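(* Let $h>w>0$ be fixed integers and let $\gamma$ be any constant between $0$ and $1$. Then there exists a constant $N>0$ depending only on $\gamma$ (with $h,w$ regarded as absolute constants), such that for all $k>N$ and any $\epsilon>0$, the following holds. If $\mathbf m(n)=(m_{h-w+1}(n),\dots,m_h(n))$ is, for each $n$, a nonnegative integer vector satisfying $\sum_{j=0}^{w-1}(w-j)m_{h-j}(n)\le kn-\epsilon n$ for all $n$, then $G\in\mathcal{M}(n,\mathbf m(n),k+1)$ asymptotically almost surely (as $n\to\infty$) either has a $(w,k)$-orientation or does not have property $\mathcal{A}(\gamma)$.
   Context: Model. $k$ is a positive integer. For a nonnegative integer vector $\mathbf m=(m_{h-w+1},\dots,m_h)$, $\mathcal{M}_{n,\mathbf m}$ is the random multihypergraph on vertex set $[n]$ with $m_i$ hyperedges of size $i$ for each $i$, where each hyperedge of size $i$ is a multiset of $i$ vertices chosen independently and uniformly at random from $[n]$ (equivalently, it is given by a uniformly random function from the disjoint union of the sets $[m_i]\times[i]$ to $[n]$; loops and multiple hyperedges are possible). $\mathcal{M}(n,\mathbf m,k+1)$ is $\mathcal{M}_{n,\mathbf m}$ restricted to (i.e. conditioned on) multihypergraphs with minimum degree at least $k+1$. Degrees, sizes and cardinalities $|x\cap S|$ are counted with multiplicity. Orientation. For a positive integer $r$, a hyperedge is $r$-oriented if exactly $r$ distinct vertices in it are marked with positive signs with respect to the hyperedge. The indegree of a vertex is the total number of positive signs it receives. A $(w,k)$-orientation of a multihypergraph $G$ with hyperedge sizes between $h-w+1$ and $h$ is a simultaneous $(w-j)$-orientation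 of each hyperedge of size $h-j$ ($0\le j\le w-1$) such that every vertex has indegree at most $k$. Property $\mathcal A(\gamma)$. A hyperedge $x$ is partially contained in a vertex set $S$ if $|x\cap S|\ge2$. $G$ has property $\mathcal{A}(\gamma)$ if for all nonempty $S\subset V(G)$ with $|S|<\gamma|V(G)|$, the number of hyperedges partially contained in $S$ is strictly less than $k|S|/(2w)$. *)

theory Defs
  imports "HOL-Probability.Probability"
begin

text \<open>Hyperedges are multisets of vertices, indexed by abstract names so that parallel
  hyperedges remain distinguishable (and can be oriented differently).\<close>

record ('v, 'e) multihypergraph =
  verts :: "'v set"
  hedges :: "'e set"
  ends :: "'e \<Rightarrow> 'v multiset"

definition degree :: "('v, 'e) multihypergraph \<Rightarrow> 'v \<Rightarrow> nat" where
  "degree G v = (\<Sum>e\<in>hedges G. count (ends G e) v)"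

definition min_degree_ge :: "nat \<Rightarrow> ('v, 'e) multihypergraph \<Rightarrow> bool" where
  "min_degree_ge d G \<longleftrightarrow> (\<forall>v\<in>verts G. d \<le> degree G v)"

text \<open>The random model. The vector $(m_{h-w+1},\dots,m_h)$ is a function \<open>m\<close> of which only the
  values at sizes in \<open>{h - w + 1..h}\<close> are used. A triple \<open>(i, a, b)\<close> is the \<open>b\<close>-th place of the
  \<open>a\<close>-th hyperedge of size \<open>i\<close>.\<close>

definition places :: "nat \<Rightarrow> nat \<Rightarrow> (nat \<Rightarrow> nat) \<Rightarrow> (nat \<times> nat \<times> nat) set" where
  "places h w m = (SIGMA i:{h - w + 1..h}. {1..m i} \<times> {1..i})"

definition multihypergraph_of ::
  "nat \<Rightarrow> nat \<Rightarrow> nat \<Rightarrow> (nat \<Rightarrow> nat) \<Rightarrow> (nat \<times> nat \<times> nat \<Rightarrow> nat) \<Rightarrow> (nat, nat \<times> nat) multihypergraph"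
where
  "multihypergraph_of h w n m f =
     \<lparr> verts = {1..n},
       hedges = (SIGMA i:{h - w + 1..h}. {1..m i}),
       ends = (\<lambda>(i, a). image_mset (\<lambda>b. f (i, a, b)) (mset_set {1..i})) \<rparr>"

definition random_multihypergraph ::
  "nat \<Rightarrow> nat \<Rightarrow> nat \<Rightarrow> (nat \<Rightarrow> nat) \<Rightarrow> (nat, nat \<times> nat) multihypergraph pmf" where
  "random_multihypergraph h w n m =
     map_pmf (multihypergraph_of h w n m) (pmf_of_set (places h w m \<rightarrow>\<^sub>E {1..n}))"

text \<open>Conditioning on minimum degree at least \<open>d\<close>; this is meaningful only if
  \<open>min_degree_feasible\<close> holds, since otherwise the conditioning event has probability zero and
  \<^const>\<open>cond_pmf\<close> is unspecified.\<close>

definition min_degree_feasible :: "nat \<Rightarrow> nat \<Rightarrow> nat \<Rightarrow> (nat \<Rightarrow> nat) \<Rightarrow> nat \<Rightarrow> bool" where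
  "min_degree_feasible h w n m d \<longleftrightarrow>
     (\<exists>G\<in>set_pmf (random_multihypergraph h w n m). min_degree_ge d G)"

definition random_multihypergraph_min_degree ::
  "nat \<Rightarrow> nat \<Rightarrow> nat \<Rightarrow> (nat \<Rightarrow> nat) \<Rightarrow> nat \<Rightarrow> (nat, nat \<times> nat) multihypergraph pmf" where
  "random_multihypergraph_min_degree h w n m d =
     cond_pmf (random_multihypergraph h w n m) {G. min_degree_ge d G}"

text \<open>A marking \<open>\<sigma>\<close> assigns to each hyperedge the set of (distinct) vertices that carry a
  positive sign with respect to it.\<close>

definition oriented :: "('v, 'e) multihypergraph \<Rightarrow> ('e \<Rightarrow> 'v set) \<Rightarrow> nat \<Rightarrow> 'e \<Rightarrow> bool" where
  "oriented G \<sigma> r e \<longleftrightarrow> \<sigma> e \<subseteq> set_mset (ends G e) \<and> card (\<sigma> e) = r"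

definition indegree :: "('v, 'e) multihypergraph \<Rightarrow> ('e \<Rightarrow> 'v set) \<Rightarrow> 'v \<Rightarrow> nat" where
  "indegree G \<sigma> v = card {e \<in> hedges G. v \<in> \<sigma> e}"

definition is_orientation ::
  "nat \<Rightarrow> nat \<Rightarrow> nat \<Rightarrow> ('v, 'e) multihypergraph \<Rightarrow> ('e \<Rightarrow> 'v set) \<Rightarrow> bool" where
  "is_orientation h w k G \<sigma> \<longleftrightarrow>
     (\<forall>e\<in>hedges G. \<exists>j<w. size (ends G e) = h - j \<and> oriented G \<sigma> (w - j) e) \<and>
     (\<forall>v\<in>verts G. indegree G \<sigma> v \<le> k)"

definition has_orientation :: "nat \<Rightarrow> nat \<Rightarrow> nat \<Rightarrow> ('v, 'e) multihypergraph \<Rightarrow> bool" where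
  "has_orientation h w k G \<longleftrightarrow> (\<exists>\<sigma>. is_orientation h w k G \<sigma>)"

definition partially_contained :: "'v multiset \<Rightarrow> 'v set \<Rightarrow> bool" where
  "partially_contained x S \<longleftrightarrow> 2 \<le> size {#v \<in># x. v \<in> S#}"

definition property_A :: "nat \<Rightarrow> nat \<Rightarrow> real \<Rightarrow> ('v, 'e) multihypergraph \<Rightarrow> bool" where
  "property_A w k \<gamma> G \<longleftrightarrow>
     (\<forall>S. S \<subseteq> verts G \<and> S \<noteq> {} \<and> real (card S) < \<gamma> * real (card (verts G)) \<longrightarrow>
        real (card {e \<in> hedges G. partially_contained (ends G e) S})
          < real k * real (card S) / (2 * real w))"

end

(*
  Write T for the complement of a vertex set S, t = |T|, n for the number of vertices, D for the sum
  of the demands and call the places of a hyperedge its vertex slots. By a Hall-type theorem an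
  orientation exists unless for some S the hyperedges cannot place k|S| + 1 of their signs outside S.

  If |S| < gamma n, property A and the absence (a.a.s.) of strongly degenerate hyperedges and of two
  hyperedges with repeated vertices sharing a vertex exclude this.

  If |S| >= gamma n and t is at least a constant fraction of n, the expected number of signs that
  cannot be placed outside S lies below k|S| by order k n, because max(0, d - j) is convex and every
  hyperedge is larger than its demand. Hoeffding's inequality gives failure probability
  exp(-c k n) in the unconditioned model. The minimum degree condition has probability at least
  (e (k + 1))^(-n), so for large k this survives both the conditioning and the union over 2^n sets.

  If t is small, then S can only be bad when D is close to k n. In that case the average degree
  exceeds (1 + 4c) k, and fewer than k t hyperedges meet T. Given the total degree x of T, the set of
  its slots is a uniformly random x-subset of all slots, so hitting few hyperedges is unlikely; this
  beats the number of sets T unless x is close to k t, and then x itself is exponentially unlikely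
  because consecutive values of its distribution have ratio bounded away from 1.
*)
theory Submission
  imports Defs "HOL-Real_Asymp.Real_Asymp"
begin

section \<open>A Hall theorem with demands and capacities\<close>

text \<open>The conditioned model is uniform on the functions from slots to vertices whose fibres
  all have at least \<open>k + 1\<close> elements, so every probability is a quotient of two counts.
  The values of such functions are dependent; three devices replace independence. (a) Comparison
  with all functions costs a factor exponential in n. This is affordable against exp(-c k n), but
  not for small T, where the bounds decay only in t. (b) The fibre condition is local to each
  vertex, so prescribing the preimage of T splits the count into two occupancy counts, whose ratios
  are found by adding or removing one slot. (c) Exchanging two slots preserves all degrees, which
  bounds coincidences once the maximum degree is capped. The threshold for k must not depend on
  epsilon. The slack epsilon n is therefore spent on the sets T with k t <= epsilon n; in the union
  over small T only t of linear order remain. For these it matters that the minimum degree exceeds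
  the capacity by one: T receives at least (k + 1) t slots, so hitting fewer than k t hyperedges
  means more than t redundant slots.\<close>

lemma trunc_diff_supermodular:
  fixes A B :: "'v set"
  assumes "finite A" "finite B"
  shows "(d - card A) + (d - card B) \<le> (d - card (A \<union> B)) + (d - card (A \<inter> B))"
    and "card A \<le> d \<Longrightarrow> card B \<le> d \<Longrightarrow> d < card (A \<union> B) \<Longrightarrow>
      (d - card A) + (d - card B) < (d - card (A \<union> B)) + (d - card (A \<inter> B))"
proof -
  \<comment> \<open>With the sum of the sizes fixed, this is convexity of
    \<open>x \<mapsto> max 0 (d - x)\<close>, which is strict across the kink at
    \<open>d\<close>.\<close>
  have "card A + card B = card (A \<union> B) + card (A \<inter> B)"
    using assms by (rule card_Un_Int)
  moreover have "card (A \<inter> B) \<le> card A" "card (A \<inter> B) \<le> card B"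
    using assms by (auto intro: card_mono)
  ultimately show "(d - card A) + (d - card B) \<le> (d - card (A \<union> B)) + (d - card (A \<inter> B))"
    and "card A \<le> d \<Longrightarrow> card B \<le> d \<Longrightarrow> d < card (A \<union> B) \<Longrightarrow>
      (d - card A) + (d - card B) < (d - card (A \<union> B)) + (d - card (A \<inter> B))"
    by linarith+
qed

text \<open>Rado's argument: shrink the candidate sets as long as the condition survives. If no element
  of \<open>N e0\<close> can be removed, then every element is missed by a tight set \<open>S\<close> with
  \<open>card (N e0 - S) \<le> d e0\<close>. By supermodularity such sets are closed under intersection,
  so \<open>N e0\<close> itself has at most \<open>d e0\<close> elements.\<close>

theorem hall_demand_capacity:
  fixes N :: "'e \<Rightarrow> 'v set" and d :: "'e \<Rightarrow> nat"
  assumes "finite E" "finite V" "\<And>e. e \<in> E \<Longrightarrow> N e \<subseteq> V"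
    and "\<And>S. S \<subseteq> V \<Longrightarrow> (\<Sum>e\<in>E. d e - card (N e - S)) \<le> k * card S"
  shows "\<exists>\<sigma>. (\<forall>e\<in>E. \<sigma> e \<subseteq> N e \<and> card (\<sigma> e) = d e) \<and> (\<forall>v\<in>V. card {e\<in>E. v \<in> \<sigma> e} \<le> k)"
  using assms(3,4)
proof (induction "\<Sum>e\<in>E. card (N e)" arbitrary: N rule: less_induct)
  case less
  note NV = less.prems(1) and H = less.prems(2)
  have fN: "finite (N e)" if "e \<in> E" for e
    using NV[OF that] assms(2) finite_subset by blast
  define \<phi> where "\<phi> S = (\<Sum>e\<in>E. d e - card (N e - S))" for S
  show ?case
  proof (cases "\<forall>e\<in>E. card (N e) \<le> d e")
    case True
    \<comment> \<open>The empty set in the condition forces \<open>card (N e) = d e\<close>, and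
      singletons then bound the number of candidate sets through a vertex; so \<open>N\<close>
      itself is the marking.\<close>
    have "(\<Sum>e\<in>E. d e - card (N e)) = 0" using H[of "{}"] by simp
    hence eq: "card (N e) = d e" if "e \<in> E" for e
      using True that assms(1) by (simp add: le_antisym)
    have "card {e\<in>E. v \<in> N e} \<le> k" if "v \<in> V" for v
    proof -
      have "card {e\<in>E. v \<in> N e} = (\<Sum>e\<in>E. if v \<in> N e then 1 else 0)"
        using assms(1) by (simp add: sum.If_cases Collect_conj_eq Int_commute)
      also have "\<dots> \<le> (\<Sum>e\<in>E. d e - card (N e - {v}))"
      proof (intro sum_mono)
        fix e assume e: "e \<in> E"
        have "card (N e) > 0" if "v \<in> N e" using that fN[OF e] card_gt_0_iff by blast
        thus "(if v \<in> N e then 1 else 0) \<le> d e - card (N e - {v})"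
          using eq[OF e] fN[OF e] by (auto simp: card_Diff_singleton_if)
      qed
      also have "\<dots> \<le> k" using H[of "{v}"] that by simp
      finally show ?thesis .
    qed
    with eq show ?thesis by (intro exI[of _ N]) auto
  next
    case False
    then obtain e0 where e0: "e0 \<in> E" "d e0 < card (N e0)" by force
    have "\<exists>x\<in>N e0. \<forall>S\<subseteq>V. (\<Sum>e\<in>E. d e - card ((N(e0 := N e0 - {x})) e - S)) \<le> k * card S"
    proof (rule ccontr)
      assume neg: "\<not> ?thesis"
      define tight where "tight S \<longleftrightarrow> S \<subseteq> V \<and> \<phi> S = k * card S \<and> card (N e0 - S) \<le> d e0" for S
      have ex: "\<exists>S. tight S \<and> x \<notin> S" if x: "x \<in> N e0" for x
      proof -
        from neg x obtain S where S: "S \<subseteq> V"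
          and viol: "k * card S < (\<Sum>e\<in>E. d e - card ((N(e0 := N e0 - {x})) e - S))" (is "_ < ?l")
          by (meson not_le)
        have l: "?l = (d e0 - card (N e0 - S - {x})) + (\<Sum>e\<in>E-{e0}. d e - card (N e - S))"
        proof -
          have "?l = (d e0 - card (N e0 - {x} - S)) + (\<Sum>e\<in>E-{e0}. d e - card ((N(e0 := N e0 - {x})) e - S))"
            using e0 assms(1) by (subst sum.remove[of _ e0]) auto
          also have "(\<Sum>e\<in>E-{e0}. d e - card ((N(e0 := N e0 - {x})) e - S)) = (\<Sum>e\<in>E-{e0}. d e - card (N e - S))"
            by (intro sum.cong) auto
          also have "N e0 - {x} - S = N e0 - S - {x}" by blast
          finally show ?thesis .
        qed
        have p: "\<phi> S = (d e0 - card (N e0 - S)) + (\<Sum>e\<in>E-{e0}. d e - card (N e - S))"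
          unfolding \<phi>_def using e0 assms(1) by (subst sum.remove[of _ e0]) auto
        have le: "\<phi> S \<le> k * card S" using H[OF S] by (simp add: \<phi>_def)
        have xS: "x \<notin> S"
        proof
          assume "x \<in> S"
          hence "N e0 - S - {x} = N e0 - S" by auto
          with l p le viol show False by simp
        qed
        hence c: "card (N e0 - S - {x}) = card (N e0 - S) - 1" "card (N e0 - S) > 0"
          using x fN[OF e0(1)] by (auto simp: card_gt_0_iff)
        have "tight S" unfolding tight_def using S c l p le viol by auto
        with xS show ?thesis by blast
      qed
      define M where "M = {S. tight S}"
      have finM: "finite M" unfolding M_def tight_def
        using assms(2) by (auto intro: finite_subset[of _ "Pow V"])
      have "N e0 \<noteq> {}" using e0(2) by auto
      hence "M \<noteq> {}" using ex M_def by blast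
      \<comment> \<open>Among the tight sets, \<open>S\<close> leaves as much of \<open>N e0\<close>
        outside as possible. Intersecting it with a tight set that misses a point of
        \<open>N e0 \<inter> S\<close> will leave even more.\<close>
      then obtain S where S: "tight S" and mx: "\<And>S'. tight S' \<Longrightarrow> card (N e0 - S') \<le> card (N e0 - S)"
        using finM Max_in[of "(\<lambda>S. card (N e0 - S)) ` M"] Max_ge[of "(\<lambda>S. card (N e0 - S)) ` M"]
        unfolding M_def by fastforce
      have "\<exists>x. x \<in> N e0 \<inter> S"
      proof (rule ccontr)
        assume "\<not> ?thesis"
        hence "N e0 - S = N e0" by auto
        with S e0(2) show False unfolding tight_def by simp
      qed
      then obtain x where x: "x \<in> N e0" "x \<in> S" by auto
      from ex[OF x(1)] obtain S' where S': "tight S'" "x \<notin> S'" by blast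
      have U: "S \<union> S' \<subseteq> V" "S \<inter> S' \<subseteq> V" using S S' unfolding tight_def by auto
      have setU: "N e - (S \<union> S') = (N e - S) \<inter> (N e - S')" "N e - (S \<inter> S') = (N e - S) \<union> (N e - S')" for e
        by auto
      have tw: "(d e - card (N e - S)) + (d e - card (N e - S')) \<le>
         (d e - card (N e - (S \<inter> S'))) + (d e - card (N e - (S \<union> S')))" if "e \<in> E" for e
        unfolding setU using fN[OF that] by (intro trunc_diff_supermodular) auto
      have cs: "k * card S + k * card S' = k * card (S \<union> S') + k * card (S \<inter> S')"
        using card_Un_Int[of S S'] S S' assms(2) unfolding tight_def
        by (metis add_mult_distrib2 finite_subset)
      have a1: "\<phi> S + \<phi> S' \<le> \<phi> (S \<inter> S') + \<phi> (S \<union> S')"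
        unfolding \<phi>_def sum.distrib[symmetric] by (intro sum_mono tw)
      have a2: "\<phi> (S \<inter> S') \<le> k * card (S \<inter> S')" "\<phi> (S \<union> S') \<le> k * card (S \<union> S')"
        using H U unfolding \<phi>_def by auto
      \<comment> \<open>Otherwise supermodularity is strict at \<open>e0\<close>, and
        \<open>S \<inter> S'\<close> or \<open>S \<union> S'\<close> violates the Hall
        condition.\<close>
      have small: "card (N e0 - (S \<inter> S')) \<le> d e0"
      proof (rule ccontr)
        assume "\<not> ?thesis"
        hence "(d e0 - card (N e0 - S)) + (d e0 - card (N e0 - S')) <
         (d e0 - card (N e0 - (S \<inter> S'))) + (d e0 - card (N e0 - (S \<union> S')))"
          unfolding setU using fN[OF e0(1)] S S'
          by (intro trunc_diff_supermodular(2)) (auto simp: tight_def setU)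
        hence "\<phi> S + \<phi> S' < \<phi> (S \<inter> S') + \<phi> (S \<union> S')"
          unfolding \<phi>_def sum.distrib[symmetric] using e0(1) assms(1) tw
          by (intro sum_strict_mono_ex1) auto
        with a2 cs S S' show False unfolding tight_def by simp
      qed
      have "tight (S \<inter> S')" unfolding tight_def using small U a1 a2 cs S S'
        by (auto simp: tight_def)
      from mx[OF this] have "card (N e0 - (S \<inter> S')) \<le> card (N e0 - S)" .
      moreover have "card (N e0 - S) < card (N e0 - (S \<inter> S'))"
        using x S' fN[OF e0(1)] by (intro psubset_card_mono) auto
      ultimately show False by simp
    qed
    then obtain x where x: "x \<in> N e0"
      and Hx: "\<And>S. S \<subseteq> V \<Longrightarrow> (\<Sum>e\<in>E. d e - card ((N(e0 := N e0 - {x})) e - S)) \<le> k * card S"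
      by blast
    let ?N = "N(e0 := N e0 - {x})"
    have "(\<Sum>e\<in>E. card (?N e)) < (\<Sum>e\<in>E. card (N e))"
      using e0(1) assms(1) card_Diff1_less[OF fN[OF e0(1)] x]
      by (intro sum_strict_mono_ex1) (auto simp del: card_Diff_insert)
    moreover have "?N e \<subseteq> V" if "e \<in> E" for e
      using NV[OF that] NV[OF e0(1)] by auto
    ultimately obtain \<sigma> where
      "(\<forall>e\<in>E. \<sigma> e \<subseteq> ?N e \<and> card (\<sigma> e) = d e) \<and> (\<forall>v\<in>V. card {e\<in>E. v \<in> \<sigma> e} \<le> k)"
      using less.hyps[OF _ _ Hx] by blast
    thus ?thesis by (intro exI[of _ \<sigma>]) (auto split: if_splits)
  qed
qed

section \<open>Occupancy counts\<close>

definition occ :: "nat \<Rightarrow> 'p set \<Rightarrow> 'v set \<Rightarrow> ('p \<Rightarrow> 'v) set" where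
  "occ d P V = {f \<in> P \<rightarrow>\<^sub>E V. \<forall>v\<in>V. d \<le> card {p \<in> P. f p = v}}"

text \<open>For \<open>d > 0\<close> this is t! times the d-associated Stirling number of the second
  kind.\<close>

definition nocc :: "nat \<Rightarrow> nat \<Rightarrow> nat \<Rightarrow> nat" where
  "nocc d x t = card (occ d {..<x} {..<t})"

lemma finite_occ: "finite P \<Longrightarrow> finite V \<Longrightarrow> finite (occ d P V)"
  unfolding occ_def by (rule finite_subset[of _ "P \<rightarrow>\<^sub>E V"]) (auto intro: finite_PiE)

lemma card_occ_le:
  assumes "finite P'" "finite V'" "bij_betw g P' P" "bij_betw q V V'"
  shows "card (occ d P V) \<le> card (occ d P' V')"
proof (rule card_inj_on_le[where f = "\<lambda>f. \<lambda>p\<in>P'. q (f (g p))"])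
  have gP: "g ` P' = P" and gi: "inj_on g P'" and qV: "q ` V = V'" and qi: "inj_on q V"
    using assms(3,4) by (auto simp: bij_betw_def)
  show "finite (occ d P' V')" using assms by (simp add: finite_occ)
  show "inj_on (\<lambda>f. \<lambda>p\<in>P'. q (f (g p))) (occ d P V)"
  proof (rule inj_onI)
    fix f1 f2 assume f: "f1 \<in> occ d P V" "f2 \<in> occ d P V"
      and eq: "(\<lambda>p\<in>P'. q (f1 (g p))) = (\<lambda>p\<in>P'. q (f2 (g p)))"
    have "f1 p = f2 p" if "p \<in> P" for p
    proof -
      obtain p' where p': "p' \<in> P'" "p = g p'" using \<open>p \<in> P\<close> gP by auto
      have "q (f1 p) = q (f2 p)" using fun_cong[OF eq, of p'] p' by simp
      thus ?thesis using qi f that unfolding occ_def by (auto dest: inj_onD)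
    qed
    thus "f1 = f2" using f unfolding occ_def by (auto intro: PiE_ext)
  qed
  show "(\<lambda>f. \<lambda>p\<in>P'. q (f (g p))) ` occ d P V \<subseteq> occ d P' V'"
  proof (intro image_subsetI)
    fix f assume f: "f \<in> occ d P V"
    have fV: "f p \<in> V" if "p \<in> P" for p using f that unfolding occ_def by auto
    have "d \<le> card {p \<in> P'. (\<lambda>p\<in>P'. q (f (g p))) p = v'}" if "v' \<in> V'" for v'
    proof -
      obtain v where v: "v \<in> V" "v' = q v" using \<open>v' \<in> V'\<close> qV by auto
      have img: "g ` {p \<in> P'. (\<lambda>p\<in>P'. q (f (g p))) p = v'} = {p \<in> P. f p = v}"
      proof (intro equalityI subsetI)
        fix x assume "x \<in> g ` {p \<in> P'. (\<lambda>p\<in>P'. q (f (g p))) p = v'}"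
        then obtain p where p: "p \<in> P'" "x = g p" "q (f (g p)) = q v" using v by auto
        moreover have "g p \<in> P" using p gP by blast
        ultimately show "x \<in> {p \<in> P. f p = v}"
          using inj_onD[OF qi p(3) fV[of "g p"] v(1)] by auto
      next
        fix x assume x: "x \<in> {p \<in> P. f p = v}"
        then obtain p where "p \<in> P'" "x = g p" using gP by blast
        with x show "x \<in> g ` {p \<in> P'. (\<lambda>p\<in>P'. q (f (g p))) p = v'}" using v by auto
      qed
      have inj: "inj_on g {p \<in> P'. (\<lambda>p\<in>P'. q (f (g p))) p = v'}"
        by (rule inj_on_subset[OF gi]) auto
      have "card {p \<in> P'. (\<lambda>p\<in>P'. q (f (g p))) p = v'} = card {p \<in> P. f p = v}"
        using card_image[OF inj] unfolding img by (rule sym)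
      thus ?thesis using f v(1) unfolding occ_def by auto
    qed
    moreover have "(\<lambda>p\<in>P'. q (f (g p))) \<in> P' \<rightarrow>\<^sub>E V'"
      using fV gP qV by auto
    ultimately show "(\<lambda>p\<in>P'. q (f (g p))) \<in> occ d P' V'" unfolding occ_def by blast
  qed
qed

lemma card_occ:
  assumes "finite P" "finite V"
  shows "card (occ d P V) = nocc d (card P) (card V)"
proof -
  obtain g where g: "bij_betw g P {..<card P}"
    using assms ex_bij_betw_finite_nat lessThan_atLeast0 by metis
  obtain q where q: "bij_betw q V {..<card V}"
    using assms ex_bij_betw_finite_nat lessThan_atLeast0 by metis
  show ?thesis unfolding nocc_def
    using card_occ_le[OF _ _ bij_betw_inv_into[OF g] q, of d]
      card_occ_le[OF _ _ g bij_betw_inv_into[OF q], of d] assms by (simp add: le_antisym)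
qed

text \<open>The lower bound is imposed bin by bin, so the restrictions to \<open>X\<close> and
  \<open>P - X\<close> can be chosen independently. The count depends on \<open>X\<close> only
  through its size: given its size, the preimage of \<open>T\<close> is a uniformly random set of
  places.\<close>

lemma card_occ_preimage:
  assumes "finite P" "finite V" "T \<subseteq> V" "X \<subseteq> P"
  shows "card {f \<in> occ d P V. {p \<in> P. f p \<in> T} = X} = nocc d (card X) (card T) * nocc d (card P - card X) (card V - card T)"
proof -
  have bij: "bij_betw (\<lambda>f. (restrict f X, restrict f (P - X))) {f \<in> occ d P V. {p \<in> P. f p \<in> T} = X}
     (occ d X T \<times> occ d (P - X) (V - T))"
  proof (rule bij_betwI[where g = "\<lambda>(a, b). \<lambda>p. if p \<in> X then a p else b p"])
    show "(\<lambda>f. (restrict f X, restrict f (P - X))) \<in> {f \<in> occ d P V. {p \<in> P. f p \<in> T} = X} \<rightarrow>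
        occ d X T \<times> occ d (P - X) (V - T)"
    proof
      fix f assume "f \<in> {f \<in> occ d P V. {p \<in> P. f p \<in> T} = X}"
      hence f: "f \<in> occ d P V" and X: "X = {p \<in> P. f p \<in> T}" by auto
      have a: "{p \<in> X. restrict f X p = v} = {p \<in> P. f p = v}" if "v \<in> T" for v
        using X that by auto
      have b: "{p \<in> P - X. restrict f (P - X) p = v} = {p \<in> P. f p = v}" if "v \<in> V - T" for v
        using X that by auto
      have "restrict f X \<in> occ d X T" "restrict f (P - X) \<in> occ d (P - X) (V - T)"
        using f assms a b unfolding occ_def by (auto simp: X PiE_def Pi_def)
      thus "(restrict f X, restrict f (P - X)) \<in> occ d X T \<times> occ d (P - X) (V - T)" by simp
    qed
    show "(\<lambda>(a, b). \<lambda>p. if p \<in> X then a p else b p) \<in> occ d X T \<times> occ d (P - X) (V - T) \<rightarrow>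
        {f \<in> occ d P V. {p \<in> P. f p \<in> T} = X}"
    proof
      fix ab assume "ab \<in> occ d X T \<times> occ d (P - X) (V - T)"
      then obtain a b where ab: "ab = (a, b)" and a: "a \<in> occ d X T" and b: "b \<in> occ d (P - X) (V - T)" by auto
      define f where "f = (\<lambda>p. if p \<in> X then a p else b p)"
      have aT: "a p \<in> T" if "p \<in> X" for p using a that unfolding occ_def by auto
      have bT: "b p \<in> V - T" if "p \<in> P - X" for p using b that unfolding occ_def by blast
      have "f \<in> P \<rightarrow>\<^sub>E V"
        using a b aT bT assms(3,4) unfolding f_def occ_def by (auto simp: PiE_def extensional_def subset_iff)
      moreover have "{p \<in> P. f p \<in> T} = X"
        using aT bT assms unfolding f_def by auto
      moreover have "d \<le> card {p \<in> P. f p = v}" if v: "v \<in> V" for v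
      proof (cases "v \<in> T")
        case True
        have "{p \<in> P. f p = v} = {p \<in> X. a p = v}"
          using True bT assms(3,4) unfolding f_def by (fastforce split: if_splits)
        thus ?thesis using a True unfolding occ_def by auto
      next
        case False
        have "{p \<in> P. f p = v} = {p \<in> P - X. b p = v}"
          using False aT assms(3,4) unfolding f_def by (fastforce split: if_splits)
        thus ?thesis using b False v unfolding occ_def by auto
      qed
      ultimately have "f \<in> {f \<in> occ d P V. {p \<in> P. f p \<in> T} = X}" unfolding occ_def by auto
      thus "(case ab of (a, b) \<Rightarrow> \<lambda>p. if p \<in> X then a p else b p) \<in> {f \<in> occ d P V. {p \<in> P. f p \<in> T} = X}"
        unfolding ab f_def by simp
    qed
    show "(case (restrict f X, restrict f (P - X)) of (a, b) \<Rightarrow> \<lambda>p. if p \<in> X then a p else b p) = f"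
      if "f \<in> {f \<in> occ d P V. {p \<in> P. f p \<in> T} = X}" for f
      using that assms(4) unfolding occ_def by (auto simp: fun_eq_iff PiE_def extensional_def)
    show "(\<lambda>f. (restrict f X, restrict f (P - X))) (case ab of (a, b) \<Rightarrow> \<lambda>p. if p \<in> X then a p else b p) = ab"
      if "ab \<in> occ d X T \<times> occ d (P - X) (V - T)" for ab
      using that unfolding occ_def by (auto simp: fun_eq_iff PiE_def extensional_def restrict_def)
  qed
  hence "card {f \<in> occ d P V. {p \<in> P. f p \<in> T} = X} = card (occ d X T) * card (occ d (P - X) (V - T))"
    using bij_betw_same_card[OF bij] by (simp only: card_cartesian_product)
  thus ?thesis using assms finite_subset[OF assms(3,2)] finite_subset[OF assms(4,1)]
    by (simp add: card_occ card_Diff_subset)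
qed

lemma card_occ_preimage_pred:
  assumes "finite P" "finite V" "T \<subseteq> V"
  shows "card {f \<in> occ d P V. Q {p \<in> P. f p \<in> T}} =
    (\<Sum>X | X \<subseteq> P \<and> Q X. nocc d (card X) (card T) * nocc d (card P - card X) (card V - card T))"
proof -
  have "{f \<in> occ d P V. Q {p \<in> P. f p \<in> T}} =
      (\<Union>X\<in>{X. X \<subseteq> P \<and> Q X}. {f \<in> occ d P V. {p \<in> P. f p \<in> T} = X})" by auto
  also have "card \<dots> = (\<Sum>X | X \<subseteq> P \<and> Q X. card {f \<in> occ d P V. {p \<in> P. f p \<in> T} = X})"
    using assms by (intro card_UN_disjoint) (auto simp: finite_occ intro: finite_subset[of _ "Pow P"])
  also have "\<dots> = (\<Sum>X | X \<subseteq> P \<and> Q X. nocc d (card X) (card T) * nocc d (card P - card X) (card V - card T))"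
    using assms by (intro sum.cong refl card_occ_preimage) auto
  finally show ?thesis .
qed

text \<open>A place in a bin above the minimum can be deleted, and conversely a new place can be put
  into any bin. This links the counts for \<open>y\<close> and \<open>y - 1\<close> places.\<close>

lemma card_occ_loose:
  assumes "finite P" "finite V" "p \<in> P"
  shows "card {f \<in> occ d P V. d < card {q \<in> P. f q = f p}} = card V * nocc d (card P - 1) (card V)"
proof -
  have ins: "P = insert p (P - {p})" using assms by auto
  have split: "card {q \<in> P. g q = v} = card {q \<in> P - {p}. g q = v} + (if g p = v then 1 else 0)"
    for g :: "'a \<Rightarrow> 'b" and v
  proof (cases "g p = v")
    case True
    have "{q \<in> P. g q = v} = insert p {q \<in> P - {p}. g q = v}" using True assms by auto
    moreover have "card (insert p {q \<in> P - {p}. g q = v}) = Suc (card {q \<in> P - {p}. g q = v})"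
      using assms by (intro card_insert_disjoint) auto
    ultimately show ?thesis using True by simp
  next
    case False
    hence "{q \<in> P. g q = v} = {q \<in> P - {p}. g q = v}" by auto
    thus ?thesis using False by simp
  qed
  have bij: "bij_betw (\<lambda>f. (f p, restrict f (P - {p}))) {f \<in> occ d P V. d < card {q \<in> P. f q = f p}}
     (V \<times> occ d (P - {p}) V)"
  proof (rule bij_betwI[where g = "\<lambda>(v, g). g(p := v)"])
    show "(\<lambda>f. (f p, restrict f (P - {p}))) \<in> {f \<in> occ d P V. d < card {q \<in> P. f q = f p}} \<rightarrow> V \<times> occ d (P - {p}) V"
    proof
      fix f assume "f \<in> {f \<in> occ d P V. d < card {q \<in> P. f q = f p}}"
      hence f: "f \<in> occ d P V" and l: "d < card {q \<in> P. f q = f p}" by auto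
      have "d \<le> card {q \<in> P - {p}. restrict f (P - {p}) q = v}" if "v \<in> V" for v
      proof -
        have "{q \<in> P - {p}. restrict f (P - {p}) q = v} = {q \<in> P - {p}. f q = v}" by auto
        moreover have "d \<le> card {q \<in> P. f q = v}" using f that unfolding occ_def by auto
        ultimately show ?thesis using split[of f v] l by (cases "f p = v") auto
      qed
      thus "(f p, restrict f (P - {p})) \<in> V \<times> occ d (P - {p}) V"
        using f assms unfolding occ_def by auto
    qed
    show "(\<lambda>(v, g). g(p := v)) \<in> V \<times> occ d (P - {p}) V \<rightarrow> {f \<in> occ d P V. d < card {q \<in> P. f q = f p}}"
    proof
      fix vg assume "vg \<in> V \<times> occ d (P - {p}) V"
      then obtain v g where vg: "vg = (v, g)" "v \<in> V" and g: "g \<in> occ d (P - {p}) V" by auto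
      have eq: "{q \<in> P - {p}. (g(p := v)) q = u} = {q \<in> P - {p}. g q = u}" for u by auto
      have ge: "d \<le> card {q \<in> P - {p}. g q = u}" if "u \<in> V" for u
        using g that unfolding occ_def by auto
      have "d < card {q \<in> P. (g(p := v)) q = (g(p := v)) p}"
        using split[of "g(p := v)" v] ge[OF vg(2)] unfolding eq by simp
      moreover have "d \<le> card {q \<in> P. (g(p := v)) q = u}" if "u \<in> V" for u
        using split[of "g(p := v)" u] ge[OF that] unfolding eq by linarith
      moreover have "g(p := v) \<in> P \<rightarrow>\<^sub>E V"
        using g vg(2) unfolding occ_def by (subst ins) (auto intro!: PiE_fun_upd simp del: insert_Diff_single)
      ultimately show "(case vg of (v, g) \<Rightarrow> g(p := v)) \<in> {f \<in> occ d P V. d < card {q \<in> P. f q = f p}}"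
        unfolding vg occ_def by (simp del: fun_upd_apply)
    qed
    show "(case (f p, restrict f (P - {p})) of (v, g) \<Rightarrow> g(p := v)) = f"
      if "f \<in> {f \<in> occ d P V. d < card {q \<in> P. f q = f p}}" for f
      using that assms unfolding occ_def by (auto simp: fun_eq_iff PiE_def extensional_def)
    show "(\<lambda>f. (f p, restrict f (P - {p}))) (case vg of (v, g) \<Rightarrow> g(p := v)) = vg"
      if "vg \<in> V \<times> occ d (P - {p}) V" for vg
      using that unfolding occ_def by (auto simp: fun_eq_iff PiE_def extensional_def restrict_def)
  qed
  hence "card {f \<in> occ d P V. d < card {q \<in> P. f q = f p}} = card V * card (occ d (P - {p}) V)"
    using bij_betw_same_card[OF bij] by (simp only: card_cartesian_product)
  thus ?thesis using assms by (simp add: card_occ)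
qed

section \<open>Lower bounds for occupancy counts\<close>

lemma nocc_Suc_ge: "N * nocc d y N \<le> nocc d (Suc y) N"
proof -
  have "N * nocc d y N = card {f \<in> occ d {..<Suc y} {..<N}. d < card {q \<in> {..<Suc y}. f q = f y}}"
    by (subst card_occ_loose) auto
  also have "\<dots> \<le> card (occ d {..<Suc y} {..<N})"
    by (intro card_mono finite_occ) auto
  finally show ?thesis by (simp add: nocc_def)
qed

lemma nocc_add_ge: "N ^ j * nocc d y N \<le> nocc d (y + j) N"
proof (induction j)
  case (Suc j)
  have "N ^ Suc j * nocc d y N \<le> N * nocc d (y + j) N" using Suc by (simp add: mult.assoc)
  also have "\<dots> \<le> nocc d (y + Suc j) N" using nocc_Suc_ge[of N d "y + j"] by simp
  finally show ?case .
qed simp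

lemma sum_card_fibres:
  assumes "finite P" "finite V" "f \<in> P \<rightarrow> V"
  shows "(\<Sum>v\<in>V. card {p \<in> P. f p = v}) = card P"
proof -
  have "card P = card (\<Union>v\<in>V. {p \<in> P. f p = v})" using assms by (intro arg_cong[of _ _ card]) auto
  also have "\<dots> = (\<Sum>v\<in>V. card {p \<in> P. f p = v})" using assms by (intro card_UN_disjoint) auto
  finally show ?thesis ..
qed

lemma occ_card_ge:
  assumes "finite P" "finite V" "f \<in> occ d P V"
  shows "d * card V \<le> card P"
proof -
  have "d * card V = (\<Sum>v\<in>V. d)" by simp
  also have "\<dots> \<le> (\<Sum>v\<in>V. card {p \<in> P. f p = v})"
    using assms unfolding occ_def by (intro sum_mono) auto
  also have "\<dots> = card P" using assms unfolding occ_def by (intro sum_card_fibres) auto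
  finally show ?thesis .
qed

text \<open>A multinomial coefficient: it counts the functions with all fibres of size exactly
  \<open>d\<close>. The induction peels off the last bin.\<close>

lemma nocc_fact_ge: "fact (d * N) \<le> nocc d (d * N) N * fact d ^ N"
proof (induction N)
  case 0
  have "(\<lambda>_. undefined) \<in> occ d {..<(0::nat)} {..<(0::nat)}" unfolding occ_def by auto
  hence "nocc d 0 0 > 0" unfolding nocc_def by (subst card_gt_0_iff) (auto simp: finite_occ)
  thus ?case by simp
next
  case (Suc N)
  let ?P = "{..<d * Suc N}" and ?V = "{..<Suc N}"
  have one: "nocc d d 1 \<ge> 1"
  proof -
    have "(\<lambda>p\<in>{..<d}. 0) \<in> occ d {..<d} {..<Suc 0}" unfolding occ_def by auto
    hence "card (occ d {..<d} {..<Suc 0}) > 0" by (subst card_gt_0_iff) (auto simp: finite_occ)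
    thus ?thesis by (simp add: nocc_def)
  qed
  have "((d * Suc N) choose d) * nocc d (d * N) N =
      (\<Sum>X | X \<subseteq> ?P \<and> card X = d. nocc d (d * N) N)"
    by (simp add: n_subsets)
  also have "\<dots> \<le> (\<Sum>X | X \<subseteq> ?P \<and> card X = d. nocc d (card X) (card {N}) * nocc d (card ?P - card X) (card ?V - card {N}))"
    using one by (intro sum_mono) (auto simp: Suc_le_eq)
  also have "\<dots> = card {f \<in> occ d ?P ?V. card {p \<in> ?P. f p \<in> {N}} = d}"
    by (subst card_occ_preimage_pred) auto
  also have "\<dots> \<le> nocc d (d * Suc N) (Suc N)"
    unfolding nocc_def by (intro card_mono finite_occ) auto
  finally have le: "((d * Suc N) choose d) * nocc d (d * N) N \<le> nocc d (d * Suc N) (Suc N)" .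
  have "fact (d * Suc N) = fact d * fact (d * N) * ((d * Suc N) choose d)"
    using binomial_fact_lemma[of d "d * Suc N"] by simp
  also have "\<dots> \<le> fact d * (nocc d (d * N) N * fact d ^ N) * ((d * Suc N) choose d)"
    using Suc by (intro mult_mono) auto
  also have "\<dots> = (((d * Suc N) choose d) * nocc d (d * N) N) * fact d ^ Suc N" by simp
  also have "\<dots> \<le> nocc d (d * Suc N) (Suc N) * fact d ^ Suc N"
    using le by (rule mult_right_mono) simp
  finally show ?case .
qed

lemma fact_ge_exp: "(real n / exp 1) ^ n \<le> fact n"
proof -
  have "real n ^ n / fact n \<le> exp (real n)"
    using exp_converges[of "real n"] sum_le_suminf[of "\<lambda>i. real n ^ i /\<^sub>R fact i" "{n}"]
    by (auto simp: sums_iff divide_inverse mult.commute summable_exp)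
  thus ?thesis by (simp add: power_divide exp_of_nat_mult[symmetric] field_simps flip: exp_of_nat_mult)
qed

text \<open>The induction step is (1 + 1/n)^(n+1) >= e. The factor \<open>exp 1 * real n\<close>
  becomes the base \<open>exp 1 * real d\<close> of \<open>nocc_ge\<close>.\<close>

lemma fact_le_exp:
  assumes "n > 0"
  shows "fact n \<le> exp 1 * real n * (real n / exp 1) ^ n"
  using assms
proof (induction n rule: nat_induct_non_zero)
  case 1
  then show ?case by simp
next
  case (Suc n)
  have pos: "real n > 0" using Suc by simp
  have "1 / real (Suc n) \<le> ln (1 + 1 / real n)"
  proof -
    have "ln (real n / real (Suc n)) \<le> real n / real (Suc n) - 1" using pos by (intro ln_le_minus_one) auto
    also have "real n / real (Suc n) - 1 = - (1 / real (Suc n))" by (simp add: field_simps)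
    also have "ln (real n / real (Suc n)) = - ln (1 + 1 / real n)"
      using pos by (subst ln_inverse[symmetric]) (auto simp: field_simps)
    finally show ?thesis by simp
  qed
  hence "exp (real (Suc n) * (1 / real (Suc n))) \<le> exp (real (Suc n) * ln (1 + 1 / real n))"
    by (subst exp_le_cancel_iff) (intro mult_left_mono, auto)
  also have "\<dots> = (1 + 1 / real n) ^ Suc n" using pos
    by (subst exp_of_nat_mult, subst exp_ln) (auto simp: add_pos_pos)
  also have "1 + 1 / real n = real (Suc n) / real n" using pos by (simp add: field_simps)
  finally have "exp 1 * real n ^ Suc n \<le> real (Suc n) ^ Suc n"
    using pos by (simp add: power_divide pos_le_divide_eq del: power_Suc)
  hence key: "real n * real n ^ n \<le> real (Suc n) ^ Suc n / exp 1" by (simp add: field_simps)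
  have "fact (Suc n) = real (Suc n) * fact n" by simp
  also have "\<dots> \<le> real (Suc n) * (exp 1 * real n * (real n / exp 1) ^ n)"
    using Suc by (intro mult_left_mono) auto
  also have "\<dots> = real (Suc n) * exp 1 * (real n * real n ^ n) / exp 1 ^ n" by (simp add: power_divide)
  also have "\<dots> \<le> real (Suc n) * exp 1 * (real (Suc n) ^ Suc n / exp 1) / exp 1 ^ n"
    using key by (intro divide_right_mono mult_left_mono) auto
  also have "\<dots> = exp 1 * real (Suc n) * (real (Suc n) / exp 1) ^ Suc n"
    by (simp add: power_divide)
  finally show ?case .
qed

text \<open>The multinomial coefficient is evaluated by the two factorial bounds, whose powers of
  \<open>d / e\<close> cancel; the remaining \<open>y - d * N\<close> places go anywhere. Read as a
  probability, the minimum degree event has probability at least (e d)^(-N).\<close>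

lemma nocc_ge:
  assumes "d > 0" "N > 0" "d * N \<le> y"
  shows "real N ^ y \<le> (exp 1 * real d) ^ N * real (nocc d y N)"
proof -
  have "(real (d * N) / exp 1) ^ (d * N) \<le> real (fact (d * N))"
    using fact_ge_exp[of "d * N"] by simp
  also have "\<dots> \<le> real (nocc d (d * N) N * fact d ^ N)"
    using nocc_fact_ge[of d N] by (simp only: of_nat_le_iff)
  also have "\<dots> = real (nocc d (d * N) N) * fact d ^ N" by simp
  also have "\<dots> \<le> real (nocc d (d * N) N) * (exp 1 * real d * (real d / exp 1) ^ d) ^ N"
    using fact_le_exp[OF assms(1)] by (intro mult_left_mono power_mono) auto
  also have "\<dots> = (exp 1 * real d) ^ N * real (nocc d (d * N) N) * (real d / exp 1) ^ (d * N)"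
    by (simp add: power_mult_distrib power_mult)
  also have "(real (d * N) / exp 1) ^ (d * N) = real N ^ (d * N) * (real d / exp 1) ^ (d * N)"
    by (simp add: power_divide power_mult_distrib)
  finally have "real N ^ (d * N) \<le> (exp 1 * real d) ^ N * real (nocc d (d * N) N)"
    using assms by (subst (asm) mult_le_cancel_right_pos) auto
  hence "real N ^ (y - d * N) * real N ^ (d * N) \<le> real N ^ (y - d * N) * ((exp 1 * real d) ^ N * real (nocc d (d * N) N))"
    by (intro mult_left_mono) auto
  also have "\<dots> = (exp 1 * real d) ^ N * real (N ^ (y - d * N) * nocc d (d * N) N)" by simp
  also have "\<dots> \<le> (exp 1 * real d) ^ N * real (nocc d y N)"
    using nocc_add_ge[of N "y - d * N" d "d * N"] assms(3) by (intro mult_left_mono of_nat_mono) auto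
  also have "real N ^ (y - d * N) * real N ^ (d * N) = real N ^ y"
    using assms by (simp flip: power_add)
  finally show ?thesis .
qed


text \<open>Chernoff's method as a count: a function gets weight \<open>\<theta>\<close> for each
  place in \<open>U\<close>, and the total weight factorises over the places.\<close>

lemma card_few_balls:
  fixes \<theta> :: real
  assumes "finite P" "finite V" "U \<subseteq> V" "0 < \<theta>" "\<theta> \<le> 1"
  shows "real (card {f \<in> P \<rightarrow>\<^sub>E V. card {p \<in> P. f p \<in> U} \<le> s}) * \<theta> ^ s
    \<le> (real (card V) - (1 - \<theta>) * real (card U)) ^ card P"
proof -
  let ?A = "{f \<in> P \<rightarrow>\<^sub>E V. card {p \<in> P. f p \<in> U} \<le> s}"
  let ?g = "\<lambda>v. if v \<in> U then \<theta> else 1"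
  have fin: "finite (P \<rightarrow>\<^sub>E V)" using assms by (auto intro: finite_PiE)
  have pr: "(\<Prod>p\<in>P. ?g (f p)) = \<theta> ^ card {p \<in> P. f p \<in> U}" for f
  proof -
    have "(\<Prod>p\<in>P. ?g (f p)) = (\<Prod>p\<in>{p \<in> P. f p \<in> U}. \<theta>)"
      using assms(1) by (intro prod.mono_neutral_cong_right) auto
    thus ?thesis by simp
  qed
  have "real (card ?A) * \<theta> ^ s = (\<Sum>f\<in>?A. \<theta> ^ s)" by simp
  also have "\<dots> \<le> (\<Sum>f\<in>?A. \<Prod>p\<in>P. ?g (f p))"
    unfolding pr using assms by (intro sum_mono power_decreasing) auto
  also have "\<dots> \<le> (\<Sum>f\<in>P \<rightarrow>\<^sub>E V. \<Prod>p\<in>P. ?g (f p))"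
    using fin assms by (intro sum_mono2) (auto intro!: prod_nonneg)
  also have "\<dots> = (\<Prod>p\<in>P. \<Sum>v\<in>V. ?g v)"
    using assms by (subst prod_sum_PiE) auto
  also have "(\<Sum>v\<in>V. ?g v) = (\<Sum>v\<in>V. 1 - (1 - \<theta>) * indicator U v)"
    by (intro sum.cong) auto
  also have "\<dots> = real (card V) - (1 - \<theta>) * real (card U)"
    using assms(2,3) by (simp add: sum_subtractf indicator_def sum.If_cases Int_absorb1 flip: sum_distrib_left)
  finally show ?thesis by simp
qed

section \<open>Bins at the minimum and ratios of consecutive occupancy counts\<close>

definition tight_bins :: "nat \<Rightarrow> 'p set \<Rightarrow> 'v set \<Rightarrow> ('p \<Rightarrow> 'v) \<Rightarrow> 'v set" where
  "tight_bins d P V f = {v \<in> V. card {p \<in> P. f p = v} = d}"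

text \<open>A lower tail event: a bin receives on average at least (1 + 3c) k places, but those of
  \<open>U\<close> only k + 1.\<close>

lemma card_tight_superset:
  fixes c :: real and k :: nat
  assumes "finite P" "finite V" "V \<noteq> {}" "U \<subseteq> V" "0 < c" "c \<le> 1"
    and "(1 + 3 * c) * real k * real (card V) \<le> real (card P)"
  shows "real (card {f \<in> P \<rightarrow>\<^sub>E V. card {p \<in> P. f p \<in> U} \<le> (k + 1) * card U})
    \<le> real (card V) ^ card P * exp ((1 - c\<^sup>2 * real k) * real (card U))"
proof -
  let ?A = "{f \<in> P \<rightarrow>\<^sub>E V. card {p \<in> P. f p \<in> U} \<le> (k + 1) * card U}"
  define N u y where "N = real (card V)" and "u = real (card U)" and "y = real (card P)"
  have N: "N > 0" using assms by (simp add: N_def card_gt_0_iff)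
  have u: "0 \<le> u" "u \<le> N" using assms card_mono unfolding u_def N_def by auto
  \<comment> \<open>With this weight the exponent per bin of \<open>U\<close> is at most c (k + 1) -
    c (1 + 3c) k / (1 + c) = c - 2 c^2 k / (1 + c), hence at most 1 - c^2 k.\<close>
  define \<theta> where "\<theta> = 1 / (1 + c)"
  have \<theta>: "0 < \<theta>" "\<theta> \<le> 1" "1 - \<theta> = c / (1 + c)" using assms unfolding \<theta>_def by (auto simp: field_simps)
  let ?s = "(k + 1) * card U"
  have "real (card ?A) * \<theta> ^ ?s \<le> (N - (1 - \<theta>) * u) ^ card P"
    unfolding N_def u_def using assms \<theta> by (intro card_few_balls) auto
  also have "N - (1 - \<theta>) * u = N * (1 + (- ((1 - \<theta>) * u / N)))" using N by (simp add: field_simps)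
  also have "\<dots> ^ card P \<le> (N * exp (- ((1 - \<theta>) * u / N))) ^ card P"
  proof (intro power_mono mult_left_mono exp_ge_add_one_self mult_nonneg_nonneg)
    have "(1 - \<theta>) * u \<le> 1 * N" using u \<theta> by (intro mult_mono) auto
    thus "0 \<le> 1 + (- ((1 - \<theta>) * u / N))" using N by (simp add: field_simps)
  qed (use N in auto)
  also have "\<dots> = N ^ card P * exp (- ((1 - \<theta>) * u * y / N))"
    by (simp add: power_mult_distrib y_def mult.commute flip: exp_of_nat_mult)
  finally have 1: "real (card ?A) * \<theta> ^ ?s \<le> N ^ card P * exp (- ((1 - \<theta>) * u * y / N))" .
  have "(1 + c) ^ ?s \<le> exp c ^ ?s" using assms by (intro power_mono exp_ge_add_one_self) auto
  also have "\<dots> = exp (c * ((real k + 1) * u))"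
    unfolding u_def by (simp add: mult.commute algebra_simps flip: exp_of_nat_mult)
  finally have 2: "(1 + c) ^ ?s \<le> exp (c * ((real k + 1) * u))" .
  have "real (card ?A) = (real (card ?A) * \<theta> ^ ?s) * (1 + c) ^ ?s"
    using assms unfolding \<theta>_def by (simp add: power_divide)
  also have "\<dots> \<le> (N ^ card P * exp (- ((1 - \<theta>) * u * y / N))) * exp (c * ((real k + 1) * u))"
    by (intro mult_mono 1 2) (use N assms(5) in simp_all)
  also have "\<dots> = N ^ card P * exp (c * ((real k + 1) * u) - (1 - \<theta>) * u * y / N)"
    by (simp add: exp_diff exp_minus field_simps)
  also have "\<dots> \<le> N ^ card P * exp ((1 - c\<^sup>2 * real k) * u)"
  proof -
    have "(1 + 3 * c) * real k \<le> y / N" using assms(7) N by (simp add: field_simps N_def y_def)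
    hence "(1 - \<theta>) * u * ((1 + 3 * c) * real k) \<le> (1 - \<theta>) * u * (y / N)"
      using u \<theta>(2) by (intro mult_left_mono mult_nonneg_nonneg) auto
    hence "c * ((real k + 1) * u) - (1 - \<theta>) * u * y / N \<le> c * ((real k + 1) * u) - (1 - \<theta>) * u * ((1 + 3 * c) * real k)"
      by simp
    also have "\<dots> = u * (c * (real k + 1) - (1 - \<theta>) * ((1 + 3 * c) * real k))"
      by (simp add: algebra_simps)
    also have "c * (real k + 1) - (1 - \<theta>) * ((1 + 3 * c) * real k) = c - 2 * c\<^sup>2 * real k / (1 + c)"
      unfolding \<theta>(3) using assms by (simp add: field_simps power2_eq_square)
    also have "u * \<dots> \<le> u * (1 - c\<^sup>2 * real k)"
    proof (intro mult_left_mono u)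
      have "c\<^sup>2 * real k * (1 + c) \<le> c\<^sup>2 * real k * 2" using assms by (intro mult_left_mono) auto
      hence "c\<^sup>2 * real k \<le> 2 * c\<^sup>2 * real k / (1 + c)" using assms by (simp add: field_simps)
      thus "c - 2 * c\<^sup>2 * real k / (1 + c) \<le> 1 - c\<^sup>2 * real k" using assms by linarith
    qed
    finally show ?thesis using N by (intro mult_left_mono) (auto simp: mult.commute)
  qed
  finally show ?thesis unfolding N_def u_def .
qed

text \<open>The crude lower bound \<open>nocc_ge\<close> loses a factor \<open>(e (k + 1))\<^sup>N\<close>, which the exponential
  estimate \<open>card_tight_superset\<close> beats once \<open>k\<close> is large.\<close>

lemma card_many_tight:
  fixes c \<beta> :: real and k :: nat
  assumes "finite P" "finite V" "V \<noteq> {}" "0 < c" "c \<le> 1" "0 < \<beta>" "\<beta> \<le> 1"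
    and "(1 + 3 * c) * real k * real (card V) \<le> real (card P)"
    and "1 \<le> c\<^sup>2 * real k"
    and "2 * exp 1 * (real k + 1) * exp (\<beta> * (1 - c\<^sup>2 * real k)) \<le> \<beta>"
  shows "real (card {f \<in> occ (k + 1) P V. \<beta> * real (card V) \<le> real (card (tight_bins (k + 1) P V f))})
    \<le> \<beta> * real (card (occ (k + 1) P V))"
proof (cases "(k + 1) * card V \<le> card P")
  case False
  hence "occ (k + 1) P V = {}" using occ_card_ge[OF assms(1,2)] by blast
  thus ?thesis by simp
next
  case True
  let ?A = "{f \<in> occ (k + 1) P V. \<beta> * real (card V) \<le> real (card (tight_bins (k + 1) P V f))}"
  let ?\<U> = "{U. U \<subseteq> V \<and> \<beta> * real (card V) \<le> real (card U)}"
  let ?B = "\<lambda>U. {f \<in> P \<rightarrow>\<^sub>E V. card {p \<in> P. f p \<in> U} \<le> (k + 1) * card U}"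
  define N where "N = card V"
  have N: "N > 0" using assms by (simp add: N_def card_gt_0_iff)
  have finU: "finite ?\<U>" using assms by auto
  have finB: "finite (?B U)" for U
    using assms by (intro finite_subset[OF _ finite_PiE[of P "\<lambda>_. V"]]) auto
  have "?A \<subseteq> (\<Union>U\<in>?\<U>. ?B U)"
  proof
    fix f assume f: "f \<in> ?A"
    define U where "U = tight_bins (k + 1) P V f"
    have fP: "f \<in> P \<rightarrow>\<^sub>E V" using f unfolding occ_def by auto
    have "card {p \<in> P. f p \<in> U} = card (\<Union>v\<in>U. {p \<in> P. f p = v})" by (intro arg_cong[of _ _ card]) auto
    also have "\<dots> \<le> (\<Sum>v\<in>U. card {p \<in> P. f p = v})"
      using assms by (intro card_UN_le) (auto simp: U_def tight_bins_def)
    also have "\<dots> = (\<Sum>v\<in>U. k + 1)" by (intro sum.cong) (auto simp: U_def tight_bins_def)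
    finally have "card {p \<in> P. f p \<in> U} \<le> (k + 1) * card U" by (simp add: mult.commute)
    moreover have "U \<in> ?\<U>" using f by (auto simp: U_def tight_bins_def)
    ultimately show "f \<in> (\<Union>U\<in>?\<U>. ?B U)" using fP by blast
  qed
  hence "card ?A \<le> card (\<Union>U\<in>?\<U>. ?B U)" using finU finB by (intro card_mono) auto
  also have "\<dots> \<le> (\<Sum>U\<in>?\<U>. card (?B U))" using finU by (rule card_UN_le)
  finally have "real (card ?A) \<le> (\<Sum>U\<in>?\<U>. real (card (?B U)))" by (simp flip: of_nat_sum)
  also have "\<dots> \<le> (\<Sum>U\<in>?\<U>. real N ^ card P * exp ((1 - c\<^sup>2 * real k) * (\<beta> * real N)))"
  proof (intro sum_mono)
    fix U assume U: "U \<in> ?\<U>"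
    have "real (card (?B U)) \<le> real N ^ card P * exp ((1 - c\<^sup>2 * real k) * real (card U))"
      unfolding N_def using assms U by (intro card_tight_superset) auto
    also have "\<dots> \<le> real N ^ card P * exp ((1 - c\<^sup>2 * real k) * (\<beta> * real N))"
      using U assms(9) by (intro mult_left_mono) (auto simp: N_def intro!: mult_left_mono_neg)
    finally show "real (card (?B U)) \<le> \<dots>" .
  qed
  also have "\<dots> \<le> 2 ^ N * (real N ^ card P * exp ((1 - c\<^sup>2 * real k) * (\<beta> * real N)))"
  proof -
    have "card ?\<U> \<le> card (Pow V)" using assms by (intro card_mono) auto
    hence "real (card ?\<U>) \<le> 2 ^ N" using assms by (simp add: card_Pow N_def) 
    thus ?thesis by (simp add: mult_right_mono)
  qed
  also have "\<dots> \<le> 2 ^ N * (((exp 1 * real (k + 1)) ^ N * real (nocc (k + 1) (card P) N)) * exp ((1 - c\<^sup>2 * real k) * (\<beta> * real N)))"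
    using nocc_ge[of "k + 1" N "card P"] True N
    by (intro mult_left_mono mult_right_mono) (auto simp: N_def)
  also have "\<dots> = (2 * exp 1 * (real k + 1) * exp (\<beta> * (1 - c\<^sup>2 * real k))) ^ N * real (nocc (k + 1) (card P) N)"
    unfolding power_mult_distrib exp_of_nat_mult[symmetric] by (simp add: mult_ac add_ac)
  \<comment> \<open>The base collects the 2^N choices of \<open>U\<close>, the loss from
    \<open>nocc_ge\<close> and the Chernoff factor; the last assumption says that it is at most
    \<open>\<beta>\<close>.\<close>
  also have "\<dots> \<le> \<beta> ^ N * real (nocc (k + 1) (card P) N)"
    using assms(10) by (intro mult_right_mono power_mono) auto
  also have "\<dots> \<le> \<beta> * real (nocc (k + 1) (card P) N)"
    using assms(6,7) N power_decreasing[of 1 N \<beta>] by (intro mult_right_mono) auto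
  finally show ?thesis using assms by (simp add: card_occ N_def)
qed

text \<open>Double counting of pairs of a function and a place in a bin above the minimum.
  \<open>card_occ_loose\<close> gives the number per place; a function misses only the
  \<open>k + 1\<close> places of each bin at the minimum, and few bins are there on average. Since
  \<open>(k + 1) * N \<le> y\<close>, this loss is relative to \<open>y\<close>.\<close>

lemma nocc_pred_ge:
  fixes c \<beta> :: real and k :: nat
  assumes "N > 0" "0 < c" "c \<le> 1" "0 < \<beta>" "\<beta> \<le> 1"
    and "(1 + 3 * c) * real k * real N \<le> real y"
    and "1 \<le> c\<^sup>2 * real k"
    and "2 * exp 1 * (real k + 1) * exp (\<beta> * (1 - c\<^sup>2 * real k)) \<le> \<beta>"
  shows "(1 - 2 * \<beta>) * real (nocc (k + 1) y N) \<le> real N * real (nocc (k + 1) (y - 1) N)"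
proof (cases "(k + 1) * N \<le> y")
  case False
  hence "occ (k + 1) {..<y} {..<N} = {}" using occ_card_ge[of "{..<y}" "{..<N}" _ "k + 1"] by fastforce
  thus ?thesis by (simp add: nocc_def)
next
  case True
  let ?P = "{..<y}" and ?V = "{..<N}"
  let ?O = "occ (k + 1) ?P ?V"
  define z where "z = real (nocc (k + 1) y N)"
  define B where "B f = card (tight_bins (k + 1) ?P ?V f)" for f
  have y: "y > 0" using True assms(1) by (cases y) auto
  have finO: "finite ?O" by (simp add: finite_occ)
  have z: "z = real (card ?O)" by (simp add: z_def nocc_def)
  have BN: "B f \<le> N" for f
    unfolding B_def using card_mono[of ?V "tight_bins (k + 1) ?P ?V f"] by (auto simp: tight_bins_def)
  have loose: "real y - (real k + 1) * real (B f) = real (card {p \<in> ?P. k + 1 < card {q \<in> ?P. f q = f p}})"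
    if f: "f \<in> ?O" for f
  proof -
    let ?T = "tight_bins (k + 1) ?P ?V f"
    have "?P = {p \<in> ?P. k + 1 < card {q \<in> ?P. f q = f p}} \<union> (\<Union>v\<in>?T. {p \<in> ?P. f p = v})"
    proof -
      have "f p \<in> ?T \<or> k + 1 < card {q \<in> ?P. f q = f p}" if "p \<in> ?P" for p
      proof -
        have "f p \<in> ?V" using f that unfolding occ_def by auto
        moreover from this have "k + 1 \<le> card {q \<in> ?P. f q = f p}" using f unfolding occ_def by blast
        ultimately show ?thesis unfolding tight_bins_def by (auto simp del: lessThan_iff)
      qed
      thus ?thesis by auto
    qed
    hence "y = card ({p \<in> ?P. k + 1 < card {q \<in> ?P. f q = f p}} \<union> (\<Union>v\<in>?T. {p \<in> ?P. f p = v}))"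
      by (metis card_lessThan)
    also have "\<dots> = card {p \<in> ?P. k + 1 < card {q \<in> ?P. f q = f p}} + card (\<Union>v\<in>?T. {p \<in> ?P. f p = v})"
      by (intro card_Un_disjoint) (auto simp: tight_bins_def)
    also have "card (\<Union>v\<in>?T. {p \<in> ?P. f p = v}) = (\<Sum>v\<in>?T. card {p \<in> ?P. f p = v})"
      by (intro card_UN_disjoint) (auto simp: tight_bins_def)
    also have "\<dots> = (\<Sum>v\<in>?T. k + 1)" by (intro sum.cong) (auto simp: tight_bins_def)
    finally have "real y = real (card {p \<in> ?P. k + 1 < card {q \<in> ?P. f q = f p}} + B f * (k + 1))"
      by (simp add: B_def)
    thus ?thesis by (simp add: algebra_simps)
  qed
  have "(\<Sum>f\<in>?O. real y - (real k + 1) * real (B f))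
      = (\<Sum>f\<in>?O. \<Sum>p\<in>?P. of_bool (k + 1 < card {q \<in> ?P. f q = f p}))"
    using loose by (intro sum.cong) (auto simp: sum.If_cases Int_def of_bool_def)
  also have "\<dots> = (\<Sum>p\<in>?P. real (card {f \<in> ?O. k + 1 < card {q \<in> ?P. f q = f p}}))"
    using finO by (subst sum.swap) (simp add: of_bool_def sum.If_cases Int_def)
  also have "\<dots> = (\<Sum>p\<in>?P. real (N * nocc (k + 1) (y - 1) N))"
    by (intro sum.cong arg_cong[of _ _ real] refl) (subst card_occ_loose, auto)
  finally have 1: "(\<Sum>f\<in>?O. real y - (real k + 1) * real (B f)) = real y * (real N * real (nocc (k + 1) (y - 1) N))"
    by simp
  \<comment> \<open>One \<open>\<beta>\<close> comes from functions with few bins at the minimum,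
    the other from the rare exceptions, for which the trivial bound \<open>N\<close> is
    used.\<close>
  have "(\<Sum>f\<in>?O. real (B f)) \<le> (\<Sum>f\<in>?O. \<beta> * real N + real N * of_bool (\<beta> * real N \<le> real (B f)))"
  proof (intro sum_mono)
    fix f
    have "\<beta> * real N \<ge> 0" using assms by simp
    thus "real (B f) \<le> \<beta> * real N + real N * of_bool (\<beta> * real N \<le> real (B f))"
      using BN[of f] by (cases "\<beta> * real N \<le> real (B f)") (auto simp: of_nat_mono add_increasing)
  qed
  also have "\<dots> = z * \<beta> * real N + real N * real (card {f \<in> ?O. \<beta> * real N \<le> real (B f)})"
    using finO by (simp add: sum.distrib z of_bool_def sum.If_cases Int_def flip: sum_distrib_left)
  also have "real (card {f \<in> ?O. \<beta> * real N \<le> real (B f)}) \<le> \<beta> * z"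
    using card_many_tight[of ?P ?V c \<beta> k] assms unfolding B_def z by (auto simp: lessThan_empty_iff)
  finally have "(\<Sum>f\<in>?O. real (B f)) \<le> z * \<beta> * real N + real N * (\<beta> * z)" by (simp add: mult_left_mono)
  hence 2: "(\<Sum>f\<in>?O. real (B f)) \<le> 2 * \<beta> * real N * z" by (simp add: algebra_simps)
  have "real y * z - (real k + 1) * (2 * \<beta> * real N * z) \<le> (\<Sum>f\<in>?O. real y - (real k + 1) * real (B f))"
    using mult_left_mono[OF 2, of "real k + 1"] by (simp add: sum_subtractf z flip: sum_distrib_left)
  also note 1
  also have "real y * z - (real k + 1) * (2 * \<beta> * real N * z) \<ge> real y * z - real y * (2 * \<beta> * z)"
  proof -
    have "(real k + 1) * real N \<le> real y"
      using True by (metis of_nat_1 of_nat_add of_nat_le_iff of_nat_mult)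
    hence "((real k + 1) * real N) * (2 * \<beta> * z) \<le> real y * (2 * \<beta> * z)"
      using assms by (intro mult_right_mono) (auto simp: z_def)
    thus ?thesis by (simp add: mult_ac)
  qed
  finally have "real y * ((1 - 2 * \<beta>) * z) \<le> real y * (real N * real (nocc (k + 1) (y - 1) N))"
    by (simp add: algebra_simps)
  thus ?thesis using y by (subst (asm) mult_le_cancel_left_pos) (auto simp: z_def)
qed

section \<open>Small vertex sets\<close>

text \<open>\<open>X\<close> contains \<open>x - r\<close> places that already hit all its
  hyperedges. The other \<open>r\<close> places lie in those hyperedges, which have at most
  \<open>h * (x - r)\<close> places.\<close>

lemma card_excess_le:
  fixes \<pi> :: "'p \<Rightarrow> 'e"
  assumes "finite P" and h: "\<And>e. card {p \<in> P. \<pi> p = e} \<le> h" and "r \<le> x"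
  shows "card {X. X \<subseteq> P \<and> card X = x \<and> card (\<pi> ` X) + r \<le> x}
    \<le> (card P choose (x - r)) * ((h * (x - r)) choose r)"
proof -
  define nb where "nb Y = {p \<in> P. \<pi> p \<in> \<pi> ` Y}" for Y
  define \<Y> where "\<Y> = {Y. Y \<subseteq> P \<and> card Y = x - r}"
  have finP: "finite {X. X \<subseteq> P \<and> Q X}" for Q using assms(1) by auto
  have nb: "card (nb Y) \<le> h * (x - r)" if "Y \<in> \<Y>" for Y
  proof -
    have fY: "finite Y" using that assms(1) finite_subset by (auto simp: \<Y>_def)
    have "nb Y = (\<Union>e\<in>\<pi> ` Y. {p \<in> P. \<pi> p = e})" by (auto simp: nb_def)
    also have "card \<dots> \<le> (\<Sum>e\<in>\<pi> ` Y. card {p \<in> P. \<pi> p = e})" using fY by (intro card_UN_le) auto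
    also have "\<dots> \<le> (\<Sum>e\<in>\<pi> ` Y. h)" by (intro sum_mono h)
    also have "\<dots> \<le> h * card Y" using card_image_le[OF fY, of \<pi>] by simp
    finally show ?thesis using that by (simp add: \<Y>_def)
  qed
  have "{X. X \<subseteq> P \<and> card X = x \<and> card (\<pi> ` X) + r \<le> x} \<subseteq> (\<Union>Y\<in>\<Y>. (\<lambda>R. Y \<union> R) ` {R. R \<subseteq> nb Y \<and> card R = r})"
  proof
    fix X assume "X \<in> {X. X \<subseteq> P \<and> card X = x \<and> card (\<pi> ` X) + r \<le> x}"
    hence X: "X \<subseteq> P" "card X = x" "card (\<pi> ` X) + r \<le> x" by auto
    have fX: "finite X" using X(1) assms(1) finite_subset by blast
    obtain Y0 where Y0: "Y0 \<subseteq> X" "inj_on \<pi> Y0" "\<pi> ` Y0 = \<pi> ` X"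
      by (metis subset_image_inj order_refl)
    have c0: "card Y0 \<le> x - r" using X Y0 card_image[of \<pi> Y0] by simp
    obtain Y where Y: "Y0 \<subseteq> Y" "Y \<subseteq> X" "card Y = x - r"
      using exists_subset_between[of Y0 "x - r" X] c0 X Y0 fX by auto
    have "\<pi> ` Y = \<pi> ` X" using Y Y0 by blast
    hence "X - Y \<subseteq> nb Y" using X by (auto simp: nb_def)
    moreover have "card (X - Y) = r"
      using Y X fX assms(3) by (subst card_Diff_subset) (auto intro: finite_subset)
    moreover have "X = Y \<union> (X - Y)" using Y by auto
    moreover have "Y \<in> \<Y>" using Y X by (auto simp: \<Y>_def)
    ultimately show "X \<in> (\<Union>Y\<in>\<Y>. (\<lambda>R. Y \<union> R) ` {R. R \<subseteq> nb Y \<and> card R = r})" by blast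
  qed
  moreover have fnb: "finite {R. R \<subseteq> nb Y \<and> card R = r}" for Y
    using assms(1) by (simp add: nb_def)
  ultimately have "card {X. X \<subseteq> P \<and> card X = x \<and> card (\<pi> ` X) + r \<le> x} \<le> card (\<Union>Y\<in>\<Y>. (\<lambda>R. Y \<union> R) ` {R. R \<subseteq> nb Y \<and> card R = r})"
    using finP by (intro card_mono) (auto simp: \<Y>_def)
  also have "\<dots> \<le> (\<Sum>Y\<in>\<Y>. card ((\<lambda>R. Y \<union> R) ` {R. R \<subseteq> nb Y \<and> card R = r}))"
    using finP by (intro card_UN_le) (auto simp: \<Y>_def)
  also have "\<dots> \<le> (\<Sum>Y\<in>\<Y>. (h * (x - r)) choose r)"
  proof (intro sum_mono)
    fix Y assume Y: "Y \<in> \<Y>"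
    have "card ((\<lambda>R. Y \<union> R) ` {R. R \<subseteq> nb Y \<and> card R = r}) \<le> card {R. R \<subseteq> nb Y \<and> card R = r}"
      by (intro card_image_le fnb)
    also have "\<dots> = card (nb Y) choose r" using assms(1) by (intro n_subsets) (simp add: nb_def)
    also have "\<dots> \<le> (h * (x - r)) choose r" by (intro binomial_right_mono nb Y)
    finally show "card ((\<lambda>R. Y \<union> R) ` {R. R \<subseteq> nb Y \<and> card R = r}) \<le> \<dots>" .
  qed
  also have "\<dots> = (card P choose (x - r)) * ((h * (x - r)) choose r)"
    using n_subsets[OF assms(1)] by (simp add: \<Y>_def)
  finally show ?thesis .
qed

lemma Suc_binomial_Suc: "Suc k * (n choose Suc k) = (n - k) * (n choose k)"
  by (simp only: binomial_absorption binomial_absorb_comp)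

text \<open>Each of the \<open>r\<close> steps down from \<open>x\<close> multiplies the binomial
  coefficient by at most x / (M - x).\<close>

lemma binomial_diff_le:
  assumes "x \<le> M" "r \<le> x"
  shows "(M choose (x - r)) * (M - x) ^ r \<le> (M choose x) * x ^ r"
  using assms(2)
proof (induction r)
  case (Suc r)
  let ?y = "x - Suc r"
  have Sy: "Suc ?y = x - r" using Suc by simp
  have "(M choose ?y) * (M - x) ^ Suc r = ((M - x) * (M choose ?y)) * (M - x) ^ r" by simp
  also have "\<dots> \<le> ((M - ?y) * (M choose ?y)) * (M - x) ^ r" using Suc assms by (intro mult_right_mono) auto
  also have "(M - ?y) * (M choose ?y) = (x - r) * (M choose (x - r))"
    using Suc_binomial_Suc[of ?y M] by (simp only: Sy)
  also have "\<dots> * (M - x) ^ r \<le> x * (M choose (x - r)) * (M - x) ^ r" by (intro mult_right_mono) auto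
  also have "\<dots> = x * ((M choose (x - r)) * (M - x) ^ r)" by simp
  also have "\<dots> \<le> x * ((M choose x) * x ^ r)" using Suc by (intro mult_left_mono) auto
  finally show ?case by (simp add: mult_ac)
qed simp

lemma binomial_le_exp: "real (a choose r) \<le> (exp 1 * real a / real r) ^ r"
proof (cases "r = 0")
  case False
  have "real (a choose r) * (real r / exp 1) ^ r \<le> real (a choose r) * fact r"
    using fact_ge_exp[of r] by (intro mult_left_mono) auto
  also have "\<dots> = real ((a choose r) * fact r)" by simp
  also have "\<dots> \<le> real (a ^ r)" by (intro of_nat_mono binomial_fact_pow)
  finally show ?thesis using False by (simp add: power_divide power_mult_distrib field_simps)
qed simp

lemma excess_fraction_le:
  fixes \<pi> :: "'p \<Rightarrow> 'e" and \<rho> :: real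
  assumes "finite P" "\<And>e. card {p \<in> P. \<pi> p = e} \<le> h" "r \<le> x" "x < card P"
    and "0 \<le> \<rho>" "exp 1 * real h * real (x - r) / real r * real x \<le> \<rho> * (real (card P) - real x)"
  shows "real (card {X. X \<subseteq> P \<and> card X = x \<and> card (\<pi> ` X) + r \<le> x}) \<le> \<rho> ^ r * real (card P choose x)"
proof -
  let ?M = "card P" and ?B = "{X. X \<subseteq> P \<and> card X = x \<and> card (\<pi> ` X) + r \<le> x}"
  have D: "real (?M - x) > 0" using assms by simp
  have "real (card ?B) * real (?M - x) ^ r
      \<le> real ((?M choose (x - r)) * ((h * (x - r)) choose r)) * real (?M - x) ^ r"
    using card_excess_le[OF assms(1-3)] by (intro mult_right_mono of_nat_mono) auto
  also have "\<dots> = real ((?M choose (x - r)) * (?M - x) ^ r) * real ((h * (x - r)) choose r)" by simp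
  also have "\<dots> \<le> real ((?M choose x) * x ^ r) * (exp 1 * real (h * (x - r)) / real r) ^ r"
    using assms by (intro mult_mono[OF of_nat_mono[OF binomial_diff_le] binomial_le_exp]) auto
  also have "\<dots> = real (?M choose x) * (exp 1 * real h * real (x - r) / real r * real x) ^ r"
    by (simp add: power_mult_distrib power_divide mult_ac)
  also have "\<dots> \<le> real (?M choose x) * (\<rho> * (real ?M - real x)) ^ r"
    using assms(6) by (intro mult_left_mono power_mono) auto
  also have "real ?M - real x = real (?M - x)" using assms(4) by simp
  finally have "real (card ?B) * real (?M - x) ^ r \<le> (\<rho> ^ r * real (?M choose x)) * real (?M - x) ^ r"
    by (simp add: power_mult_distrib mult_ac)
  thus ?thesis using D by (subst (asm) mult_le_cancel_right_pos) auto
qed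

section \<open>Distribution of the number of places over a small vertex set\<close>

text \<open>\<open>mass\<close> counts the functions in \<open>occ\<close> for which exactly \<open>x\<close> places fall into a fixed set of \<open>t\<close> of the
  \<open>n\<close> bins.\<close>

definition mass :: "nat \<Rightarrow> nat \<Rightarrow> nat \<Rightarrow> nat \<Rightarrow> nat \<Rightarrow> nat" where
  "mass d M n t x = (M choose x) * (nocc d x t * nocc d (M - x) (n - t))"

lemma card_occ_preimage_card:
  assumes "finite P" "finite V" "T \<subseteq> V"
  shows "card {f \<in> occ d P V. Q {p \<in> P. f p \<in> T}} =
    (\<Sum>x\<le>card P. card {X. X \<subseteq> P \<and> card X = x \<and> Q X} * (nocc d x (card T) * nocc d (card P - x) (card V - card T)))"
proof -
  let ?g = "\<lambda>x. nocc d x (card T) * nocc d (card P - x) (card V - card T)"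
  have fin: "finite {X. X \<subseteq> P \<and> R X}" for R using assms(1) by auto
  have "(\<Sum>X | X \<subseteq> P \<and> Q X. ?g (card X)) = (\<Sum>x\<le>card P. \<Sum>X | X \<in> {X. X \<subseteq> P \<and> Q X} \<and> card X = x. ?g (card X))"
    using assms(1) by (intro sum.group[symmetric] fin) (auto intro: card_mono)
  also have "\<dots> = (\<Sum>x\<le>card P. card {X. X \<subseteq> P \<and> card X = x \<and> Q X} * ?g x)"
  proof (intro sum.cong refl)
    fix x
    have "(\<Sum>X | X \<in> {X. X \<subseteq> P \<and> Q X} \<and> card X = x. ?g (card X)) = (\<Sum>X | X \<subseteq> P \<and> card X = x \<and> Q X. ?g x)"
      by (intro sum.cong) auto
    thus "(\<Sum>X | X \<in> {X. X \<subseteq> P \<and> Q X} \<and> card X = x. ?g (card X)) = card {X. X \<subseteq> P \<and> card X = x \<and> Q X} * ?g x"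
      by simp
  qed
  finally show ?thesis using card_occ_preimage_pred[OF assms] by simp
qed

lemma sum_mass:
  assumes "t \<le> n"
  shows "(\<Sum>x\<le>M. mass d M n t x) = nocc d M n"
proof -
  have "nocc d M n = card {f \<in> occ d {..<M} {..<n}. True}" by (simp add: nocc_def)
  also have "\<dots> = (\<Sum>x\<le>M. mass d M n t x)"
    using card_occ_preimage_card[of "{..<M}" "{..<n}" "{..<t}" d "\<lambda>_. True"] assms
    by (simp add: mass_def n_subsets)
  finally show ?thesis ..
qed

lemma mass_le: "t \<le> n \<Longrightarrow> x \<le> M \<Longrightarrow> mass d M n t x \<le> nocc d M n"
  using member_le_sum[of x "{..M}" "mass d M n t"] by (simp add: sum_mass)

text \<open>The density margins are nested: with (1 + 4c) k places per bin overall, the complement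
  of T keeps (1 + 3c) k per bin even when T takes up to (1 + 2c) k t, and this is what
  \<open>nocc_pred_ge\<close> requires. Assumption \<open>kb\<close> is its condition for \<beta> =
  c / 8.\<close>

locale dense_occupancy =
  fixes k M n t :: nat and c :: real
  assumes c: "0 < c" "c \<le> 1 / 8"
    and kc: "1 \<le> c\<^sup>2 * real k"
    and kb: "2 * exp 1 * (real k + 1) * exp (c / 8 * (1 - c\<^sup>2 * real k)) \<le> c / 8"
    and M: "(1 + 4 * c) * real k * real n \<le> real M"
    and t: "0 < t" "4 * t \<le> n"
begin

lemma k_pos: "k > 0" using kc by (cases k) auto

text \<open>Moving one place into T changes the binomial by (M - x) / (x + 1), gains at least a
  factor t on T and keeps at least (1 - c / 4) / N outside. The product is at least (1 + 3c) (1 - c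
  / 4) / (1 + 2c), by the density margins.\<close>

lemma mass_Suc_ge:
  assumes "real x + 1 \<le> (1 + 2 * c) * real k * real t"
  shows "(1 + c / 2) * real (mass (k + 1) M n t x) \<le> real (mass (k + 1) M n t (Suc x))"
proof -
  define N where "N = n - t"
  have N: "N > 0" "real N = real n - real t" using t unfolding N_def by auto
  have Mx: "(1 + 3 * c) * real k * real N \<le> real M - real x"
  proof -
    have "(1 + 3 * c) * real k * real N = (1 + 3 * c) * real k * real n - (1 + 3 * c) * real k * real t"
      unfolding N by (simp add: algebra_simps)
    moreover have "(1 + 3 * c) * real k * real n \<le> (1 + 4 * c) * real k * real n"
      using c by (intro mult_right_mono) auto
    moreover have "(1 + 2 * c) * real k * real t \<le> (1 + 3 * c) * real k * real t"
      using c by (intro mult_right_mono) auto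
    ultimately show ?thesis using assms M by linarith
  qed
  have pos: "(1 + 3 * c) * real k * real N > 0" using c k_pos N by simp
  have xM: "x < M" using Mx pos by (simp flip: of_nat_less_iff)
  define z1 z2 z1' z2' where "z1 = real (nocc (k + 1) x t)" and "z2 = real (nocc (k + 1) (M - x) N)"
    and "z1' = real (nocc (k + 1) (Suc x) t)" and "z2' = real (nocc (k + 1) (M - Suc x) N)"
  have r1: "real t * z1 \<le> z1'" unfolding z1_def z1'_def using nocc_Suc_ge[of t "k + 1" x]
    by (simp only: of_nat_le_iff flip: of_nat_mult)
  have r2: "(1 - 2 * (c / 8)) * z2 \<le> real N * z2'"
    using nocc_pred_ge[of N c "c / 8" k "M - x"] N(1) c kc kb Mx xM unfolding z2_def z2'_def by simp
  have bin: "(real x + 1) * real (M choose Suc x) = (real M - real x) * real (M choose x)"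
    using arg_cong[OF Suc_binomial_Suc[of x M], of real] xM by (simp add: algebra_simps)
  have key: "(1 + c / 2) * ((real x + 1) * real N) \<le> (real M - real x) * real t * (1 - 2 * (c / 8))"
  proof -
    have "(1 + c / 2) * ((real x + 1) * real N) \<le> (1 + c / 2) * (((1 + 2 * c) * real k * real t) * real N)"
      using assms c by (intro mult_left_mono mult_right_mono) auto
    also have "\<dots> = ((1 + c / 2) * (1 + 2 * c)) * (real k * real t * real N)" by simp
    also have "\<dots> \<le> ((1 + 3 * c) * (1 - 2 * (c / 8))) * (real k * real t * real N)"
    proof (intro mult_right_mono)
      \<comment> \<open>Comparing the quadratic terms leaves 7 c <= 1, which the bound 1/8 on
        \<open>c\<close> ensures.\<close>
      have "c * (7 * c) \<le> c * 1" using c by (intro mult_left_mono) auto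
      thus "(1 + c / 2) * (1 + 2 * c) \<le> (1 + 3 * c) * (1 - 2 * (c / 8))" by (simp add: algebra_simps)
    qed auto
    also have "\<dots> = ((1 + 3 * c) * real k * real N) * real t * (1 - 2 * (c / 8))" by simp
    also have "\<dots> \<le> (real M - real x) * real t * (1 - 2 * (c / 8))"
      using Mx c by (intro mult_right_mono) auto
    finally show ?thesis .
  qed
  have "(1 + c / 2) * ((real x + 1) * real N) * (real (M choose x) * (z1 * z2))
      \<le> (real M - real x) * real t * (1 - 2 * (c / 8)) * (real (M choose x) * (z1 * z2))"
    using key by (intro mult_right_mono) (auto simp: z1_def z2_def)
  also have "\<dots> = ((real M - real x) * real (M choose x)) * ((real t * z1) * ((1 - 2 * (c / 8)) * z2))" by simp
  also have "\<dots> \<le> ((real M - real x) * real (M choose x)) * (z1' * (real N * z2'))"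
    using xM c by (intro mult_left_mono[OF mult_mono[OF r1 r2]]) (auto simp: z1_def z2_def z1'_def z2'_def)
  also have "\<dots> = ((real x + 1) * real N) * (real (M choose Suc x) * (z1' * z2'))"
    unfolding bin[symmetric] by simp
  finally have "((real x + 1) * real N) * ((1 + c / 2) * (real (M choose x) * (z1 * z2)))
      \<le> ((real x + 1) * real N) * (real (M choose Suc x) * (z1' * z2'))" by (simp only: mult_ac)
  hence "(1 + c / 2) * (real (M choose x) * (z1 * z2)) \<le> real (M choose Suc x) * (z1' * z2')"
    using N(1) by (subst (asm) mult_le_cancel_left_pos) auto
  thus ?thesis by (simp add: mass_def z1_def z2_def z1'_def z2'_def N_def)
qed

lemma mass_add_ge:
  assumes "real x + real j \<le> (1 + 2 * c) * real k * real t"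
  shows "(1 + c / 2) ^ j * real (mass (k + 1) M n t x) \<le> real (mass (k + 1) M n t (x + j))"
  using assms
proof (induction j)
  case (Suc j)
  have "(1 + c / 2) ^ Suc j * real (mass (k + 1) M n t x)
      = (1 + c / 2) * ((1 + c / 2) ^ j * real (mass (k + 1) M n t x))" by simp
  also have "\<dots> \<le> (1 + c / 2) * real (mass (k + 1) M n t (x + j))"
    using Suc c by (intro mult_left_mono) auto
  also have "\<dots> \<le> real (mass (k + 1) M n t (x + Suc j))"
    using mass_Suc_ge[of "x + j"] Suc.prems by (simp add: algebra_simps)
  finally show ?case .
qed simp

lemma kt_le_M: "(1 + 2 * c) * real k * real t \<le> real M" "2 * real k * real t + real k * real n / 2 \<le> real M"
proof -
  have kt: "real k * (4 * real t) \<le> real k * real n" using t by (intro mult_left_mono) auto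
  have ckt: "c * (real k * real t) \<le> 1 / 8 * (real k * real t)" using c by (intro mult_right_mono) auto
  have ckn: "0 \<le> c * (real k * real n)" using c by auto
  from M have M': "real k * real n + 4 * (c * (real k * real n)) \<le> real M" by (simp add: algebra_simps)
  have "0 \<le> real k * real t" by simp
  with kt ckn M' show "2 * real k * real t + real k * real n / 2 \<le> real M" by simp
  have "(1 + 2 * c) * real k * real t = real k * real t + 2 * (c * (real k * real t))" by (simp add: algebra_simps)
  with kt ckt ckn M' \<open>0 \<le> real k * real t\<close> show "(1 + 2 * c) * real k * real t \<le> real M" by linarith
qed

text \<open>About c k t steps of growth 1 + c / 2 lie between (1 + c) k t and (1 + 2c) k t, and the
  mass at the upper end is at most the total. The factor 2 absorbs the rounding of the number of
  steps.\<close>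

lemma mass_small_le:
  assumes "real x \<le> (1 + c) * real k * real t"
  shows "real (mass (k + 1) M n t x) * ((1 + c / 2) powr (c * real k)) ^ t \<le> 2 * real (nocc (k + 1) M n)"
proof -
  define j where "j = nat \<lfloor>c * real k * real t\<rfloor>"
  have nn: "c * real k * real t \<ge> 0" using c by auto
  have j: "real j \<le> c * real k * real t" "c * real k * real t < real j + 1"
    unfolding j_def using nn by linarith+
  have xj: "real x + real j \<le> (1 + 2 * c) * real k * real t" using assms j by (simp add: algebra_simps)
  have xM: "x + j \<le> M" using xj kt_le_M(1) by (simp flip: of_nat_le_iff of_nat_add)
  have "((1 + c / 2) powr (c * real k)) ^ t = (1 + c / 2) powr (c * real k * real t)"
    using c by (simp add: powr_power mult_ac)
  also have "\<dots> \<le> (1 + c / 2) powr (real j + 1)" using j c by (intro powr_mono) auto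
  also have "\<dots> = (1 + c / 2) ^ j * (1 + c / 2)" using c by (simp add: powr_add powr_realpow)
  finally have "real (mass (k + 1) M n t x) * ((1 + c / 2) powr (c * real k)) ^ t
      \<le> real (mass (k + 1) M n t x) * ((1 + c / 2) ^ j * (1 + c / 2))" by (intro mult_left_mono) auto
  also have "\<dots> = ((1 + c / 2) ^ j * real (mass (k + 1) M n t x)) * (1 + c / 2)" by simp
  also have "\<dots> \<le> real (nocc (k + 1) M n) * 2"
  proof (intro mult_mono)
    have "(1 + c / 2) ^ j * real (mass (k + 1) M n t x) \<le> real (mass (k + 1) M n t (x + j))" by (rule mass_add_ge[OF xj])
    also have "\<dots> \<le> real (nocc (k + 1) M n)" using mass_le[of t n "x + j" M "k + 1"] xM t by simp
    finally show "(1 + c / 2) ^ j * real (mass (k + 1) M n t x) \<le> real (nocc (k + 1) M n)" .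
  qed (use c in auto)
  finally show ?thesis by simp
qed


text \<open>The factor \<open>n choose t\<close> prepares the union over all T of this size. For x <
  (k + 1) t the minimum degree fails, and for x > h k t too many hyperedges are hit. If x is near k
  t, there are at least t redundant places, whose price of order (k t / n)^t cancels (e n / t)^t up
  to a power of k that the small mass at x pays. If x is larger, the excess is at least c k t and
  its price alone suffices.\<close>

lemma card_few_touched_edges:
  fixes P :: "'p set" and V T :: "'v set" and \<pi> :: "'p \<Rightarrow> 'e" and h :: nat
  assumes P: "finite P" "card P = M" and V: "finite V" "card V = n" and T: "T \<subseteq> V" "card T = t"
    and h: "0 < h" "\<And>e. card {p \<in> P. \<pi> p = e} \<le> h" "2 * h * t \<le> n"
    and A: "4 * exp 1 * real h ^ 2 * real t \<le> c * real n"
    and K1: "768 * exp 1 ^ 2 * real h * real k ^ 2 \<le> (1 + c / 2) powr (c * real k)"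
    and K2: "32 * exp 1 ^ 2 * real h ^ 2 / c \<le> 2 powr (c * real k)"
  shows "real (card {f \<in> occ (k + 1) P V. card (\<pi> ` {p \<in> P. f p \<in> T}) < k * t}) * real (n choose t)
    \<le> (1 / 4) ^ t * real (nocc (k + 1) M n)"
proof -
  define bad where "bad x = real (card {X. X \<subseteq> P \<and> card X = x \<and> card (\<pi> ` X) < k * t})" for x
  define g where "g x = real (nocc (k + 1) x t * nocc (k + 1) (M - x) (n - t))" for x
  define Z where "Z = real (nocc (k + 1) M n)"
  define D where "D = real (n choose t)"
  define W where "W = (1 + c / 2) powr (c * real k)"
  have eighth: "a / v \<le> 1 / 8" if "8 * a \<le> v" "v > 0" for a v :: real
    using that by (simp add: field_simps)
  have n: "n > 0" using t by auto
  have W: "W > 0" using c by (simp add: W_def)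
  have Z: "Z \<ge> 0" by (simp add: Z_def)
  have D: "0 \<le> D" "D \<le> (exp 1 * real n / real t) ^ t" unfolding D_def by (auto intro: binomial_le_exp)
  have mass: "real (mass (k + 1) M n t x) = real (M choose x) * g x" for x
    by (simp add: mass_def g_def)
  have g0: "g x \<ge> 0" for x by (simp add: g_def)
  have kn: "real k * real n > 0" using k_pos n by simp
  \<comment> \<open>The first summand serves the range near k t and is restricted to few
    \<open>x\<close>, since it does not decay in \<open>x\<close>; the second is proportional to the
    mass and may be summed over all \<open>x\<close>.\<close>
  have step: "bad x * g x * D \<le> of_bool (x \<le> 2 * k * t) * (2 * (8 * exp 1 ^ 2 * real h * real k / W) ^ t * Z)
      + (1 / 8) ^ t * real (mass (k + 1) M n t x)" if x: "x \<le> M" for x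
  proof -
    consider (small) "x < (k + 1) * t" | (mid) "(k + 1) * t \<le> x" "real x \<le> (1 + c) * real k * real t"
      | (huge) "h * k * t < x" | (large) "(1 + c) * real k * real t < real x" "x \<le> h * k * t"
      by linarith
    thus ?thesis
    proof cases
      case small
      hence "occ (k + 1) {..<x} {..<t} = {}" using occ_card_ge[of "{..<x}" "{..<t}" _ "k + 1"] by fastforce
      hence "g x = 0" by (simp add: g_def nocc_def)
      thus ?thesis using Z W by simp
    next
      case mid
      have "c * (real k * real t) \<le> 1 * (real k * real t)" using c by (intro mult_right_mono) auto
      hence x2: "real x \<le> 2 * real k * real t" using mid(2) by (simp add: algebra_simps)
      have Mx: "real k * real n / 2 \<le> real M - real x" using x2 kt_le_M(2) by linarith
      have xM: "x < M" using Mx kn by (simp flip: of_nat_less_iff)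
      have tx: "t \<le> x" using mid(1) by simp
      \<comment> \<open>Here (x - t) / t <= 2 k, x <= 2 k t and M - x >= k n / 2, so
        \<open>\<rho>\<close> must satisfy \<rho> k n / 2 = 4 e h k^2 t.\<close>
      define \<rho> where "\<rho> = 8 * exp 1 * real h * real k * real t / real n"
      have \<rho>: "\<rho> \<ge> 0" by (simp add: \<rho>_def)
      have "bad x \<le> real (card {X. X \<subseteq> P \<and> card X = x \<and> card (\<pi> ` X) + t \<le> x})"
        unfolding bad_def using mid(1) P(1) by (intro of_nat_mono card_mono) auto
      also have "\<dots> \<le> \<rho> ^ t * real (card P choose x)"
      proof (rule excess_fraction_le[OF P(1) h(2) tx _ \<rho>])
        have "real (x - t) / real t \<le> 2 * real k" using x2 tx t by (simp add: field_simps)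
        hence "exp 1 * real h * (real (x - t) / real t) * real x \<le> exp 1 * real h * (2 * real k) * (2 * real k * real t)"
          using x2 by (intro mult_mono mult_left_mono) auto
        also have "\<dots> = \<rho> * (real k * real n / 2)" using n by (simp add: \<rho>_def)
        also have "\<dots> \<le> \<rho> * (real M - real x)" using Mx \<rho> by (intro mult_left_mono) auto
        finally show "exp 1 * real h * real (x - t) / real t * real x \<le> \<rho> * (real (card P) - real x)"
          using P by simp
      qed (use xM P in auto)
      finally have "bad x * g x \<le> \<rho> ^ t * real (mass (k + 1) M n t x)"
        unfolding mass P(2) using g0[of x] by (simp add: mult_right_mono mult.assoc[symmetric])
      from this D(2) have "bad x * g x * D \<le> \<rho> ^ t * real (mass (k + 1) M n t x) * (exp 1 * real n / real t) ^ t"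
        by (rule mult_mono) (use D(1) \<rho> in auto)
      also have "\<dots> = (\<rho> * (exp 1 * real n / real t)) ^ t * real (mass (k + 1) M n t x)"
        by (simp only: power_mult_distrib mult_ac)
      also have "\<rho> * (exp 1 * real n / real t) = 8 * exp 1 ^ 2 * real h * real k"
        using n t by (simp add: \<rho>_def power2_eq_square)
      also have "real (mass (k + 1) M n t x) \<le> 2 * Z / W ^ t"
        using mass_small_le[OF mid(2)] W by (simp add: W_def Z_def field_simps)
      finally have "bad x * g x * D \<le> (8 * exp 1 ^ 2 * real h * real k) ^ t * (2 * Z / W ^ t)"
        by (simp add: mult_left_mono)
      also have "\<dots> = 2 * (8 * exp 1 ^ 2 * real h * real k / W) ^ t * Z" by (simp add: power_divide)
      finally have *: "bad x * g x * D \<le> 2 * (8 * exp 1 ^ 2 * real h * real k / W) ^ t * Z" .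
      have "real x \<le> real (2 * k * t)" using x2 by simp
      hence x2': "x \<le> 2 * k * t" by (simp only: of_nat_le_iff)
      have "0 \<le> (1 / 8) ^ t * real (mass (k + 1) M n t x)" by simp
      from add_increasing2[OF this *] x2' show ?thesis by simp
    next
      case huge
      have "{X. X \<subseteq> P \<and> card X = x \<and> card (\<pi> ` X) < k * t} = {}"
      proof (rule ccontr)
        assume "\<not> ?thesis"
        then obtain X where X: "X \<subseteq> P" "card X = x" "card (\<pi> ` X) < k * t" by blast
        have fX: "finite X" using X(1) P(1) finite_subset by blast
        have "X = (\<Union>e\<in>\<pi> ` X. {p \<in> X. \<pi> p = e})" by auto
        hence "card X = card (\<Union>e\<in>\<pi> ` X. {p \<in> X. \<pi> p = e})" by simp
        also have "\<dots> \<le> (\<Sum>e\<in>\<pi> ` X. card {p \<in> X. \<pi> p = e})" using fX by (intro card_UN_le) auto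
        also have "\<dots> \<le> (\<Sum>e\<in>\<pi> ` X. h)"
        proof (intro sum_mono)
          fix e
          have "card {p \<in> X. \<pi> p = e} \<le> card {p \<in> P. \<pi> p = e}" using X(1) P(1) by (intro card_mono) auto
          also have "\<dots> \<le> h" by (rule h(2))
          finally show "card {p \<in> X. \<pi> p = e} \<le> h" .
        qed
        also have "\<dots> = h * card (\<pi> ` X)" by simp
        also have "\<dots> \<le> h * (k * t)" using X(3) by (intro mult_left_mono) auto
        finally show False using huge X(2) by simp
      qed
      hence "bad x = 0" by (simp only: bad_def card.empty of_nat_0)
      thus ?thesis using Z W by simp
    next
      case large
      define r where "r = x - k * t"
      have ck: "1 \<le> c * real k"
      proof -
        have "c\<^sup>2 * real k \<le> 1 * (c * real k)" unfolding power2_eq_square mult.assoc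
          using c by (intro mult_right_mono) auto
        thus ?thesis using kc by simp
      qed
      have "1 * (real k * real t) \<le> (1 + c) * (real k * real t)" using c by (intro mult_right_mono) auto
      hence "real (k * t) \<le> real x" using large(1) unfolding of_nat_mult mult.assoc by linarith
      hence ktx: "k * t \<le> x" by (simp only: of_nat_le_iff)
      have rr: "real r = real x - real k * real t" unfolding r_def of_nat_diff[OF ktx] by simp
      have r: "c * real k * real t \<le> real r" unfolding rr using large(1) by (simp add: algebra_simps)
      have "1 * real t \<le> (c * real k) * real t" using ck by (intro mult_right_mono) auto
      hence "real t \<le> real r" using r by linarith
      hence tr: "t \<le> r" by (simp only: of_nat_le_iff)
      have r0: "r > 0" using tr t by simp
      have "real x \<le> real (h * k * t)" using large(2) by (simp only: of_nat_le_iff)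
      hence x2: "real x \<le> real h * real k * real t" by simp
      have "real (2 * h * t) \<le> real n" using h(3) by (simp only: of_nat_le_iff)
      hence "real k * (2 * real h * real t) \<le> real k * real n" by (intro mult_left_mono) auto
      hence "real h * real k * real t \<le> real k * real n / 2" by (simp add: algebra_simps)
      moreover have "real k * real n \<le> real M"
      proof -
        have "1 * (real k * real n) \<le> (1 + 4 * c) * (real k * real n)" using c by (intro mult_right_mono) auto
        thus ?thesis using M unfolding mult.assoc by linarith
      qed
      ultimately have Mx: "real k * real n / 2 \<le> real M - real x" using x2 by linarith
      have xM: "x < M" using Mx kn by (simp flip: of_nat_less_iff)
      \<comment> \<open>Now k t / r <= 1 / c and x <= h k t. Assumption \<open>A\<close> says
        precisely that this \<open>\<rho>\<close> is at most 1/2.\<close>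
      define \<rho> where "\<rho> = 2 * exp 1 * real h ^ 2 * real t / (c * real n)"
      have \<rho>: "\<rho> \<ge> 0" "\<rho> \<le> 1 / 2" using A c n by (auto simp: \<rho>_def field_simps)
      have rx: "r \<le> x" by (simp add: r_def)
      have "bad x \<le> real (card {X. X \<subseteq> P \<and> card X = x \<and> card (\<pi> ` X) + r \<le> x})"
        unfolding bad_def using ktx P(1) by (intro of_nat_mono card_mono) (auto simp: r_def)
      also have "\<dots> \<le> \<rho> ^ r * real (card P choose x)"
      proof (rule excess_fraction_le[OF P(1) h(2) rx _ \<rho>(1)])
        have xr: "x - r = k * t" using ktx by (simp add: r_def)
        have "real (k * t) / real r \<le> 1 / c" using r r0 c by (simp add: field_simps)
        hence "exp 1 * real h * (real (x - r) / real r) * real x \<le> exp 1 * real h * (1 / c) * (real h * real k * real t)"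
          unfolding xr using x2 c by (intro mult_mono mult_left_mono) auto
        also have "\<dots> = \<rho> * (real k * real n / 2)" using n c by (simp add: \<rho>_def power2_eq_square)
        also have "\<dots> \<le> \<rho> * (real M - real x)" using Mx \<rho> by (intro mult_left_mono) auto
        finally show "exp 1 * real h * real (x - r) / real r * real x \<le> \<rho> * (real (card P) - real x)"
          using P by simp
      qed (use xM P in auto)
      also have "\<dots> \<le> (2 * \<rho> / 2 powr (c * real k)) ^ t * real (card P choose x)"
      proof -
        have "\<rho> ^ r \<le> (2 * \<rho> / 2 powr (c * real k)) ^ t"
        proof -
          \<comment> \<open>The first t factors carry t / n and cancel the number of sets T; the
            others are bounded by 1/2 each and give the decay in k.\<close>
          have "\<rho> ^ r = \<rho> ^ t * \<rho> ^ (r - t)" using tr by (simp flip: power_add)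
          also have "\<dots> \<le> \<rho> ^ t * (1 / 2) ^ (r - t)" using \<rho> by (intro mult_left_mono power_mono) auto
          also have "\<dots> \<le> \<rho> ^ t * (2 ^ t * (1 / 2 powr (c * real k)) ^ t)"
          proof (intro mult_left_mono)
            have "(1 / 2 :: real) ^ (r - t) = 2 ^ t * 2 powr (- real r)"
            proof -
              define s where "s = r - t"
              have rs: "r = t + s" using tr by (simp add: s_def)
              have "2 powr (- real r) = (1 / 2 :: real) ^ r"
                by (simp add: powr_minus powr_realpow power_one_over inverse_eq_divide)
              also have "\<dots> = (1 / 2) ^ t * (1 / 2) ^ s" by (simp only: rs power_add)
              finally have "2 ^ t * 2 powr (- real r) = (2 ^ t * (1 / 2 :: real) ^ t) * (1 / 2) ^ s"
                by (simp only: mult.assoc)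
              also have "2 ^ t * (1 / 2 :: real) ^ t = 1" by (simp flip: power_mult_distrib)
              finally show ?thesis by (simp add: s_def)
            qed
            also have "\<dots> \<le> 2 ^ t * 2 powr (- (c * real k * real t))"
              using r by (intro mult_left_mono powr_mono) auto
            also have "2 powr (- (c * real k * real t)) = (1 / 2 powr (c * real k)) ^ t"
            proof -
              have "(1 / 2 powr (c * real k)) ^ t = (2 powr (- (c * real k))) ^ t" by (simp only: powr_minus_divide)
              also have "\<dots> = 2 powr (- (c * real k * real t))" by (simp add: powr_power mult_ac)
              finally show ?thesis ..
            qed
            finally show "(1 / 2) ^ (r - t) \<le> 2 ^ t * (1 / 2 powr (c * real k)) ^ t" .
          qed (use \<rho> in auto)
          also have "\<dots> = (2 * \<rho> / 2 powr (c * real k)) ^ t"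
            by (simp add: power_mult_distrib power_divide)
          finally show ?thesis .
        qed
        thus ?thesis by (rule mult_right_mono) simp
      qed
      finally have "bad x * g x \<le> (2 * \<rho> / 2 powr (c * real k)) ^ t * real (mass (k + 1) M n t x)"
        unfolding mass P(2) using g0[of x] by (simp add: mult_right_mono mult.assoc[symmetric])
      from this D(2) have "bad x * g x * D \<le> (2 * \<rho> / 2 powr (c * real k)) ^ t * real (mass (k + 1) M n t x) * (exp 1 * real n / real t) ^ t"
        by (rule mult_mono) (use D(1) \<rho> in auto)
      also have "\<dots> = (2 * \<rho> / 2 powr (c * real k) * (exp 1 * real n / real t)) ^ t * real (mass (k + 1) M n t x)"
        by (simp only: power_mult_distrib mult_ac)
      also have "\<dots> \<le> (1 / 8) ^ t * real (mass (k + 1) M n t x)"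
      proof (intro mult_right_mono power_mono)
        have "2 * \<rho> / 2 powr (c * real k) * (exp 1 * real n / real t) = (4 * exp 1 ^ 2 * real h ^ 2 / c) / 2 powr (c * real k)"
          using n t c by (simp add: \<rho>_def power2_eq_square)
        also have "\<dots> \<le> 1 / 8" by (rule eighth) (use K2 in simp_all)
        finally show "2 * \<rho> / 2 powr (c * real k) * (exp 1 * real n / real t) \<le> 1 / 8" .
      qed (use \<rho> in auto)
      finally show ?thesis using Z W by (simp add: add_increasing)
    qed
  qed
  have "real (card {f \<in> occ (k + 1) P V. card (\<pi> ` {p \<in> P. f p \<in> T}) < k * t}) * D = (\<Sum>x\<le>M. bad x * g x * D)"
    using card_occ_preimage_card[OF P(1) V(1) T(1), of "k + 1" "\<lambda>X. card (\<pi> ` X) < k * t"] P V T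
    by (simp add: bad_def g_def sum_distrib_right)
  also have "\<dots> \<le> (\<Sum>x\<le>M. of_bool (x \<le> 2 * k * t) * (2 * (8 * exp 1 ^ 2 * real h * real k / W) ^ t * Z)
      + (1 / 8) ^ t * real (mass (k + 1) M n t x))"
    by (intro sum_mono step) auto
  also have "\<dots> = real (card {x. x \<le> M \<and> x \<le> 2 * k * t}) * (2 * (8 * exp 1 ^ 2 * real h * real k / W) ^ t * Z)
      + (1 / 8) ^ t * Z"
    using sum_mass[of t n "k + 1" M] t
    by (simp add: sum.distrib Z_def of_bool_def sum.If_cases Int_def flip: sum_distrib_right sum_distrib_left of_nat_sum)
  \<comment> \<open>At most 3 k t values of \<open>x\<close> matter, a number absorbed into (6 k)^t.
    Together with 2^t and the base 8 e^2 h k / W this makes 96 e^2 h k^2 / W, which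
    \<open>K1\<close> bounds by 1/8.\<close>
  also have "\<dots> \<le> (6 * real k) ^ t * (2 ^ t * (8 * exp 1 ^ 2 * real h * real k / W) ^ t * Z) + (1 / 8) ^ t * Z"
  proof (intro add_right_mono mult_mono)
    have "card {x. x \<le> M \<and> x \<le> 2 * k * t} \<le> card {..2 * k * t}" by (intro card_mono) auto
    also have "\<dots> \<le> 3 * k * t" using k_pos t by simp
    finally have "card {x. x \<le> M \<and> x \<le> 2 * k * t} \<le> 3 * k * t" .
    hence "real (card {x. x \<le> M \<and> x \<le> 2 * k * t}) \<le> real (3 * k * t)" by (rule of_nat_mono)
    also have "\<dots> = (3 * real k) * real t" by simp
    also have "\<dots> \<le> (3 * real k) ^ t * 2 ^ t"
      using k_pos t self_le_power[of "3 * real k" t] of_nat_less_two_power[of t, where 'a = real]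
      by (intro mult_mono) auto
    also have "\<dots> = (3 * real k * 2) ^ t" by (simp only: power_mult_distrib)
    also have "\<dots> = (6 * real k) ^ t" by simp
    finally show "real (card {x. x \<le> M \<and> x \<le> 2 * k * t}) \<le> (6 * real k) ^ t" .
    show "(2::real) \<le> 2 ^ t" using t self_le_power[of "2::real" t] by simp
  qed (use Z W in auto)
  also have "\<dots> \<le> (1 / 8) ^ t * Z + (1 / 8) ^ t * Z"
  proof (intro add_right_mono)
    have "(6 * real k) ^ t * (2 ^ t * (8 * exp 1 ^ 2 * real h * real k / W) ^ t * Z)
        = ((6 * real k) * (2 * (8 * exp 1 ^ 2 * real h * real k / W))) ^ t * Z"
      by (simp only: power_mult_distrib mult.assoc)
    also have "(6 * real k) * (2 * (8 * exp 1 ^ 2 * real h * real k / W)) = 96 * exp 1 ^ 2 * real h * real k ^ 2 / W"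
      by (simp add: power2_eq_square)
    also have "(96 * exp 1 ^ 2 * real h * real k ^ 2 / W) ^ t * Z \<le> (1 / 8) ^ t * Z"
      using K1 W Z by (intro mult_right_mono power_mono eighth) (simp_all add: W_def)
    finally show "(6 * real k) ^ t * (2 ^ t * (8 * exp 1 ^ 2 * real h * real k / W) ^ t * Z) \<le> (1 / 8) ^ t * Z" .
  qed
  also have "\<dots> = (1 / 8) ^ t * 2 * Z" by simp
  also have "\<dots> \<le> (1 / 8) ^ t * 2 ^ t * Z"
    using Z t self_le_power[of "2::real" t] by (intro mult_right_mono mult_left_mono) auto
  also have "(1 / 8 :: real) ^ t * 2 ^ t = (1 / 8 * 2) ^ t" by (simp only: power_mult_distrib)
  also have "(1 / 8 * 2 :: real) = 1 / 4" by simp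
  finally show ?thesis by (simp add: D_def Z_def)
qed

end

section \<open>Coincidences under the minimum degree condition\<close>

lemma card_union_bound:
  assumes "finite I" "A \<subseteq> (\<Union>i\<in>I. B i)" "\<And>i. i \<in> I \<Longrightarrow> finite (B i)"
    "\<And>i. i \<in> I \<Longrightarrow> real (card (B i)) \<le> b" "real (card I) \<le> N" "0 \<le> b"
  shows "real (card A) \<le> N * b"
proof -
  have "card A \<le> card (\<Union>i\<in>I. B i)" using assms by (intro card_mono) auto
  also have "\<dots> \<le> (\<Sum>i\<in>I. card (B i))" using assms(1) by (rule card_UN_le)
  finally have "real (card A) \<le> (\<Sum>i\<in>I. real (card (B i)))" by (simp flip: of_nat_sum)
  also have "\<dots> \<le> (\<Sum>i\<in>I. b)" using assms(4) by (intro sum_mono) auto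
  also have "\<dots> \<le> N * b" using assms(5,6) by (simp add: mult_right_mono)
  finally show ?thesis .
qed

text \<open>Places of a crowded bin can be reassigned arbitrarily without leaving \<open>occ\<close>.\<close>

lemma card_occ_crowded:
  assumes "finite P" "finite V" "J \<subseteq> P"
  shows "card {f \<in> occ d P V. (\<forall>p\<in>J. f p = v) \<and> d + card J \<le> card {p \<in> P. f p = v}} * card V ^ card J
    \<le> card (occ d P V)"
proof -
  let ?A = "{f \<in> occ d P V. (\<forall>p\<in>J. f p = v) \<and> d + card J \<le> card {p \<in> P. f p = v}}"
  let ?F = "\<lambda>(f, u). \<lambda>p. if p \<in> J then u p else f p"
  have fJ: "finite J" using assms finite_subset by blast
  \<comment> \<open>The old values on \<open>J\<close> were all \<open>v\<close>, so overwriting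
    them loses no information.\<close>
  have "inj_on ?F (?A \<times> (J \<rightarrow>\<^sub>E V))"
  proof (rule inj_onI, clarify)
    fix f u g w assume f: "f \<in> occ d P V" "\<forall>p\<in>J. f p = v" and g: "g \<in> occ d P V" "\<forall>p\<in>J. g p = v"
      and u: "u \<in> J \<rightarrow>\<^sub>E V" and w: "w \<in> J \<rightarrow>\<^sub>E V"
      and eq: "(\<lambda>p. if p \<in> J then u p else f p) = (\<lambda>p. if p \<in> J then w p else g p)"
    have "u p = w p" if "p \<in> J" for p using fun_cong[OF eq, of p] that by simp
    moreover have "f p = g p" for p using fun_cong[OF eq, of p] f(2) g(2) by (cases "p \<in> J") auto
    ultimately show "f = g \<and> u = w" using u w by (auto intro: PiE_ext)
  qed
  moreover have "?F ` (?A \<times> (J \<rightarrow>\<^sub>E V)) \<subseteq> occ d P V"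
  proof (clarify)
    fix f u assume f: "f \<in> occ d P V" "\<forall>p\<in>J. f p = v" and l: "d + card J \<le> card {p \<in> P. f p = v}"
      and u: "u \<in> J \<rightarrow>\<^sub>E V"
    let ?g = "\<lambda>p. if p \<in> J then u p else f p"
    have "?g \<in> P \<rightarrow>\<^sub>E V" using f(1) u assms(3) unfolding occ_def by (auto simp: PiE_def extensional_def)
    moreover have "d \<le> card {p \<in> P. ?g p = x}" if x: "x \<in> V" for x
    proof (cases "x = v")
      case True
      have "card {p \<in> P. f p = v} \<le> card ({p \<in> P. ?g p = v} \<union> J)"
        using assms(1) fJ by (intro card_mono) auto
      also have "\<dots> \<le> card {p \<in> P. ?g p = v} + card J" by (rule card_Un_le)
      finally show ?thesis using l True by simp
    next
      case False
      have "d \<le> card {p \<in> P. f p = x}" using f(1) x unfolding occ_def by auto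
      also have "\<dots> \<le> card {p \<in> P. ?g p = x}"
        using assms(1) f(2) False by (intro card_mono) auto
      finally show ?thesis .
    qed
    ultimately show "?g \<in> occ d P V" unfolding occ_def by auto
  qed
  ultimately have "card (?A \<times> (J \<rightarrow>\<^sub>E V)) \<le> card (occ d P V)"
    using finite_occ[OF assms(1,2)] by (rule card_inj_on_le)
  thus ?thesis using fJ by (simp add: card_cartesian_product card_PiE)
qed

text \<open>First moment over a bin and \<open>j\<close> of its places. These may be reassigned
  freely without violating the minimum, so each choice has probability at most n^(-j), as for
  independent places.\<close>

lemma card_occ_max_degree:
  assumes "finite P" "finite V" "V \<noteq> {}"
  shows "real (card {f \<in> occ d P V. \<exists>v\<in>V. d + j \<le> card {p \<in> P. f p = v}})
    \<le> real (card V) * (real (card P) / real (card V)) ^ j / fact j * real (card (occ d P V))"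
proof -
  let ?I = "V \<times> {J. J \<subseteq> P \<and> card J = j}"
  let ?B = "\<lambda>(v, J). {f \<in> occ d P V. (\<forall>p\<in>J. f p = v) \<and> d + card J \<le> card {p \<in> P. f p = v}}"
  have n: "real (card V) > 0" using assms by (simp add: card_gt_0_iff)
  have "real (card {f \<in> occ d P V. \<exists>v\<in>V. d + j \<le> card {p \<in> P. f p = v}})
      \<le> (real (card V) * (real (card P) ^ j / fact j)) * (real (card (occ d P V)) / real (card V) ^ j)"
  proof (rule card_union_bound[where I = ?I and B = ?B])
    show "finite ?I" using assms by auto
    show "{f \<in> occ d P V. \<exists>v\<in>V. d + j \<le> card {p \<in> P. f p = v}} \<subseteq> (\<Union>i\<in>?I. ?B i)"
    proof
      fix f assume "f \<in> {f \<in> occ d P V. \<exists>v\<in>V. d + j \<le> card {p \<in> P. f p = v}}"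
      then obtain v where f: "f \<in> occ d P V" "v \<in> V" "d + j \<le> card {p \<in> P. f p = v}" by auto
      then obtain J where "J \<subseteq> {p \<in> P. f p = v}" "card J = j"
        using obtain_subset_with_card_n[of j "{p \<in> P. f p = v}"] by (metis add_leD2)
      thus "f \<in> (\<Union>i\<in>?I. ?B i)" using f by (intro UN_I[of "(v, J)"]) auto
    qed
    show "real (card (?B i)) \<le> real (card (occ d P V)) / real (card V) ^ j" if i0: "i \<in> ?I" for i
    proof -
      obtain v J where i: "i = (v, J)" "J \<subseteq> P" "card J = j" using i0 by (cases i) auto
      have "real (card (?B i) * card V ^ j) \<le> real (card (occ d P V))"
        using card_occ_crowded[OF assms(1,2) i(2), of d v] i by (intro of_nat_mono) simp
      thus ?thesis using n by (simp add: pos_le_divide_eq)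
    qed
    have "real (card P choose j) * fact j \<le> real (card P) ^ j"
      using of_nat_mono[OF binomial_fact_pow[of "card P" j], where 'a = real] by simp
    hence "real (card P choose j) \<le> real (card P) ^ j / fact j" by (simp add: pos_le_divide_eq)
    hence "real (card V) * real (card P choose j) \<le> real (card V) * (real (card P) ^ j / fact j)"
      by (rule mult_left_mono) simp
    thus "real (card ?I) \<le> real (card V) * (real (card P) ^ j / fact j)"
      using assms by (simp only: card_cartesian_product n_subsets of_nat_mult)
  qed (use assms in \<open>auto simp: finite_occ\<close>)
  thus ?thesis by (simp add: power_divide mult_ac)
qed

text \<open>The cap bounds how many places share a bin with a given one. Like the minimum, it is
  invariant under exchanging places, as switching requires.\<close>

definition occ_le :: "nat \<Rightarrow> nat \<Rightarrow> 'p set \<Rightarrow> 'v set \<Rightarrow> ('p \<Rightarrow> 'v) set" where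
  "occ_le d L P V = {f \<in> occ d P V. \<forall>v\<in>V. card {p \<in> P. f p = v} \<le> L}"

lemma finite_occ_le: "finite P \<Longrightarrow> finite V \<Longrightarrow> finite (occ_le d L P V)"
  unfolding occ_le_def by (simp add: finite_occ)

lemma occ_le_transpose:
  assumes "f \<in> occ_le d L P V" "q \<in> P" "z \<in> P"
  shows "f \<circ> Transposition.transpose q z \<in> occ_le d L P V"
proof -
  have tP: "Transposition.transpose q z p \<in> P \<longleftrightarrow> p \<in> P" for p using assms(2,3) by (auto simp: Transposition.transpose_def)
  have fib: "card {p \<in> P. (f \<circ> Transposition.transpose q z) p = v} = card {p \<in> P. f p = v}" for v
  proof -
    have "bij_betw (Transposition.transpose q z) {p \<in> P. (f \<circ> Transposition.transpose q z) p = v} {p \<in> P. f p = v}"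
      by (rule bij_betwI[where g = "Transposition.transpose q z"]) (auto simp: tP)
    thus ?thesis by (rule bij_betw_same_card)
  qed
  have "f \<circ> Transposition.transpose q z \<in> P \<rightarrow>\<^sub>E V"
  proof (rule PiE_I)
    fix p assume "p \<in> P"
    hence "Transposition.transpose q z p \<in> P" by (simp add: tP)
    thus "(f \<circ> Transposition.transpose q z) p \<in> V" using assms(1) unfolding occ_le_def occ_def by auto
  next
    fix p assume "p \<notin> P"
    hence "Transposition.transpose q z p \<notin> P" by (simp add: tP)
    thus "(f \<circ> Transposition.transpose q z) p = undefined" using assms(1) unfolding occ_le_def occ_def by auto
  qed
  thus ?thesis using assms(1) fib unfolding occ_le_def occ_def by (auto simp del: comp_apply)
qed

text \<open>Exchanging the place \<open>q\<close> with an arbitrary place outside \<open>J\<close> preserves all degrees.\<close>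

lemma card_coincidence_le:
  assumes "finite P" "finite V" "J \<subseteq> P" "p \<in> J" "q \<in> P" "q \<notin> J"
    and Q: "\<And>f g. (\<And>x. x \<in> J \<Longrightarrow> f x = g x) \<Longrightarrow> Q f \<Longrightarrow> Q g"
  shows "card {f \<in> occ_le d L P V. Q f \<and> f q = f p} * (card P - card J) \<le> L * card {f \<in> occ_le d L P V. Q f}"
proof -
  let ?A = "{f \<in> occ_le d L P V. Q f \<and> f q = f p}" and ?B = "{f \<in> occ_le d L P V. Q f}"
  \<comment> \<open>After the exchange \<open>z\<close> shares the bin of \<open>p\<close>, so an
    image function is reached for at most \<open>L\<close> values of \<open>z\<close>. Recording
    \<open>z\<close> makes the map injective.\<close>
  let ?F = "\<lambda>(f, z). (f \<circ> Transposition.transpose q z, z)"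
  have finB: "finite ?B" using assms by (simp add: finite_occ_le)
  have finJ: "finite J" using assms finite_subset by blast
  have "inj_on ?F (?A \<times> (P - J))"
  proof (rule inj_onI)
    fix x y assume "?F x = ?F y"
    moreover obtain f z where x: "x = (f, z)" by (cases x)
    moreover obtain g z' where y: "y = (g, z')" by (cases y)
    ultimately have eq: "f \<circ> Transposition.transpose q z = g \<circ> Transposition.transpose q z" and z: "z' = z"
      by auto
    have "f x = g x" for x using fun_cong[OF eq, of "Transposition.transpose q z x"] by simp
    thus "x = y" using x y z by auto
  qed
  moreover have "?F ` (?A \<times> (P - J)) \<subseteq> (SIGMA f:?B. {z \<in> P. f z = f p})"
  proof (clarify)
    fix f z assume f: "f \<in> occ_le d L P V" "Q f" "f q = f p" and z: "z \<in> P" "z \<notin> J"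
    have J: "(f \<circ> Transposition.transpose q z) x = f x" if "x \<in> J" for x
      using that assms(6) z(2) by (metis comp_apply Transposition.transpose_apply_other)
    have "Q (f \<circ> Transposition.transpose q z)" by (rule Q[OF _ f(2)]) (simp add: J del: comp_apply)
    moreover have "(f \<circ> Transposition.transpose q z) z = (f \<circ> Transposition.transpose q z) p"
      using J[OF assms(4)] f(3) by simp
    ultimately show "f \<circ> Transposition.transpose q z \<in> ?B \<and> z \<in> {z' \<in> P. (f \<circ> Transposition.transpose q z) z' = (f \<circ> Transposition.transpose q z) p}"
      using occ_le_transpose[OF f(1) assms(5) z(1)] z by blast
  qed
  moreover have "finite (SIGMA f:?B. {z \<in> P. f z = f p})" using finB assms by auto
  ultimately have "card (?A \<times> (P - J)) \<le> card (SIGMA f:?B. {z \<in> P. f z = f p})"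
    by (rule card_inj_on_le)
  also have "\<dots> = (\<Sum>f\<in>?B. card {z \<in> P. f z = f p})" using finB assms by (intro card_SigmaI) auto
  also have "\<dots> \<le> (\<Sum>f\<in>?B. L)"
  proof (intro sum_mono)
    fix f assume "f \<in> ?B"
    hence "f \<in> occ_le d L P V" by simp
    moreover from this have "f p \<in> V" using assms(3,4) unfolding occ_le_def occ_def by auto
    ultimately show "card {z \<in> P. f z = f p} \<le> L" unfolding occ_le_def by auto
  qed
  also have "\<dots> = L * card ?B" by simp
  finally show ?thesis using finJ assms(3) by (simp add: card_cartesian_product card_Diff_subset)
qed

text \<open>Three coincidences involve at most six places, so 6 gives one denominator for all
  stages.\<close>

lemma card_coincidence_real:
  assumes "finite P" "finite V" "J \<subseteq> P" "p \<in> J" "q \<in> P" "q \<notin> J" "card J \<le> 6" "6 < card P"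
    and Q: "\<And>f g. (\<And>x. x \<in> J \<Longrightarrow> f x = g x) \<Longrightarrow> Q f \<Longrightarrow> Q g"
  shows "real (card {f \<in> occ_le d L P V. Q f \<and> f q = f p})
    \<le> real L / (real (card P) - 6) * real (card {f \<in> occ_le d L P V. Q f})"
proof -
  let ?A = "{f \<in> occ_le d L P V. Q f \<and> f q = f p}" and ?B = "{f \<in> occ_le d L P V. Q f}"
  have "real (card ?A) * (real (card P) - 6) = real (card ?A * (card P - 6))" using assms(8) by simp
  also have "\<dots> \<le> real (card ?A * (card P - card J))" using assms(7) by (intro of_nat_mono mult_left_mono) auto
  also have "\<dots> \<le> real (L * card ?B)"
    using assms by (intro of_nat_mono card_coincidence_le) auto
  finally show ?thesis using assms(8) by (simp add: field_simps)
qed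

lemma card_two_coincidences:
  assumes "finite P" "finite V" "6 < card P" "{p1, p2, q1, q2} \<subseteq> P" "q1 \<noteq> q2"
    "p1 \<notin> {q1, q2}" "p2 \<notin> {q1, q2}"
  shows "real (card {f \<in> occ_le d L P V. f q1 = f p1 \<and> f q2 = f p2})
    \<le> (real L / (real (card P) - 6)) ^ 2 * real (card (occ_le d L P V))"
proof -
  let ?r = "real L / (real (card P) - 6)"
  have r: "?r \<ge> 0" using assms(3) by simp
  have "real (card {f \<in> occ_le d L P V. f q2 = f p2 \<and> f q1 = f p1})
      \<le> ?r * real (card {f \<in> occ_le d L P V. f q2 = f p2})"
    using assms by (intro card_coincidence_real[where J = "{p1, p2, q2}"]) (auto simp: card_insert_if)
  also have "real (card {f \<in> occ_le d L P V. True \<and> f q2 = f p2}) \<le> ?r * real (card {f \<in> occ_le d L P V. True})"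
    using assms by (intro card_coincidence_real[where J = "{p2}"]) auto
  hence "?r * real (card {f \<in> occ_le d L P V. f q2 = f p2}) \<le> ?r * (?r * real (card (occ_le d L P V)))"
    using r by (intro mult_left_mono) auto
  finally show ?thesis by (simp add: power2_eq_square conj_commute)
qed

text \<open>The coincidences are peeled off in the order \<open>q1\<close>, \<open>q2\<close>,
  \<open>b\<close>. Each peeled place must be absent from the equations still to come, hence the
  asymmetric disequalities.\<close>

lemma card_three_coincidences:
  assumes "finite P" "finite V" "6 < card P" "{p1, p2, q1, q2, a, b} \<subseteq> P" "q1 \<noteq> q2"
    "q1 \<notin> {p1, p2, a, b}" "q2 \<notin> {p2, a, b}" "a \<noteq> b"
  shows "real (card {f \<in> occ_le d L P V. f q1 = f p1 \<and> f q2 = f p2 \<and> f b = f a})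
    \<le> (real L / (real (card P) - 6)) ^ 3 * real (card (occ_le d L P V))"
proof -
  let ?r = "real L / (real (card P) - 6)"
  have r: "?r \<ge> 0" using assms(3) by simp
  have 1: "real (card {f \<in> occ_le d L P V. (f q2 = f p2 \<and> f b = f a) \<and> f q1 = f p1})
      \<le> ?r * real (card {f \<in> occ_le d L P V. f q2 = f p2 \<and> f b = f a})"
    using assms by (intro card_coincidence_real[where J = "{p1, p2, q2, a, b}"]) (auto simp: card_insert_if)
  have 2: "real (card {f \<in> occ_le d L P V. f b = f a \<and> f q2 = f p2}) \<le> ?r * real (card {f \<in> occ_le d L P V. f b = f a})"
    using assms by (intro card_coincidence_real[where J = "{p2, a, b}"]) (auto simp: card_insert_if)
  have 3: "real (card {f \<in> occ_le d L P V. True \<and> f b = f a}) \<le> ?r * real (card {f \<in> occ_le d L P V. True})"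
    using assms by (intro card_coincidence_real[where J = "{a}"]) auto
  have "{f \<in> occ_le d L P V. f q1 = f p1 \<and> f q2 = f p2 \<and> f b = f a} = {f \<in> occ_le d L P V. (f q2 = f p2 \<and> f b = f a) \<and> f q1 = f p1}"
    by auto
  hence "real (card {f \<in> occ_le d L P V. f q1 = f p1 \<and> f q2 = f p2 \<and> f b = f a})
      \<le> ?r * real (card {f \<in> occ_le d L P V. f q2 = f p2 \<and> f b = f a})" using 1 by simp
  also have "\<dots> \<le> ?r * (?r * real (card {f \<in> occ_le d L P V. f b = f a}))"
    using 2 r by (intro mult_left_mono) (simp_all add: conj_commute)
  also have "\<dots> \<le> ?r * (?r * (?r * real (card (occ_le d L P V))))"
    using 3 r by (intro mult_left_mono) simp_all
  finally show ?thesis by (simp add: power3_eq_cube mult.assoc)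
qed

text \<open>Two lost vertices mean two coincidences inside one hyperedge. Their price of order (L /
  M)^2 exceeds the number of hyperedges by a factor n / L^2, up to constants.\<close>

lemma card_degenerate_edge:
  fixes \<pi> :: "'p \<Rightarrow> 'e"
  assumes "finite P" "finite V" "6 < card P" "finite E"
    and h: "\<And>e. card {p \<in> P. \<pi> p = e} \<le> h"
  shows "real (card {f \<in> occ_le d L P V. \<exists>e\<in>E. card (f ` {p \<in> P. \<pi> p = e}) + 2 \<le> card {p \<in> P. \<pi> p = e}})
    \<le> (real (card E) * real h ^ 4) * ((real L / (real (card P) - 6)) ^ 2 * real (card (occ_le d L P V)))"
proof -
  define S where "S e = {p \<in> P. \<pi> p = e}" for e
  have finS: "finite (S e)" for e using assms(1) by (simp add: S_def)
  let ?X = "SIGMA e:E. S e \<times> S e \<times> S e \<times> S e"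
  let ?I = "{(e, q1, q2, p1, p2) \<in> ?X. q1 \<noteq> q2 \<and> p1 \<notin> {q1, q2} \<and> p2 \<notin> {q1, q2}}"
  let ?B = "\<lambda>(e, q1, q2, p1, p2). {f \<in> occ_le d L P V. f q1 = f p1 \<and> f q2 = f p2}"
  have finX: "finite ?X" using assms(4) finS by auto
  show ?thesis
  proof (rule card_union_bound[where I = ?I and B = ?B])
    show "finite ?I" by (rule finite_subset[OF _ finX]) auto
    show "{f \<in> occ_le d L P V. \<exists>e\<in>E. card (f ` {p \<in> P. \<pi> p = e}) + 2 \<le> card {p \<in> P. \<pi> p = e}} \<subseteq> (\<Union>i\<in>?I. ?B i)"
    proof
      fix f assume "f \<in> {f \<in> occ_le d L P V. \<exists>e\<in>E. card (f ` {p \<in> P. \<pi> p = e}) + 2 \<le> card {p \<in> P. \<pi> p = e}}"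
      then obtain e where f: "f \<in> occ_le d L P V" "e \<in> E" "card (f ` S e) + 2 \<le> card (S e)"
        by (auto simp: S_def)
      \<comment> \<open>\<open>R\<close> represents each value once; two places outside it agree
        with partners inside it, so the four places satisfy the disequalities of
        \<open>card_two_coincidences\<close>.\<close>
      obtain R where R: "R \<subseteq> S e" "inj_on f R" "f ` R = f ` S e" by (metis subset_image_inj order_refl)
      have "2 \<le> card (S e - R)"
        using R f(3) finS finite_subset[OF R(1) finS] card_image[OF R(2)] by (simp add: card_Diff_subset)
      then obtain q1 q2 where q: "q1 \<in> S e - R" "q2 \<in> S e - R" "q1 \<noteq> q2"
        by (metis card_le_Suc0_iff_eq finS finite_Diff not_less_eq_eq numeral_2_eq_2)
      have "f q1 \<in> f ` R" "f q2 \<in> f ` R" using q R(3) by auto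
      then obtain p1 p2 where "p1 \<in> R" "p2 \<in> R" "f q1 = f p1" "f q2 = f p2" by blast
      thus "f \<in> (\<Union>i\<in>?I. ?B i)" using q R(1) f
        by (intro UN_I[of "(e, q1, q2, p1, p2)"]) auto
    qed
    show "real (card (?B i)) \<le> (real L / (real (card P) - 6)) ^ 2 * real (card (occ_le d L P V))" if "i \<in> ?I" for i
    proof -
      obtain e q1 q2 p1 p2 where i: "i = (e, q1, q2, p1, p2)" by (metis prod_cases5)
      show ?thesis using that assms unfolding i
        by (simp only: prod.case) (intro card_two_coincidences, auto simp: S_def)
    qed
    have "card ?I \<le> card ?X" using finX by (intro card_mono) auto
    also have "card ?X = (\<Sum>e\<in>E. card (S e) ^ 4)"
      using assms(4) finS by (simp add: card_SigmaI card_cartesian_product power4_eq_xxxx mult.assoc)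
    also have "\<dots> \<le> (\<Sum>e\<in>E. h ^ 4)" using h by (intro sum_mono power_mono) (auto simp: S_def)
    finally have "card ?I \<le> card E * h ^ 4" by simp
    hence "real (card ?I) \<le> real (card E * h ^ 4)" by (rule of_nat_mono)
    thus "real (card ?I) \<le> real (card E) * real h ^ 4" by simp
  qed (use assms in \<open>auto simp: finite_occ_le\<close>)
qed

text \<open>One coincidence inside each hyperedge and one between them give (L / M)^3 against the
  square of the number of hyperedges.\<close>

lemma card_meeting_repeats:
  fixes \<pi> :: "'p \<Rightarrow> 'e"
  assumes "finite P" "finite V" "6 < card P" "finite E"
    and h: "\<And>e. card {p \<in> P. \<pi> p = e} \<le> h"
  shows "real (card {f \<in> occ_le d L P V. \<exists>e\<in>E. \<exists>e'\<in>E. e \<noteq> e' \<and> \<not> inj_on f {p \<in> P. \<pi> p = e} \<and>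
      \<not> inj_on f {p \<in> P. \<pi> p = e'} \<and> f ` {p \<in> P. \<pi> p = e} \<inter> f ` {p \<in> P. \<pi> p = e'} \<noteq> {}})
    \<le> (real (card E) ^ 2 * real h ^ 6) * ((real L / (real (card P) - 6)) ^ 3 * real (card (occ_le d L P V)))"
proof -
  define S where "S e = {p \<in> P. \<pi> p = e}" for e
  have finS: "finite (S e)" for e using assms(1) by (simp add: S_def)
  let ?X = "SIGMA (e, e'):E \<times> E. (S e \<times> S e \<times> S e) \<times> (S e' \<times> S e' \<times> S e')"
  let ?I = "{((e, e'), (q1, p1, a), (q2, p2, b)) \<in> ?X. e \<noteq> e' \<and> q1 \<noteq> p1 \<and> q1 \<noteq> a \<and> q2 \<noteq> p2 \<and> q2 \<noteq> b}"
  let ?B = "\<lambda>((e, e'), (q1, p1, a), (q2, p2, b)). {f \<in> occ_le d L P V. f q1 = f p1 \<and> f q2 = f p2 \<and> f b = f a}"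
  have finX: "finite ?X" using assms(4) finS by auto
  \<comment> \<open>The two places of a repeat are interchangeable, so the one to be moved can be
    chosen different from the meeting place \<open>a\<close>.\<close>
  have rep: "\<exists>q p. q \<in> S e \<and> p \<in> S e \<and> q \<noteq> p \<and> q \<noteq> a \<and> f q = f p" if "\<not> inj_on f (S e)" "a \<in> S e" for f :: "'p \<Rightarrow> 'a" and e a
  proof -
    obtain q p where "q \<in> S e" "p \<in> S e" "q \<noteq> p" "f q = f p" using \<open>\<not> inj_on f (S e)\<close> unfolding inj_on_def by blast
    thus ?thesis by metis
  qed
  show ?thesis
  proof (rule card_union_bound[where I = ?I and B = ?B])
    show "finite ?I" by (rule finite_subset[OF _ finX]) auto
    show "{f \<in> occ_le d L P V. \<exists>e\<in>E. \<exists>e'\<in>E. e \<noteq> e' \<and> \<not> inj_on f {p \<in> P. \<pi> p = e} \<and>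
      \<not> inj_on f {p \<in> P. \<pi> p = e'} \<and> f ` {p \<in> P. \<pi> p = e} \<inter> f ` {p \<in> P. \<pi> p = e'} \<noteq> {}} \<subseteq> (\<Union>i\<in>?I. ?B i)"
    proof
      fix f assume "f \<in> {f \<in> occ_le d L P V. \<exists>e\<in>E. \<exists>e'\<in>E. e \<noteq> e' \<and> \<not> inj_on f {p \<in> P. \<pi> p = e} \<and>
      \<not> inj_on f {p \<in> P. \<pi> p = e'} \<and> f ` {p \<in> P. \<pi> p = e} \<inter> f ` {p \<in> P. \<pi> p = e'} \<noteq> {}}"
      then obtain e e' where f: "f \<in> occ_le d L P V" "e \<in> E" "e' \<in> E" "e \<noteq> e'"
        "\<not> inj_on f (S e)" "\<not> inj_on f (S e')" "f ` S e \<inter> f ` S e' \<noteq> {}"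
        unfolding S_def by blast
      obtain a b where ab: "a \<in> S e" "b \<in> S e'" "f b = f a" using f(7) by force
      obtain q1 p1 where 1: "q1 \<in> S e" "p1 \<in> S e" "q1 \<noteq> p1" "q1 \<noteq> a" "f q1 = f p1" using rep[OF f(5) ab(1)] by blast
      obtain q2 p2 where 2: "q2 \<in> S e'" "p2 \<in> S e'" "q2 \<noteq> p2" "q2 \<noteq> b" "f q2 = f p2" using rep[OF f(6) ab(2)] by blast
      show "f \<in> (\<Union>i\<in>?I. ?B i)" using f ab 1 2
        by (intro UN_I[of "((e, e'), (q1, p1, a), (q2, p2, b))"]) auto
    qed
    show "real (card (?B i)) \<le> (real L / (real (card P) - 6)) ^ 3 * real (card (occ_le d L P V))" if "i \<in> ?I" for i
    proof -
      obtain e e' q1 p1 a q2 p2 b where i: "i = ((e, e'), (q1, p1, a), (q2, p2, b))" by (metis prod.exhaust)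
      have m: "e \<noteq> e'" "q1 \<in> S e" "p1 \<in> S e" "a \<in> S e" "q2 \<in> S e'" "p2 \<in> S e'" "b \<in> S e'"
        "q1 \<noteq> p1" "q1 \<noteq> a" "q2 \<noteq> p2" "q2 \<noteq> b"
        using that unfolding i by auto
      show ?thesis unfolding i prod.case
        by (intro card_three_coincidences) (use m assms in \<open>auto simp: S_def\<close>)
    qed
    have "card ?I \<le> card ?X" using finX by (intro card_mono) auto
    also have "card ?X = (\<Sum>(e, e')\<in>E \<times> E. card (S e) ^ 3 * card (S e') ^ 3)"
      using assms(4) finS by (subst card_SigmaI) (auto simp: card_cartesian_product power3_eq_cube mult.assoc split_beta)
    also have "\<dots> \<le> (\<Sum>(e, e')\<in>E \<times> E. h ^ 3 * h ^ 3)"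
    proof (intro sum_mono)
      fix x
      have "card (S e) ^ 3 \<le> h ^ 3" for e using h by (intro power_mono) (auto simp: S_def)
      hence "card (S (fst x)) ^ 3 * card (S (snd x)) ^ 3 \<le> h ^ 3 * h ^ 3" by (intro mult_mono) auto
      thus "(case x of (e, e') \<Rightarrow> card (S e) ^ 3 * card (S e') ^ 3) \<le> (case x of (e, e') \<Rightarrow> h ^ 3 * h ^ 3)"
        by (simp add: split_beta)
    qed
    also have "\<dots> = card E ^ 2 * h ^ 6" by (simp add: card_cartesian_product power2_eq_square flip: power_add)
    finally have "card ?I \<le> card E ^ 2 * h ^ 6" .
    hence "real (card ?I) \<le> real (card E ^ 2 * h ^ 6)" by (rule of_nat_mono)
    thus "real (card ?I) \<le> real (card E) ^ 2 * real h ^ 6" by simp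
  qed (use assms in \<open>auto simp: finite_occ_le\<close>)
qed

section \<open>Large vertex sets\<close>

lemma card_PiE_two:
  assumes "finite P" "finite V" "p \<in> P" "q \<in> P" "p \<noteq> q" "A \<subseteq> V" "B \<subseteq> V" "V \<noteq> {}"
  shows "real (card {f \<in> P \<rightarrow>\<^sub>E V. f p \<in> A \<and> f q \<in> B})
    = real (card V) ^ card P * (real (card A) / real (card V)) * (real (card B) / real (card V))"
proof -
  let ?C = "\<lambda>x. if x = p then A else if x = q then B else V"
  have n: "real (card V) > 0" using assms by (simp add: card_gt_0_iff)
  have c: "card P = Suc (Suc (card (P - {p} - {q})))"
    using assms by (metis card_Suc_Diff1 finite_Diff insertE insert_Diff)
  have "{f \<in> P \<rightarrow>\<^sub>E V. f p \<in> A \<and> f q \<in> B} = PiE P ?C"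
  proof (intro equalityI subsetI)
    fix f assume "f \<in> PiE P ?C"
    hence C: "\<And>x. x \<in> P \<Longrightarrow> f x \<in> ?C x" and e: "f \<in> extensional P" unfolding PiE_def Pi_def by blast+
    have "f x \<in> V" if "x \<in> P" for x using C[OF that] assms(6,7) by (auto split: if_splits)
    thus "f \<in> {f \<in> P \<rightarrow>\<^sub>E V. f p \<in> A \<and> f q \<in> B}"
      using C[OF assms(3)] C[OF assms(4)] assms(5) e by (auto simp: PiE_def)
  qed (auto simp: PiE_def Pi_def)
  hence "card {f \<in> P \<rightarrow>\<^sub>E V. f p \<in> A \<and> f q \<in> B} = (\<Prod>x\<in>P. card (?C x))"
    using assms(1) by (simp add: card_PiE)
  also have "\<dots> = card A * (\<Prod>x\<in>P - {p}. card (?C x))"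
    using assms by (subst prod.remove[of P p]) auto
  also have "(\<Prod>x\<in>P - {p}. card (?C x)) = card B * (\<Prod>x\<in>P - {p} - {q}. card (?C x))"
    using assms by (subst prod.remove[of "P - {p}" q]) auto
  also have "(\<Prod>x\<in>P - {p} - {q}. card (?C x)) = (\<Prod>x\<in>P - {p} - {q}. card V)"
    by (intro prod.cong) auto
  finally show ?thesis using n by (simp add: c)
qed

lemma card_PiE_one:
  assumes "finite P" "finite V" "p \<in> P" "A \<subseteq> V" "V \<noteq> {}"
  shows "real (card {f \<in> P \<rightarrow>\<^sub>E V. f p \<in> A}) = real (card V) ^ card P * (real (card A) / real (card V))"
proof -
  let ?C = "\<lambda>x. if x = p then A else V"
  have n: "real (card V) > 0" using assms by (simp add: card_gt_0_iff)
  have c: "card P = Suc (card (P - {p}))" using card_Suc_Diff1[OF assms(1,3)] by (rule sym)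
  have "{f \<in> P \<rightarrow>\<^sub>E V. f p \<in> A} = PiE P ?C"
  proof (intro equalityI subsetI)
    fix f assume "f \<in> PiE P ?C"
    hence C: "\<And>x. x \<in> P \<Longrightarrow> f x \<in> ?C x" and e: "f \<in> extensional P" unfolding PiE_def Pi_def by blast+
    have "f x \<in> V" if "x \<in> P" for x using C[OF that] assms(4) by (auto split: if_splits)
    thus "f \<in> {f \<in> P \<rightarrow>\<^sub>E V. f p \<in> A}" using C[OF assms(3)] e by (auto simp: PiE_def)
  qed (auto simp: PiE_def Pi_def)
  hence "card {f \<in> P \<rightarrow>\<^sub>E V. f p \<in> A} = (\<Prod>x\<in>P. card (?C x))"
    using assms(1) by (simp add: card_PiE)
  also have "\<dots> = card A * (\<Prod>x\<in>P - {p}. card (?C x))"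
    using assms by (subst prod.remove[of P p]) auto
  also have "(\<Prod>x\<in>P - {p}. card (?C x)) = (\<Prod>x\<in>P - {p}. card V)"
    by (intro prod.cong) auto
  finally show ?thesis using n by (simp add: c)
qed

lemma card_PiE_eq:
  assumes "finite P" "finite V" "p \<in> P" "q \<in> P" "p \<noteq> q" "V \<noteq> {}"
  shows "real (card {f \<in> P \<rightarrow>\<^sub>E V. f p = f q}) = real (card V) ^ card P / real (card V)"
proof -
  have n: "real (card V) > 0" using assms by (simp add: card_gt_0_iff)
  have fin: "finite {f \<in> P \<rightarrow>\<^sub>E V. f p \<in> {v} \<and> f q \<in> {v}}" for v
    using assms by (intro finite_subset[OF _ finite_PiE[of P "\<lambda>_. V"]]) auto
  have "{f \<in> P \<rightarrow>\<^sub>E V. f p = f q} = (\<Union>v\<in>V. {f \<in> P \<rightarrow>\<^sub>E V. f p \<in> {v} \<and> f q \<in> {v}})"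
    using assms(3) by (auto simp: PiE_def Pi_def)
  also have "card \<dots> = (\<Sum>v\<in>V. card {f \<in> P \<rightarrow>\<^sub>E V. f p \<in> {v} \<and> f q \<in> {v}})"
    using fin assms by (intro card_UN_disjoint) auto
  finally have "real (card {f \<in> P \<rightarrow>\<^sub>E V. f p = f q}) = (\<Sum>v\<in>V. real (card {f \<in> P \<rightarrow>\<^sub>E V. f p \<in> {v} \<and> f q \<in> {v}}))"
    by simp
  also have "\<dots> = (\<Sum>v\<in>V. real (card V) ^ card P * (real (card {v}) / real (card V)) * (real (card {v}) / real (card V)))"
    using assms by (intro sum.cong card_PiE_two) auto
  also have "\<dots> = real (card V) ^ card P / real (card V)" using n by simp
  finally show ?thesis .
qed

text \<open>Pointwise form of the strict convexity of \<open>j \<mapsto> max 0 (d - j)\<close> on \<open>{0..card S}\<close>; the last sum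
  accounts for repeated vertices.\<close>

lemma deficit_le:
  fixes f :: "'p \<Rightarrow> 'v" and d h :: nat and w :: real
  assumes "finite S" "0 < d" "d < card S" "card S \<le> h" "real d \<le> w"
    and p: "p1 \<in> S" "p2 \<in> S"
  shows "real (d - card (f ` S \<inter> T)) \<le> real d - real d / real (card S) * (\<Sum>p\<in>S. of_bool (f p \<in> T))
    - 1 / real h * of_bool (f p1 \<in> T \<and> f p2 \<notin> T)
    + w * (\<Sum>(p, q)\<in>{(p, q) \<in> S \<times> S. p \<noteq> q}. of_bool (f p = f q))"
proof -
  define J s where "J = card {p \<in> S. f p \<in> T}" and "s = card S"
  have sJ: "(\<Sum>p\<in>S. of_bool (f p \<in> T)) = real J"
    using assms(1) by (simp add: J_def of_bool_def sum.If_cases Int_def)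
  have Js: "J \<le> s" unfolding J_def s_def using assms(1) by (intro card_mono) auto
  have s: "s > 0" "real s > real d" "real d > 0" "real s \<le> real h" using assms by (auto simp: s_def)
  have h: "1 / real h \<le> 1 / real s" using s by (simp add: frac_le)
  have w: "w \<ge> 1" using assms by linarith
  let ?R = "\<Sum>(p, q)\<in>{(p, q) \<in> S \<times> S. p \<noteq> q}. of_bool (f p = f q) :: real"
  have R0: "?R \<ge> 0" by (intro sum_nonneg) auto
  have finS2: "finite {(p, q) \<in> S \<times> S. p \<noteq> q}" by (rule finite_subset[of _ "S \<times> S"]) (use assms in auto)
  show ?thesis
  proof (cases "inj_on f S")
    case True
    have "f ` S \<inter> T = f ` {p \<in> S. f p \<in> T}" by auto
    moreover have "inj_on f {p \<in> S. f p \<in> T}" by (rule inj_on_subset[OF True]) auto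
    ultimately have cJ: "card (f ` S \<inter> T) = J" by (simp add: card_image J_def)
    have "real (d - J) \<le> real d - real d / real s * real J - 1 / real h * of_bool (f p1 \<in> T \<and> f p2 \<notin> T)"
    proof (cases "J = 0 \<or> J = s")
      case True
      have "\<not> (f p1 \<in> T \<and> f p2 \<notin> T)"
      proof
        assume a: "f p1 \<in> T \<and> f p2 \<notin> T"
        have "{p \<in> S. f p \<in> T} \<noteq> {}" "{p \<in> S. f p \<in> T} \<noteq> S" using a p by auto
        hence "J \<noteq> 0" "J \<noteq> s" using assms(1) unfolding J_def s_def
          by (auto simp: card_eq_0_iff) (metis (no_types, lifting) card_subset_eq mem_Collect_eq subsetI)
        thus False using True by simp
      qed
      thus ?thesis using True s by auto
    next
      case False
      hence J: "1 \<le> real J" "real J + 1 \<le> real s" using Js by auto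
      have "1 / real h * of_bool (f p1 \<in> T \<and> f p2 \<notin> T) \<le> 1 / real s"
        using h s by (auto simp: of_bool_def)
      \<comment> \<open>The chord exceeds the truncated function by J (s - d) / s or d (s - J) / s.
        Both numerators are positive integers.\<close>
      moreover have "real (d - J) \<le> real d - real d / real s * real J - 1 / real s"
      proof (cases "J \<le> d")
        case True
        have "1 \<le> real J * (real s - real d)"
        proof -
          have "real d + 1 \<le> real s" using assms(3) by (simp add: s_def)
          thus ?thesis using J(1) mult_mono[of 1 "real J" 1 "real s - real d"] by simp
        qed
        hence "(real d * real J + 1) / real s \<le> real J" using s by (simp add: pos_divide_le_eq algebra_simps)
        thus ?thesis using True by (simp add: of_nat_diff add_divide_distrib)
      next
        case False
        have "1 \<le> real d * (real s - real J)"
          using J(2) s(3) mult_mono[of 1 "real d" 1 "real s - real J"] assms(2) by simp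
        hence "(real d * real J + 1) / real s \<le> real d" using s by (simp add: pos_divide_le_eq algebra_simps)
        thus ?thesis using False by (simp add: add_divide_distrib)
      qed
      ultimately show ?thesis by linarith
    qed
    thus ?thesis using R0 w unfolding cJ sJ s_def[symmetric] by (intro add_increasing2 mult_nonneg_nonneg) auto
  next
    case False
    then obtain p q where pq: "p \<in> S" "q \<in> S" "p \<noteq> q" "f p = f q" unfolding inj_on_def by blast
    \<comment> \<open>Ordered pairs count a repeat twice. The resulting 2 w pays for the deficit, at
      most w, and for the subtracted indicator, at most 1.\<close>
    have "(\<Sum>x\<in>{(p, q), (q, p)}. of_bool (f (fst x) = f (snd x))) \<le> (\<Sum>x\<in>{(p, q) \<in> S \<times> S. p \<noteq> q}. of_bool (f (fst x) = f (snd x)) :: real)"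
      using pq finS2 by (intro sum_mono2) auto
    hence R2: "2 \<le> ?R" using pq by (simp add: split_beta)
    have "real (d - card (f ` S \<inter> T)) \<le> w" using assms by linarith
    moreover have "real d / real s * real J \<le> real d" using Js s by (simp add: field_simps mult_left_mono)
    moreover have "1 / real h * of_bool (f p1 \<in> T \<and> f p2 \<notin> T) \<le> 1" using s by (simp add: of_bool_def)
    moreover have "w * 2 \<le> w * ?R" using R2 w by (intro mult_left_mono) auto
    ultimately show ?thesis unfolding sJ s_def[symmetric] using w by linarith
  qed
qed

text \<open>Only marginals of one or two places enter: a place hits T with probability
  \<open>\<tau>\<close>, two fixed places are separated in a given order with probability
  \<open>\<tau> * (1 - \<tau>)\<close>, and two places coincide with probability 1 / n.\<close>

lemma expectation_deficit_le:
  fixes P :: "'p set" and V T :: "'v set" and d h :: nat and w :: real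
  assumes "finite P" "finite V" "V \<noteq> {}" "T \<subseteq> V" "S \<subseteq> P" "0 < d" "d < card S" "card S \<le> h" "real d \<le> w"
  defines "\<tau> \<equiv> real (card T) / real (card V)"
  shows "measure_pmf.expectation (pmf_of_set (P \<rightarrow>\<^sub>E V)) (\<lambda>f. real (d - card (f ` S \<inter> T)))
    \<le> real d * (1 - \<tau>) - \<tau> * (1 - \<tau>) / real h + w * real h ^ 2 / real (card V)"
proof -
  let ?F = "P \<rightarrow>\<^sub>E V" and ?n = "real (card V)"
  have n: "?n > 0" using assms by (simp add: card_gt_0_iff)
  have F: "finite ?F" "?F \<noteq> {}" "real (card ?F) = ?n ^ card P"
    using assms by (auto simp: finite_PiE card_PiE PiE_eq_empty_iff)
  have finS: "finite S" using assms finite_subset by blast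
  have "\<not> card S \<le> Suc 0" using assms by simp
  then obtain p1 p2 where p: "p1 \<in> S" "p2 \<in> S" "p1 \<noteq> p2" using finS by (metis card_le_Suc0_iff_eq)
  define pr :: "(('p \<Rightarrow> 'v) \<Rightarrow> bool) \<Rightarrow> real" where "pr Q = real (card {f \<in> ?F. Q f}) / ?n ^ card P" for Q
  have sum_pr: "(\<Sum>f\<in>?F. of_bool (Q f)) = ?n ^ card P * pr Q" for Q
    using F n by (simp add: pr_def of_bool_def sum.If_cases Int_def)
  have cT: "card (V - T) = card V - card T" "card T \<le> card V"
    using assms finite_subset[OF assms(4,2)] by (auto simp: card_Diff_subset card_mono)
  have pr1: "pr (\<lambda>f. f p \<in> T) = \<tau>" if "p \<in> S" for p
    unfolding pr_def using card_PiE_one[OF assms(1,2) _ assms(4,3), of p] that assms(5) n by (auto simp: \<tau>_def)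
  have pr2: "pr (\<lambda>f. f p1 \<in> T \<and> f p2 \<notin> T) = \<tau> * (1 - \<tau>)"
  proof -
    have "{f \<in> ?F. f p1 \<in> T \<and> f p2 \<notin> T} = {f \<in> ?F. f p1 \<in> T \<and> f p2 \<in> V - T}" using p assms(5) by auto
    moreover have "real (card {f \<in> ?F. f p1 \<in> T \<and> f p2 \<in> V - T}) = ?n ^ card P * \<tau> * (real (card (V - T)) / ?n)"
      unfolding \<tau>_def using p assms by (intro card_PiE_two) auto
    moreover have "real (card (V - T)) / ?n = 1 - \<tau>"
      using cT n by (simp add: \<tau>_def of_nat_diff diff_divide_distrib)
    ultimately show ?thesis unfolding pr_def using n by simp
  qed
  have pr3: "pr (\<lambda>f. f p = f q) = 1 / ?n" if "p \<in> S" "q \<in> S" "p \<noteq> q" for p q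
  proof -
    have "p \<in> P" "q \<in> P" using that assms(5) by auto
    from card_PiE_eq[OF assms(1,2) this that(3) assms(3)] show ?thesis unfolding pr_def using n by simp
  qed
  let ?D = "{(p, q) \<in> S \<times> S. p \<noteq> q}"
  have finD: "finite ?D" by (rule finite_subset[of _ "S \<times> S"]) (use finS in auto)
  have "(\<Sum>f\<in>?F. real (d - card (f ` S \<inter> T))) \<le> (\<Sum>f\<in>?F. real d - real d / real (card S) * (\<Sum>p\<in>S. of_bool (f p \<in> T))
    - 1 / real h * of_bool (f p1 \<in> T \<and> f p2 \<notin> T)
    + w * (\<Sum>(p, q)\<in>?D. of_bool (f p = f q)))"
    by (intro sum_mono deficit_le) (use assms finS p in auto)
  also have "\<dots> = ?n ^ card P * real d - real d / real (card S) * (\<Sum>f\<in>?F. \<Sum>p\<in>S. of_bool (f p \<in> T))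
     - 1 / real h * (\<Sum>f\<in>?F. of_bool (f p1 \<in> T \<and> f p2 \<notin> T))
     + w * (\<Sum>f\<in>?F. \<Sum>(p, q)\<in>?D. of_bool (f p = f q))"
    unfolding sum.distrib sum_subtractf sum_distrib_left[symmetric] by (simp add: F(3))
  also have "(\<Sum>f\<in>?F. \<Sum>p\<in>S. of_bool (f p \<in> T)) = (\<Sum>p\<in>S. \<Sum>f\<in>?F. of_bool (f p \<in> T) :: real)"
    by (rule sum.swap)
  also have "(\<Sum>f\<in>?F. \<Sum>(p, q)\<in>?D. of_bool (f p = f q)) = (\<Sum>x\<in>?D. \<Sum>f\<in>?F. of_bool (f (fst x) = f (snd x)) :: real)"
    unfolding split_beta by (rule sum.swap)
  also have "(\<Sum>p\<in>S. \<Sum>f\<in>?F. of_bool (f p \<in> T)) = (\<Sum>p\<in>S. ?n ^ card P * \<tau>)"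
    by (intro sum.cong refl) (simp only: sum_pr pr1)
  also have "(\<Sum>x\<in>?D. \<Sum>f\<in>?F. of_bool (f (fst x) = f (snd x))) = (\<Sum>x\<in>?D. ?n ^ card P * (1 / ?n))"
  proof (intro sum.cong refl)
    fix x assume "x \<in> ?D"
    hence "fst x \<in> S" "snd x \<in> S" "fst x \<noteq> snd x" by auto
    hence "pr (\<lambda>f. f (fst x) = f (snd x)) = 1 / ?n" by (rule pr3)
    thus "(\<Sum>f\<in>?F. of_bool (f (fst x) = f (snd x))) = ?n ^ card P * (1 / ?n)" by (simp only: sum_pr)
  qed
  also have "(\<Sum>f\<in>?F. of_bool (f p1 \<in> T \<and> f p2 \<notin> T)) = ?n ^ card P * (\<tau> * (1 - \<tau>))"
    by (simp only: sum_pr pr2)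
  finally have "(\<Sum>f\<in>?F. real (d - card (f ` S \<inter> T)))
      \<le> ?n ^ card P * (real d - real d * \<tau> - \<tau> * (1 - \<tau>) / real h + w * real (card ?D) / ?n)"
    using assms(7) by (simp add: algebra_simps diff_divide_distrib)
  hence "(\<Sum>f\<in>?F. real (d - card (f ` S \<inter> T))) / ?n ^ card P
      \<le> real d - real d * \<tau> - \<tau> * (1 - \<tau>) / real h + w * real (card ?D) / ?n"
    using n by (simp add: pos_divide_le_eq mult.commute)
  also have "\<dots> \<le> real d - real d * \<tau> - \<tau> * (1 - \<tau>) / real h + w * real h ^ 2 / ?n"
  proof -
    have "card ?D \<le> card (S \<times> S)" using finS by (intro card_mono) auto
    also have "\<dots> \<le> h ^ 2" using assms(8) by (simp add: card_cartesian_product power2_eq_square mult_mono)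
    finally have "real (card ?D) \<le> real (h ^ 2)" by (rule of_nat_mono)
    hence "w * real (card ?D) / ?n \<le> w * real h ^ 2 / ?n"
      using n assms(6,9) by (intro divide_right_mono mult_left_mono) auto
    thus ?thesis by simp
  qed
  finally show ?thesis using F by (simp add: integral_pmf_of_set algebra_simps)
qed

text \<open>The uniform distribution on \<open>P \<rightarrow>\<^sub>E V\<close> is a product
  measure, and disjoint blocks of coordinates are independent.\<close>

lemma indep_vars_blocks:
  fixes P :: "'p set" and V :: "'v::countable set" and Y :: "'e \<Rightarrow> ('p \<Rightarrow> 'v) \<Rightarrow> real"
  assumes "finite P" "finite V" "V \<noteq> {}" "\<And>e. e \<in> E \<Longrightarrow> S e \<subseteq> P" "disjoint_family_on S E"
  shows "prob_space.indep_vars (measure_pmf (pmf_of_set (P \<rightarrow>\<^sub>E V))) (\<lambda>_. borel) (\<lambda>e f. Y e (restrict f (S e))) E"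
proof -
  have "PiE_dflt P undefined (\<lambda>_. V) = P \<rightarrow>\<^sub>E V"
    by (auto simp: PiE_dflt_def PiE_def extensional_def)
  hence eq: "pmf_of_set (P \<rightarrow>\<^sub>E V) = Pi_pmf P undefined (\<lambda>_. pmf_of_set V)"
    using Pi_pmf_of_set[of P "\<lambda>_. V" undefined] assms by simp
  let ?M = "measure_pmf (pmf_of_set (P \<rightarrow>\<^sub>E V))"
  have "prob_space.indep_vars ?M (\<lambda>_. count_space UNIV) (\<lambda>x f. f x) P"
    unfolding eq by (rule indep_vars_Pi_pmf[OF assms(1)])
  from prob_space.indep_vars_restrict[OF measure_pmf.prob_space_axioms this assms(4,5)]
  have ind: "prob_space.indep_vars ?M (\<lambda>e. PiM (S e) (\<lambda>_. count_space UNIV)) (\<lambda>e f. restrict f (S e)) E"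
    by simp
  show ?thesis
  proof (rule prob_space.indep_vars_compose2[OF measure_pmf.prob_space_axioms ind])
    fix e assume "e \<in> E"
    hence "finite (S e)" using assms(1,4) finite_subset by blast
    hence "PiM (S e) (\<lambda>_. count_space (UNIV :: 'v set)) = count_space (S e \<rightarrow>\<^sub>E UNIV)"
      by (intro count_space_PiM_finite) auto
    thus "Y e \<in> borel_measurable (PiM (S e) (\<lambda>_. count_space UNIV))" by simp
  qed
qed

lemma card_total_deficit_large:
  fixes P :: "'p set" and V T :: "'v::countable set" and \<pi> :: "'p \<Rightarrow> 'e" and d :: "'e \<Rightarrow> nat" and h w k :: nat
  assumes fins: "finite P" "finite V" "V \<noteq> {}" "T \<subseteq> V" "finite E" "E \<noteq> {}"
    and d: "\<And>e. e \<in> E \<Longrightarrow> 0 < d e \<and> d e < card {p \<in> P. \<pi> p = e} \<and> card {p \<in> P. \<pi> p = e} \<le> h \<and> d e \<le> w"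
    and D: "(\<Sum>e\<in>E. d e) \<le> k * card V"
  defines "\<tau> \<equiv> real (card T) / real (card V)"
  assumes small: "real w * real h ^ 2 / real (card V) \<le> \<tau> * (1 - \<tau>) / (2 * real h)"
  shows "real (card {f \<in> P \<rightarrow>\<^sub>E V. k * card (V - T) < (\<Sum>e\<in>E. d e - card (f ` {p \<in> P. \<pi> p = e} \<inter> T))})
    \<le> real (card V) ^ card P * exp (- (real (card E) * (\<tau> * (1 - \<tau>))\<^sup>2 / (2 * real h ^ 2 * real w ^ 2)))"
proof -
  define S where "S e = {p \<in> P. \<pi> p = e}" for e
  let ?F = "P \<rightarrow>\<^sub>E V" and ?n = "real (card V)"
  define X where "X e f = real (d e - card (f ` S e \<inter> T))" for e and f :: "'p \<Rightarrow> 'v"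
  let ?M = "pmf_of_set ?F"
  have n: "?n > 0" using fins by (simp add: card_gt_0_iff)
  have F: "finite ?F" "?F \<noteq> {}" "real (card ?F) = ?n ^ card P"
    using fins by (auto simp: finite_PiE card_PiE PiE_eq_empty_iff)
  have d': "0 < d e" "d e < card (S e)" "card (S e) \<le> h" "d e \<le> w" if "e \<in> E" for e
    using d[OF that] by (auto simp: S_def)
  obtain e0 where e0: "e0 \<in> E" using fins by auto
  have hw: "real h > 0" "real w > 0" using d'[OF e0] by auto
  have m: "real (card E) > 0" using fins by (simp add: card_gt_0_iff)
  have cT: "real (card (V - T)) = ?n * (1 - \<tau>)" "card T \<le> card V"
    using fins finite_subset[OF fins(4,2)] n by (auto simp: card_Diff_subset card_mono \<tau>_def of_nat_diff field_simps)
  have \<tau>: "0 \<le> \<tau>" "\<tau> \<le> 1" using cT n by (auto simp: \<tau>_def)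
  have ind: "prob_space.indep_vars (measure_pmf ?M) (\<lambda>_. borel) X E"
  proof -
    have "prob_space.indep_vars (measure_pmf ?M) (\<lambda>_. borel) (\<lambda>e f. X e (restrict f (S e))) E"
      using fins by (intro indep_vars_blocks) (auto simp: S_def disjoint_family_on_def)
    moreover have "X e (restrict f (S e)) = X e f" for e f by (simp add: X_def)
    ultimately show ?thesis by simp
  qed
  interpret Hoeffding_ineq "measure_pmf ?M" E X "\<lambda>_. 0" "\<lambda>_. real w" "\<Sum>e\<in>E. measure_pmf.expectation ?M (X e)"
  proof unfold_locales
    show "AE f in measure_pmf ?M. X e f \<in> {0..real w}" if "e \<in> E" for e
      using d'(4)[OF that] by (intro AE_I2) (auto simp: X_def)
  qed (use fins ind in auto)
  \<comment> \<open>Half of the convexity gain; assumption \<open>small\<close> lets the other half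
    pay for repeated vertices.\<close>
  define \<epsilon> where "\<epsilon> = real (card E) * (\<tau> * (1 - \<tau>)) / (2 * real h)"
  have \<epsilon>: "\<epsilon> \<ge> 0" using \<tau> by (simp add: \<epsilon>_def)
  have "(\<Sum>e\<in>E. measure_pmf.expectation ?M (X e)) \<le> (\<Sum>e\<in>E. real (d e) * (1 - \<tau>) - \<tau> * (1 - \<tau>) / real h + real w * real h ^ 2 / ?n)"
  proof (intro sum_mono)
    fix e assume e: "e \<in> E"
    show "measure_pmf.expectation ?M (X e) \<le> real (d e) * (1 - \<tau>) - \<tau> * (1 - \<tau>) / real h + real w * real h ^ 2 / ?n"
      unfolding X_def \<tau>_def
    proof (rule expectation_deficit_le[OF fins(1-4)])
      show "S e \<subseteq> P" by (auto simp: S_def)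
      show "real (d e) \<le> real w" using d'(4)[OF e] by (rule of_nat_mono)
    qed (use d'[OF e] in auto)
  qed
  also have "\<dots> \<le> (\<Sum>e\<in>E. real (d e) * (1 - \<tau>) - \<tau> * (1 - \<tau>) / (2 * real h))"
    using small by (intro sum_mono) (simp add: field_simps)
  also have "\<dots> = real (\<Sum>e\<in>E. d e) * (1 - \<tau>) - \<epsilon>"
    by (simp add: sum_subtractf \<epsilon>_def flip: sum_distrib_right)
  also have "\<dots> \<le> real (k * card V) * (1 - \<tau>) - \<epsilon>"
    using of_nat_mono[OF D, where 'a = real] \<tau> by (intro diff_right_mono mult_right_mono) auto
  finally have mean: "(\<Sum>e\<in>E. measure_pmf.expectation ?M (X e)) + \<epsilon> \<le> real (k * card (V - T))"
    using cT by simp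
  have "real (card {f \<in> ?F. k * card (V - T) < (\<Sum>e\<in>E. d e - card (f ` S e \<inter> T))}) / ?n ^ card P
      = measure_pmf.prob ?M {f. k * card (V - T) < (\<Sum>e\<in>E. d e - card (f ` S e \<inter> T))}"
    using F by (simp add: measure_pmf_of_set Int_def)
  also have "\<dots> \<le> measure_pmf.prob ?M {f \<in> space (measure_pmf ?M). (\<Sum>e\<in>E. X e f) \<ge> (\<Sum>e\<in>E. measure_pmf.expectation ?M (X e)) + \<epsilon>}"
  proof (intro measure_pmf.finite_measure_mono)
    show "{f. k * card (V - T) < (\<Sum>e\<in>E. d e - card (f ` S e \<inter> T))} \<subseteq>
      {f \<in> space (measure_pmf ?M). (\<Sum>e\<in>E. X e f) \<ge> (\<Sum>e\<in>E. measure_pmf.expectation ?M (X e)) + \<epsilon>}"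
    proof
      fix f assume "f \<in> {f. k * card (V - T) < (\<Sum>e\<in>E. d e - card (f ` S e \<inter> T))}"
      hence "real (k * card (V - T)) \<le> real (\<Sum>e\<in>E. d e - card (f ` S e \<inter> T))" by (intro of_nat_mono) simp
      also have "\<dots> = (\<Sum>e\<in>E. X e f)" by (simp add: X_def)
      finally show "f \<in> {f \<in> space (measure_pmf ?M). (\<Sum>e\<in>E. X e f) \<ge> (\<Sum>e\<in>E. measure_pmf.expectation ?M (X e)) + \<epsilon>}"
        using mean by simp
    qed
  qed auto
  also have "\<dots> \<le> exp (- 2 * \<epsilon>\<^sup>2 / (\<Sum>e\<in>E. (real w - 0)\<^sup>2))"
    using \<epsilon> m hw by (intro Hoeffding_ineq_ge) auto
  also have "- 2 * \<epsilon>\<^sup>2 / (\<Sum>e\<in>E. (real w - 0)\<^sup>2) = - (real (card E) * (\<tau> * (1 - \<tau>))\<^sup>2 / (2 * real h ^ 2 * real w ^ 2))"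
    using m hw by (simp add: \<epsilon>_def power2_eq_square field_simps)
  finally have "real (card {f \<in> ?F. k * card (V - T) < (\<Sum>e\<in>E. d e - card (f ` S e \<inter> T))})
      \<le> exp (- (real (card E) * (\<tau> * (1 - \<tau>))\<^sup>2 / (2 * real h ^ 2 * real w ^ 2))) * ?n ^ card P"
    using n by (subst (asm) pos_divide_le_eq) auto
  thus ?thesis unfolding S_def by (simp add: mult.commute)
qed

section \<open>Systems of hyperedges\<close>

text \<open>A hyperedge of size h - j demands w - j signs, so all hyperedges have the same surplus h
  - w of size over demand.\<close>

locale hyperedges =
  fixes P :: "'p set" and E :: "'e set" and \<pi> :: "'p \<Rightarrow> 'e" and d :: "'e \<Rightarrow> nat" and h w :: nat
  assumes finP: "finite P" and finE: "finite E" and \<pi>E: "\<pi> ` P \<subseteq> E"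
    and wh: "0 < w" "w < h"
    and dE: "\<And>e. e \<in> E \<Longrightarrow> 0 < d e \<and> d e \<le> w"
    and size: "\<And>e. e \<in> E \<Longrightarrow> card {p \<in> P. \<pi> p = e} = d e + (h - w)"
begin

definition S :: "'e \<Rightarrow> 'p set" where "S e = {p \<in> P. \<pi> p = e}"

lemma finS: "finite (S e)" by (simp add: S_def finP)

lemma card_S: "e \<in> E \<Longrightarrow> card (S e) = d e + (h - w)" using size by (simp add: S_def)

lemma d_less: "e \<in> E \<Longrightarrow> d e < card (S e)" using card_S wh by simp

lemma card_S_le: "card (S e) \<le> h"
proof (cases "e \<in> E")
  case True
  thus ?thesis using card_S[OF True] dE[OF True] wh by linarith
next
  case False
  hence "S e = {}" using \<pi>E by (auto simp: S_def)
  thus ?thesis by simp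
qed

lemma card_P: "card P = (\<Sum>e\<in>E. card (S e))"
  unfolding S_def using finP finE \<pi>E by (intro sum_card_fibres[symmetric]) auto

lemma card_P_le: "card P \<le> h * card E"
proof -
  have "card P \<le> (\<Sum>e\<in>E. h)" unfolding card_P by (intro sum_mono card_S_le)
  thus ?thesis by (simp add: mult.commute)
qed

lemma card_E_le: "card E \<le> (\<Sum>e\<in>E. d e)"
proof -
  have "(\<Sum>e\<in>E. 1) \<le> (\<Sum>e\<in>E. d e)" using dE by (intro sum_mono) (auto simp: Suc_le_eq)
  thus ?thesis by simp
qed

text \<open>The ratio d / (d + h - w) increases with d, and at d = w it equals w / h.\<close>

lemma h_demand_le: "h * (\<Sum>e\<in>E. d e) \<le> w * card P"
proof -
  have "h * d e \<le> w * card (S e)" if e: "e \<in> E" for e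
  proof -
    have "h * d e = w * d e + (h - w) * d e" using wh by (simp flip: add_mult_distrib)
    also have "\<dots> \<le> w * d e + (h - w) * w" using dE[OF e] by (intro add_left_mono mult_left_mono) auto
    also have "\<dots> = w * card (S e)" using card_S[OF e] by (simp add: algebra_simps)
    finally show ?thesis .
  qed
  thus ?thesis unfolding card_P sum_distrib_left by (intro sum_mono)
qed

text \<open>A single lost vertex is harmless, because a hyperedge has at least one place more than
  its demand.\<close>

definition degenerate :: "('p \<Rightarrow> 'v) \<Rightarrow> bool" where
  "degenerate f \<longleftrightarrow> (\<exists>e\<in>E. card (f ` S e) + 2 \<le> card (S e))"

definition repeats_meet :: "('p \<Rightarrow> 'v) \<Rightarrow> bool" where
  "repeats_meet f \<longleftrightarrow> (\<exists>e\<in>E. \<exists>e'\<in>E. e \<noteq> e' \<and> \<not> inj_on f (S e) \<and> \<not> inj_on f (S e') \<and> f ` S e \<inter> f ` S e' \<noteq> {})"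

definition partial_edges :: "('p \<Rightarrow> 'v) \<Rightarrow> 'v set \<Rightarrow> 'e set" where
  "partial_edges f U = {e \<in> E. 2 \<le> card {p \<in> S e. f p \<in> U}}"

definition deficit :: "('p \<Rightarrow> 'v) \<Rightarrow> 'v set \<Rightarrow> nat" where
  "deficit f T = (\<Sum>e\<in>E. d e - card (f ` S e \<inter> T))"

text \<open>An edge with at most one place in \<open>U\<close> keeps \<open>d e\<close> distinct vertices outside \<open>U\<close> unless it has a
  repeated vertex; the edges with repeated vertices that meet \<open>U\<close> are at most \<open>card U\<close> many.\<close>

lemma deficit_small_set:
  assumes f: "f \<in> P \<rightarrow> V" and V: "finite V" "U \<subseteq> V" and nd: "\<not> degenerate f" and nm: "\<not> repeats_meet f"
  shows "(\<Sum>e\<in>E. d e - card (f ` S e - U)) \<le> w * card (partial_edges f U) + w * card U"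
proof -
  let ?R = "{e \<in> E. \<not> inj_on f (S e) \<and> f ` S e \<inter> U \<noteq> {}}"
  have finU: "finite U" using V finite_subset by blast
  have bound: "d e - card (f ` S e - U) \<le> w * of_bool (e \<in> partial_edges f U) + w * of_bool (e \<in> ?R)" if e: "e \<in> E" for e
  proof (cases "e \<in> partial_edges f U \<or> e \<in> ?R")
    case True
    thus ?thesis using dE[OF e] by auto
  next
    case False
    hence one: "card {p \<in> S e. f p \<in> U} \<le> 1" using e by (auto simp: partial_edges_def)
    have "d e \<le> card (f ` S e - U)"
    proof (cases "f ` S e \<inter> U = {}")
      case True
      hence "f ` S e - U = f ` S e" by auto
      moreover have "card (S e) < card (f ` S e) + 2" using nd e by (auto simp: degenerate_def)
      ultimately show ?thesis using d_less[OF e] by simp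
    next
      case F2: False
      hence inj: "inj_on f (S e)" using False e by auto
      have "f ` S e - U = f ` (S e - {p \<in> S e. f p \<in> U})" by auto
      also have "card \<dots> = card (S e - {p \<in> S e. f p \<in> U})"
        by (intro card_image inj_on_subset[OF inj]) auto
      also have "\<dots> = card (S e) - card {p \<in> S e. f p \<in> U}"
        using finS by (intro card_Diff_subset) auto
      finally show ?thesis using one d_less[OF e] by simp
    qed
    thus ?thesis by simp
  qed
  have "(\<Sum>e\<in>E. d e - card (f ` S e - U)) \<le> (\<Sum>e\<in>E. w * of_bool (e \<in> partial_edges f U) + w * of_bool (e \<in> ?R))"
    by (intro sum_mono bound)
  also have "\<dots> = w * card (E \<inter> partial_edges f U) + w * card (E \<inter> ?R)"
    using finE by (simp add: sum.distrib of_bool_def sum.If_cases Int_def flip: sum_distrib_left)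
  also have "E \<inter> partial_edges f U = partial_edges f U" by (auto simp: partial_edges_def)
  also have "E \<inter> ?R = ?R" by auto
  also have "card ?R \<le> card U"
  proof (rule card_inj_on_le)
    \<comment> \<open>Each hyperedge with a repeat picks a vertex of \<open>U\<close>. The choice is
      injective because two such hyperedges share no vertex.\<close>
    let ?v = "\<lambda>e. SOME v. v \<in> f ` S e \<inter> U"
    have v: "?v e \<in> f ` S e \<inter> U" if "e \<in> ?R" for e
      using someI_ex[of "\<lambda>v. v \<in> f ` S e \<inter> U"] that by blast
    show "?v ` ?R \<subseteq> U" using v by blast
    show "inj_on ?v ?R"
    proof (rule inj_onI)
      fix e e' assume e: "e \<in> ?R" "e' \<in> ?R" "?v e = ?v e'"
      have "?v e \<in> f ` S e \<inter> f ` S e'" using v[OF e(1)] v[OF e(2)] e(3) by auto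
      thus "e = e'" using nm e(1,2) unfolding repeats_meet_def by blast
    qed
  qed (rule finU)
  finally show ?thesis by simp
qed

text \<open>Demands are positive, so every hyperedge that meets T can place at least one sign
  there.\<close>

lemma deficit_le_touched:
  assumes f: "f \<in> P \<rightarrow> V"
  shows "deficit f T + card (\<pi> ` {p \<in> P. f p \<in> T}) \<le> (\<Sum>e\<in>E. d e)"
proof -
  let ?A = "\<pi> ` {p \<in> P. f p \<in> T}"
  have AE: "?A \<subseteq> E" using \<pi>E by auto
  have "deficit f T + card ?A = (\<Sum>e\<in>E. (d e - card (f ` S e \<inter> T)) + of_bool (e \<in> ?A))"
    using finE AE by (simp add: deficit_def sum.distrib of_bool_def sum.If_cases Int_absorb1)
  also have "\<dots> \<le> (\<Sum>e\<in>E. d e)"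
  proof (intro sum_mono)
    fix e assume e: "e \<in> E"
    show "(d e - card (f ` S e \<inter> T)) + of_bool (e \<in> ?A) \<le> d e"
    proof (cases "e \<in> ?A")
      case True
      then obtain p where "p \<in> P" "f p \<in> T" "e = \<pi> p" by auto
      hence "f ` S e \<inter> T \<noteq> {}" by (auto simp: S_def)
      hence "card (f ` S e \<inter> T) > 0" using finS by (simp add: card_gt_0_iff)
      hence "(d e - card (f ` S e \<inter> T)) + 1 \<le> d e" using dE[OF e] by linarith
      thus ?thesis using True by simp
    qed simp
  qed
  finally show ?thesis .
qed

text \<open>For small U, hyperedges partially contained in U and those with repeats that meet U cost
  at most w each. Property A bounds the former cost by k |U| / 2, and \<open>2 * w \<le> k\<close>
  does the same for the latter.\<close>

lemma orientable:
  fixes f :: "'p \<Rightarrow> 'v" and \<gamma> \<delta> :: real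
  assumes f: "f \<in> P \<rightarrow> V" and V: "finite V"
    and nd: "\<not> degenerate f" and nm: "\<not> repeats_meet f" and k: "2 * w \<le> k"
    and A: "\<And>U. U \<subseteq> V \<Longrightarrow> U \<noteq> {} \<Longrightarrow> real (card U) < \<gamma> * real (card V) \<Longrightarrow>
      real (card (partial_edges f U)) < real k * real (card U) / (2 * real w)"
    and mid: "\<And>T. T \<subseteq> V \<Longrightarrow> \<delta> * real (card V) < real (card T) \<Longrightarrow> \<gamma> * real (card V) \<le> real (card (V - T)) \<Longrightarrow>
      deficit f T \<le> k * card (V - T)"
    and small: "\<And>T. T \<subseteq> V \<Longrightarrow> real (card T) \<le> \<delta> * real (card V) \<Longrightarrow> deficit f T \<le> k * card (V - T)"
  shows "\<exists>\<sigma>. (\<forall>e\<in>E. \<sigma> e \<subseteq> f ` S e \<and> card (\<sigma> e) = d e) \<and> (\<forall>v\<in>V. card {e\<in>E. v \<in> \<sigma> e} \<le> k)"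
proof (rule hall_demand_capacity[OF finE V])
  show fV: "f ` S e \<subseteq> V" if "e \<in> E" for e using f by (auto simp: S_def)
  fix U assume U: "U \<subseteq> V"
  show "(\<Sum>e\<in>E. d e - card (f ` S e - U)) \<le> k * card U"
  proof (cases "real (card U) < \<gamma> * real (card V)")
    case True
    have le: "(\<Sum>e\<in>E. d e - card (f ` S e - U)) \<le> w * card (partial_edges f U) + w * card U"
      by (rule deficit_small_set[OF f V U nd nm])
    show ?thesis
    proof (cases "U = {}")
      case True
      hence "partial_edges f U = {}" by (simp add: partial_edges_def)
      thus ?thesis using le True by simp
    next
      case False
      have "real (w * card (partial_edges f U)) \<le> real w * (real k * real (card U) / (2 * real w))"
        using A[OF U False True] by (simp only: of_nat_mult) (intro mult_left_mono, auto)
      also have "\<dots> = real k * real (card U) / 2" using wh by simp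
      finally have 1: "real (w * card (partial_edges f U)) \<le> real k * real (card U) / 2" .
      have "real (2 * w) * real (card U) \<le> real k * real (card U)"
        using k by (intro mult_right_mono of_nat_mono) auto
      hence 2: "real (w * card U) \<le> real k * real (card U) / 2" by simp
      have "real (w * card (partial_edges f U) + w * card U) \<le> real (k * card U)"
        unfolding of_nat_add using 1 2 by simp
      thus ?thesis using le by (simp only: of_nat_le_iff)
    qed
  next
    case False
    define T where "T = V - U"
    have T: "T \<subseteq> V" "V - T = U" using U by (auto simp: T_def)
    have "f ` S e - U = f ` S e \<inter> T" if "e \<in> E" for e using fV[OF that] by (auto simp: T_def)
    hence eq: "(\<Sum>e\<in>E. d e - card (f ` S e - U)) = deficit f T" unfolding deficit_def by (intro sum.cong) auto
    show ?thesis unfolding eq using mid[OF T(1)] small[OF T(1)] False T(2) by fastforce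
  qed
qed

lemma count_degenerate:
  fixes V :: "'v set"
  assumes "finite V" "6 < card P"
  shows "real (card {f \<in> occ_le q L P V. degenerate f})
    \<le> (real (card E) * real h ^ 4) * ((real L / (real (card P) - 6)) ^ 2 * real (card (occ_le q L P V)))"
  unfolding degenerate_def S_def
  by (rule card_degenerate_edge[OF finP assms finE]) (rule card_S_le[unfolded S_def])

lemma count_repeats_meet:
  fixes V :: "'v set"
  assumes "finite V" "6 < card P"
  shows "real (card {f \<in> occ_le q L P V. repeats_meet f})
    \<le> (real (card E) ^ 2 * real h ^ 6) * ((real L / (real (card P) - 6)) ^ 3 * real (card (occ_le q L P V)))"
  unfolding repeats_meet_def S_def
  by (rule card_meeting_repeats[OF finP assms finE]) (rule card_S_le[unfolded S_def])

text \<open>The Hoeffding bound for all functions is divided by the lower bound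
  \<open>nocc_ge\<close>. The loss e (k + 1) per vertex and the 2^n sets T leave a base of at most
  1/2 by \<open>K3\<close>.\<close>

lemma count_mid:
  fixes V :: "'v::countable set" and \<gamma> \<delta> :: real
  assumes V: "finite V" "V \<noteq> {}" and k: "0 < k"
    and ne: "(k + 1) * card V \<le> card P" and D: "(\<Sum>e\<in>E. d e) \<le> k * card V"
    and \<gamma>: "0 < \<gamma>" "\<gamma> < 1" "0 < \<delta>" "\<delta> < 1"
    and n: "2 * real w * real h ^ 3 \<le> \<delta> * \<gamma> * real (card V)"
    and K3: "4 * exp 1 * (real k + 1) \<le> exp (real k * (\<delta> * \<gamma>)\<^sup>2 / (2 * real h ^ 3 * real w ^ 2))"
  shows "real (card {f \<in> occ (k + 1) P V. \<exists>T\<subseteq>V. \<delta> * real (card V) < real (card T) \<and>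
      \<gamma> * real (card V) \<le> real (card (V - T)) \<and> k * card (V - T) < deficit f T})
    \<le> (1 / 2) ^ card V * real (card (occ (k + 1) P V))"
proof -
  \<comment> \<open>The Hoeffding exponent per vertex, from at least k n / h hyperedges and \<tau>
    (1 - \<tau>) >= \<delta> \<gamma>.\<close>
  define x where "x = real k * (\<delta> * \<gamma>)\<^sup>2 / (2 * real h ^ 3 * real w ^ 2)"
  let ?n = "card V"
  let ?I = "{T. T \<subseteq> V \<and> \<delta> * real (card V) < real (card T) \<and> \<gamma> * real (card V) \<le> real (card (V - T))}"
  let ?B = "\<lambda>T. {f \<in> P \<rightarrow>\<^sub>E V. k * card (V - T) < deficit f T}"
  have n0: "real ?n > 0" using V by (simp add: card_gt_0_iff)
  have hw: "real h > 0" "real w > 0" using wh by auto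
  have E: "E \<noteq> {}"
  proof
    assume "E = {}"
    hence "card P = 0" using card_P_le by simp
    thus False using ne n0 by simp
  qed
  have finF: "finite (P \<rightarrow>\<^sub>E V)" using finP V by (auto intro: finite_PiE)
  have "real (card {f \<in> occ (k + 1) P V. \<exists>T\<subseteq>V. \<delta> * real (card V) < real (card T) \<and>
      \<gamma> * real (card V) \<le> real (card (V - T)) \<and> k * card (V - T) < deficit f T}) \<le> 2 ^ ?n * (real ?n ^ card P * exp (- (real ?n * x)))"
  proof (rule card_union_bound[where I = ?I and B = ?B])
    show "finite ?I" using V by auto
    show "{f \<in> occ (k + 1) P V. \<exists>T\<subseteq>V. \<delta> * real (card V) < real (card T) \<and>
      \<gamma> * real (card V) \<le> real (card (V - T)) \<and> k * card (V - T) < deficit f T} \<subseteq> (\<Union>T\<in>?I. ?B T)"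
      unfolding occ_def by blast
    show "finite (?B T)" for T using finF by simp
    have "card ?I \<le> card (Pow V)" using V by (intro card_mono) auto
    thus "real (card ?I) \<le> 2 ^ ?n" using V by (simp add: card_Pow)
    show "real (card (?B T)) \<le> real ?n ^ card P * exp (- (real ?n * x))" if "T \<in> ?I" for T
    proof -
      have T: "T \<subseteq> V" "\<delta> * real ?n < real (card T)" "\<gamma> * real ?n \<le> real (card (V - T))" using that by auto
      define \<tau> where "\<tau> = real (card T) / real ?n"
      have cT: "card (V - T) = ?n - card T" "card T \<le> ?n"
        using V T(1) finite_subset[OF T(1) V(1)] by (auto simp: card_Diff_subset card_mono)
      have "\<delta> \<le> \<tau>" using T(2) n0 by (simp add: \<tau>_def field_simps)
      moreover have "\<gamma> \<le> 1 - \<tau>" using T(3) n0 cT by (simp add: \<tau>_def field_simps of_nat_diff)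
      ultimately have \<tau>: "\<delta> * \<gamma> \<le> \<tau> * (1 - \<tau>)" using \<gamma> by (intro mult_mono) auto
      have "real (card (?B T)) \<le> real ?n ^ card P * exp (- (real (card E) * (\<tau> * (1 - \<tau>))\<^sup>2 / (2 * real h ^ 2 * real w ^ 2)))"
        unfolding deficit_def S_def \<tau>_def
      proof (rule card_total_deficit_large[OF finP V T(1) finE E _ D])
        show "0 < d e \<and> d e < card {p \<in> P. \<pi> p = e} \<and> card {p \<in> P. \<pi> p = e} \<le> h \<and> d e \<le> w" if "e \<in> E" for e
          using dE[OF that] d_less[OF that] card_S_le[of e] by (simp add: S_def)
        have "real w * real h ^ 2 / real ?n \<le> \<delta> * \<gamma> / (2 * real h)"
          using n n0 hw by (simp add: field_simps power2_eq_square power3_eq_cube)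
        also have "\<dots> \<le> \<tau> * (1 - \<tau>) / (2 * real h)" using \<tau> by (intro divide_right_mono) auto
        finally show "real w * real h ^ 2 / real ?n \<le> real (card T) / real ?n * (1 - real (card T) / real ?n) / (2 * real h)"
          by (simp add: \<tau>_def)
      qed
      also have "\<dots> \<le> real ?n ^ card P * exp (- (real ?n * x))"
      proof (intro mult_left_mono iffD2[OF exp_le_cancel_iff] iffD2[OF neg_le_iff_le])
        have "k * ?n \<le> h * card E" using ne card_P_le by (simp add: algebra_simps)
        hence "real (k * ?n) \<le> real (h * card E)" by (rule of_nat_mono)
        hence m: "real k * real ?n / real h \<le> real (card E)" using hw by (simp add: field_simps)
        have "real ?n * x = (real k * real ?n / real h) * (\<delta> * \<gamma>)\<^sup>2 / (2 * real h ^ 2 * real w ^ 2)"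
          by (simp add: x_def power3_eq_cube power2_eq_square mult_ac)
        also have "\<dots> \<le> real (card E) * (\<tau> * (1 - \<tau>))\<^sup>2 / (2 * real h ^ 2 * real w ^ 2)"
          by (intro divide_right_mono mult_mono[OF m power_mono[OF \<tau>]]) (use \<gamma> in auto)
        finally show "real ?n * x \<le> real (card E) * (\<tau> * (1 - \<tau>))\<^sup>2 / (2 * real h ^ 2 * real w ^ 2)" .
      qed auto
      finally show ?thesis .
    qed
  qed auto
  also have "\<dots> \<le> 2 ^ ?n * (((exp 1 * real (k + 1)) ^ ?n * real (nocc (k + 1) (card P) ?n)) * exp (- (real ?n * x)))"
    using nocc_ge[of "k + 1" ?n "card P"] ne n0 by (intro mult_left_mono mult_right_mono) auto
  also have "\<dots> = (2 * (exp 1 * real (k + 1)) * exp (- x)) ^ ?n * real (nocc (k + 1) (card P) ?n)"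
  proof -
    have "exp (- (real ?n * x)) = exp (- x) ^ ?n" by (simp flip: exp_of_nat_mult)
    thus ?thesis by (simp only: power_mult_distrib mult_ac)
  qed
  also have "\<dots> \<le> (1 / 2) ^ ?n * real (nocc (k + 1) (card P) ?n)"
  proof (intro mult_right_mono power_mono)
    have "4 * exp 1 * (real k + 1) * exp (- x) \<le> exp x * exp (- x)" using K3 by (intro mult_right_mono) (auto simp: x_def)
    moreover have "exp x * exp (- x) = 1" by (simp add: exp_minus)
    ultimately have "4 * exp 1 * (real k + 1) * exp (- x) \<le> 1" by simp
    moreover have "2 * (exp 1 * real (k + 1)) * exp (- x) = (4 * exp 1 * (real k + 1) * exp (- x)) / 2" by simp
    ultimately show "2 * (exp 1 * real (k + 1)) * exp (- x) \<le> 1 / 2" by linarith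
  qed auto
  finally show ?thesis using finP V by (simp add: card_occ)
qed

text \<open>The union over the sets of size t costs exactly the binomial built into
  \<open>card_few_touched_edges\<close>. The remaining (1/4)^t is small only because t exceeds
  \<epsilon> n / k; bounded t would leave a constant.\<close>

lemma count_small:
  fixes V :: "'v set" and c \<delta> \<epsilon> :: real
  assumes V: "finite V" "V \<noteq> {}"
    and c: "0 < c" "c \<le> 1 / 8" and kc: "1 \<le> c\<^sup>2 * real k"
    and kb: "2 * exp 1 * (real k + 1) * exp (c / 8 * (1 - c\<^sup>2 * real k)) \<le> c / 8"
    and K1: "768 * exp 1 ^ 2 * real h * real k ^ 2 \<le> (1 + c / 2) powr (c * real k)"
    and K2: "32 * exp 1 ^ 2 * real h ^ 2 / c \<le> 2 powr (c * real k)"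
    and M: "(1 + 4 * c) * real k * real (card V) \<le> real (card P)"
    and \<delta>: "0 < \<delta>" "4 * exp 1 * real h ^ 2 * \<delta> \<le> c" and \<epsilon>: "0 < \<epsilon>"
  shows "real (card {f \<in> occ (k + 1) P V. \<exists>T\<subseteq>V. real (card T) \<le> \<delta> * real (card V) \<and>
      \<epsilon> * real (card V) < real k * real (card T) \<and> card (\<pi> ` {p \<in> P. f p \<in> T}) < k * card T})
    \<le> real (card V + 1) * ((1 / 4) powr (\<epsilon> * real (card V) / real k) * real (card (occ (k + 1) P V)))"
proof -
  let ?n = "card V" and ?Z = "real (card (occ (k + 1) P V))"
  let ?I = "{t. t \<le> ?n \<and> real t \<le> \<delta> * real ?n \<and> \<epsilon> * real ?n < real k * real t}"
  let ?B = "\<lambda>T. {f \<in> occ (k + 1) P V. card (\<pi> ` {p \<in> P. f p \<in> T}) < k * card T}"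
  let ?C = "\<lambda>t. \<Union>T\<in>{T. T \<subseteq> V \<and> card T = t}. ?B T"
  have n0: "real ?n > 0" using V by (simp add: card_gt_0_iff)
  have k: "real k > 0" using kc by (cases k) auto
  have h1: "real h \<ge> 1" using wh by simp
  have finB: "finite (?B T)" for T using finP V by (simp add: finite_occ)
  have finT: "finite {T. T \<subseteq> V \<and> card T = t}" for t using V by simp
  show ?thesis
  proof (rule card_union_bound[where I = ?I and B = ?C])
    show "finite ?I" by simp
    show "{f \<in> occ (k + 1) P V. \<exists>T\<subseteq>V. real (card T) \<le> \<delta> * real (card V) \<and>
      \<epsilon> * real (card V) < real k * real (card T) \<and> card (\<pi> ` {p \<in> P. f p \<in> T}) < k * card T} \<subseteq> (\<Union>t\<in>?I. ?C t)"
      using V by (auto intro!: card_mono)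
    show "finite (?C t)" for t using finB finT by blast
    have "card ?I \<le> card {..?n}" by (intro card_mono) auto
    thus "real (card ?I) \<le> real (?n + 1)" by simp
    show "real (card (?C t)) \<le> (1 / 4) powr (\<epsilon> * real (card V) / real k) * ?Z" if "t \<in> ?I" for t
    proof -
      have tI: "real t \<le> \<delta> * real ?n" "\<epsilon> * real ?n < real k * real t" using that by auto
      have "\<epsilon> * real ?n > 0" using \<epsilon> n0 by simp
      hence t0: "t > 0" using tI(2) by (cases t) auto
      have A: "4 * exp 1 * real h ^ 2 * real t \<le> c * real ?n"
      proof -
        have "4 * exp 1 * real h ^ 2 * real t \<le> 4 * exp 1 * real h ^ 2 * (\<delta> * real ?n)" using tI by (intro mult_left_mono) auto
        also have "\<dots> = (4 * exp 1 * real h ^ 2 * \<delta>) * real ?n" by simp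
        also have "\<dots> \<le> c * real ?n" using \<delta> by (intro mult_right_mono) auto
        finally show ?thesis .
      qed
      have e1: "exp 1 \<ge> (1::real)" by simp
      have "1 * 1 * real h * real t \<le> exp 1 * real h * real h * real t"
        using h1 e1 by (intro mult_mono) auto
      hence "4 * (real h * real t) \<le> c * real ?n" using A by (simp add: power2_eq_square mult_ac)
      also have "\<dots> \<le> 1 / 8 * real ?n" using c by (intro mult_right_mono) auto
      finally have ht: "32 * (real h * real t) \<le> real ?n" by simp
      have "real (2 * h * t) \<le> real ?n" using ht by simp
      hence ht2: "2 * h * t \<le> ?n" by (simp only: of_nat_le_iff)
      have "1 * real t \<le> real h * real t" using h1 by (intro mult_right_mono) auto
      hence "real (4 * t) \<le> real ?n" using ht by simp
      hence t4: "4 * t \<le> ?n" by (simp only: of_nat_le_iff)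
      interpret dense_occupancy k "card P" ?n t c
        by unfold_locales (use c kc kb M t0 t4 in auto)
      have binpos: "real (?n choose t) > 0" using t4 by (simp add: zero_less_binomial)
      have "real (card (?C t)) \<le> real (?n choose t) * ((1 / 4) ^ t * ?Z / real (?n choose t))"
      proof (rule card_union_bound[where I = "{T. T \<subseteq> V \<and> card T = t}" and B = ?B])
        show "real (card {T. T \<subseteq> V \<and> card T = t}) \<le> real (?n choose t)" using V by (simp add: n_subsets)
        show "real (card (?B T)) \<le> (1 / 4) ^ t * ?Z / real (?n choose t)" if "T \<in> {T. T \<subseteq> V \<and> card T = t}" for T
        proof -
          have T: "T \<subseteq> V" "card T = t" using that by auto
          have "real (card {f \<in> occ (k + 1) P V. card (\<pi> ` {p \<in> P. f p \<in> T}) < k * t}) * real (?n choose t)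
              \<le> (1 / 4) ^ t * real (nocc (k + 1) (card P) ?n)"
            using wh card_S_le by (intro card_few_touched_edges[OF finP refl V(1) refl T _ _ ht2 A K1 K2]) (auto simp: S_def)
          thus ?thesis using binpos finP V T by (simp add: card_occ pos_le_divide_eq)
        qed
      qed (use finB finT in auto)
      also have "\<dots> = (1 / 4) ^ t * ?Z" using binpos by simp
      also have "\<dots> \<le> (1 / 4) powr (\<epsilon> * real ?n / real k) * ?Z"
      proof (intro mult_right_mono)
        have "\<epsilon> * real ?n / real k \<le> real t" using tI(2) k by (simp add: pos_divide_le_eq mult.commute)
        hence "(1 / 4 :: real) powr real t \<le> (1 / 4) powr (\<epsilon> * real ?n / real k)" by (intro powr_mono') auto
        thus "(1 / 4) ^ t \<le> (1 / 4 :: real) powr (\<epsilon> * real ?n / real k)" by (simp add: powr_realpow)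
      qed simp
      finally show ?thesis .
    qed
  qed auto
qed

end

text \<open>The solution \<delta> of 4 e h^2 \<delta> = c with c = 1 / (8 w): up to this relative
  size of T the price of a redundant place in the range of large x is at most 1/2.\<close>

definition sparse_fraction :: "nat \<Rightarrow> nat \<Rightarrow> real" where
  "sparse_fraction h w = 1 / (32 * exp 1 * real w * real h ^ 2)"

text \<open>With \<open>c = 1 / (8 w)\<close>, total demand above \<open>(1 - 1 / (4 w)) k n\<close> forces at least
  \<open>(1 + 4 c) k n\<close> places, since a hyperedge is larger than its demand by a factor at least \<open>h / w\<close>.\<close>

definition large_capacity :: "nat \<Rightarrow> nat \<Rightarrow> real \<Rightarrow> nat \<Rightarrow> bool" where
  "large_capacity h w \<gamma> k \<longleftrightarrow> (let c = 1 / (8 * real w) in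
     2 * w \<le> k \<and> 1 \<le> c\<^sup>2 * real k \<and>
     2 * exp 1 * (real k + 1) * exp (c / 8 * (1 - c\<^sup>2 * real k)) \<le> c / 8 \<and>
     768 * exp 1 ^ 2 * real h * real k ^ 2 \<le> (1 + c / 2) powr (c * real k) \<and>
     32 * exp 1 ^ 2 * real h ^ 2 / c \<le> 2 powr (c * real k) \<and>
     4 * exp 1 * (real k + 1) \<le> exp (real k * (sparse_fraction h w * \<gamma>)\<^sup>2 / (2 * real h ^ 3 * real w ^ 2)))"

text \<open>The terms bound, in this order, the events that some degree is at least \<open>k + 1 + j\<close>, that an
  edge is degenerate, that two edges with repeats meet, that a large set is bad, and that a small
  set is bad.\<close>

definition failure_bound :: "nat \<Rightarrow> nat \<Rightarrow> real \<Rightarrow> nat \<Rightarrow> nat \<Rightarrow> real" where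
  "failure_bound h k \<epsilon> j n = real n * (real h * real k) ^ j / fact j
     + real k * real h ^ 4 * (real k + 1 + real j) ^ 2 / real n
     + real k ^ 2 * real h ^ 6 * (real k + 1 + real j) ^ 3 / real n
     + (1 / 2) ^ n + real (n + 1) * (1 / 4) powr (\<epsilon> * real n / real k)"

lemma eventually_large_capacity:
  assumes "0 < w" "w < h" "0 < \<gamma>"
  shows "eventually (large_capacity h w \<gamma>) sequentially"
proof -
  define c where "c = 1 / (8 * real w)"
  define x where "x = (sparse_fraction h w * \<gamma>)\<^sup>2 / (2 * real h ^ 3 * real w ^ 2)"
  have c: "c > 0" using assms by (simp add: c_def)
  have x: "x > 0" using assms by (simp add: x_def sparse_fraction_def)
  have h: "real h > 0" using assms by simp
  have "eventually (\<lambda>k. 2 * real w \<le> real k) sequentially" by real_asymp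
  moreover have "eventually (\<lambda>k::nat. 1 \<le> c\<^sup>2 * real k) sequentially" using c by real_asymp
  moreover have "eventually (\<lambda>k::nat. 2 * exp 1 * (real k + 1) * exp (c / 8 * (1 - c\<^sup>2 * real k)) \<le> c / 8) sequentially"
    using c by real_asymp
  moreover have "eventually (\<lambda>k::nat. 768 * exp 1 ^ 2 * real h * real k ^ 2 \<le> (1 + c / 2) powr (c * real k)) sequentially"
    using c h by real_asymp
  moreover have "eventually (\<lambda>k::nat. 32 * exp 1 ^ 2 * real h ^ 2 / c \<le> 2 powr (c * real k)) sequentially"
    using c by real_asymp
  moreover have "eventually (\<lambda>k::nat. 4 * exp 1 * (real k + 1) \<le> exp (real k * x)) sequentially"
    using x by real_asymp
  ultimately show ?thesis
  proof eventually_elim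
    case (elim k)
    have "2 * w \<le> k" using elim(1) by (simp flip: of_nat_le_iff[where 'a = real])
    thus ?case using elim unfolding large_capacity_def Let_def c_def[symmetric] by (simp add: x_def)
  qed
qed

text \<open>The degree cap must let j! outgrow n (h k)^j while j^3 / n still vanishes; the exponent
  1/4 allows both.\<close>

lemma failure_bound_tendsto:
  assumes "0 < k" "0 < h" "0 < \<epsilon>"
  shows "(\<lambda>n. failure_bound h k \<epsilon> (nat \<lfloor>real n powr (1 / 4)\<rfloor>) n) \<longlonglongrightarrow> 0"
proof -
  define j where "j n = nat \<lfloor>real n powr (1 / 4)\<rfloor>" for n :: nat
  define A B a where "A = real k * real h ^ 4" and "B = real k ^ 2 * real h ^ 6" and "a = \<epsilon> / real k"
  define K where "K = real k + 1"
  have pos: "A > 0" "B > 0" "a > 0" "K > 0" using assms by (auto simp: A_def B_def a_def K_def)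
  have j: "real (j n) \<le> real n powr (1 / 4)" "real n powr (1 / 4) - 1 \<le> real (j n)" for n
  proof -
    have "0 \<le> real n powr (1 / 4)" by simp
    thus "real (j n) \<le> real n powr (1 / 4)" "real n powr (1 / 4) - 1 \<le> real (j n)"
      unfolding j_def by linarith+
  qed
  have lim: "(\<lambda>n. real n * (1 / 2) powr (real n powr (1 / 4) - 1) + A * (K + real n powr (1 / 4)) ^ 2 / real n
     + B * (K + real n powr (1 / 4)) ^ 3 / real n
     + (1 / 2) ^ n + (real n + 1) * 4 powr (- (a * real n))) \<longlonglongrightarrow> 0"
    using pos by (intro tendsto_add_zero) real_asymp+
  have lower: "eventually (\<lambda>n. 0 \<le> failure_bound h k \<epsilon> (j n) n) sequentially"
    using assms by (intro always_eventually) (auto simp: failure_bound_def)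
  have upper: "eventually (\<lambda>n. failure_bound h k \<epsilon> (j n) n \<le> real n * (1 / 2) powr (real n powr (1 / 4) - 1)
     + A * (K + real n powr (1 / 4)) ^ 2 / real n + B * (K + real n powr (1 / 4)) ^ 3 / real n
     + (1 / 2) ^ n + (real n + 1) * 4 powr (- (a * real n))) sequentially"
  proof -
    \<comment> \<open>From there on 2 e h k <= j, and (h k)^j / j! is at most 2^(-j).\<close>
    have "eventually (\<lambda>n. 2 * exp 1 * (real h * real k) + 1 \<le> real n powr (1 / 4) - 1) sequentially" by real_asymp
    thus ?thesis
    proof eventually_elim
      case (elim n)
      have hk: "real h * real k > 0" using assms by simp
      have "2 * exp 1 * (real h * real k) > 0" using hk by simp
      hence jn: "2 * exp 1 * (real h * real k) \<le> real (j n)" "real (j n) > 0" using elim j(2)[of n] by linarith+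
      have "(real h * real k) ^ j n / fact (j n) \<le> (real h * real k) ^ j n / (real (j n) / exp 1) ^ j n"
        using jn hk by (intro divide_left_mono fact_ge_exp mult_pos_pos) auto
      also have "\<dots> = (exp 1 * (real h * real k) / real (j n)) ^ j n"
        using jn by (simp add: power_divide power_mult_distrib)
      also have "\<dots> \<le> (1 / 2) ^ j n" using jn hk by (intro power_mono) (auto simp: field_simps)
      also have "\<dots> = (1 / 2) powr real (j n)" by (simp add: powr_realpow)
      also have "\<dots> \<le> (1 / 2) powr (real n powr (1 / 4) - 1)" using j by (intro powr_mono') auto
      finally have "real n * ((real h * real k) ^ j n / fact (j n)) \<le> real n * (1 / 2) powr (real n powr (1 / 4) - 1)"
        by (intro mult_left_mono) auto
      hence 1: "real n * (real h * real k) ^ j n / fact (j n) \<le> real n * (1 / 2) powr (real n powr (1 / 4) - 1)" by simp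
      have 2: "A * (K + real (j n)) ^ i / real n \<le> A * (K + real n powr (1 / 4)) ^ i / real n"
        "B * (K + real (j n)) ^ i / real n \<le> B * (K + real n powr (1 / 4)) ^ i / real n" for i
        using pos j by (intro divide_right_mono mult_left_mono power_mono; simp)+
      have 3: "real (n + 1) * (1 / 4) powr (\<epsilon> * real n / real k) = (real n + 1) * 4 powr (- (a * real n))"
        by (simp add: a_def powr_divide powr_minus_divide)
      show ?case unfolding failure_bound_def 3 A_def[symmetric] B_def[symmetric] K_def[symmetric]
        by (intro add_mono 1 2 order_refl)
    qed
  qed
  have "(\<lambda>n. failure_bound h k \<epsilon> (j n) n) \<longlonglongrightarrow> 0"
    by (rule tendsto_sandwich[OF lower upper tendsto_const lim])
  thus ?thesis by (simp only: j_def)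
qed

section \<open>Union bound over the failure events\<close>

context hyperedges
begin

definition sparse :: "nat \<Rightarrow> real \<Rightarrow> 'v set \<Rightarrow> ('p \<Rightarrow> 'v) \<Rightarrow> bool" where
  "sparse k \<gamma> V f \<longleftrightarrow> (\<forall>U\<subseteq>V. U \<noteq> {} \<longrightarrow> real (card U) < \<gamma> * real (card V) \<longrightarrow>
     real (card (partial_edges f U)) < real k * real (card U) / (2 * real w))"

definition orientable_with :: "nat \<Rightarrow> 'v set \<Rightarrow> ('p \<Rightarrow> 'v) \<Rightarrow> bool" where
  "orientable_with k V f \<longleftrightarrow>
     (\<exists>\<sigma>. (\<forall>e\<in>E. \<sigma> e \<subseteq> f ` S e \<and> card (\<sigma> e) = d e) \<and> (\<forall>v\<in>V. card {e\<in>E. v \<in> \<sigma> e} \<le> k))"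

text \<open>A function outside the five failure events satisfies the premises of
  \<open>orientable\<close>. The small-set event is only needed when the total demand is close to k
  n, which also provides the density that its estimate requires.\<close>

lemma count_unorientable:
  fixes V :: "'v::countable set" and \<gamma> \<epsilon> :: real
  assumes V: "finite V" "6 \<le> card V" and k: "large_capacity h w \<gamma> k"
    and \<gamma>: "0 < \<gamma>" "\<gamma> < 1" and \<epsilon>: "0 < \<epsilon>"
    and D: "real (\<Sum>e\<in>E. d e) \<le> real k * real (card V) - \<epsilon> * real (card V)"
    and n: "2 * real w * real h ^ 3 \<le> sparse_fraction h w * \<gamma> * real (card V)"
  shows "real (card {f \<in> occ (k + 1) P V. sparse k \<gamma> V f \<and> \<not> orientable_with k V f})
    \<le> failure_bound h k \<epsilon> j (card V) * real (card (occ (k + 1) P V))"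
proof (cases "occ (k + 1) P V = {}")
  case True
  thus ?thesis by simp
next
  case False
  hence ne: "(k + 1) * card V \<le> card P" using occ_card_ge[OF finP V(1)] by blast
  define n where "n = card V"
  define \<delta> where "\<delta> = sparse_fraction h w"
  define c where "c = 1 / (8 * real w)"
  define L where "L = k + 1 + j"
  let ?Z = "real (card (occ (k + 1) P V))" and ?D = "\<Sum>e\<in>E. d e"
  have K: "2 * w \<le> k" "1 \<le> c\<^sup>2 * real k"
     "2 * exp 1 * (real k + 1) * exp (c / 8 * (1 - c\<^sup>2 * real k)) \<le> c / 8"
     "768 * exp 1 ^ 2 * real h * real k ^ 2 \<le> (1 + c / 2) powr (c * real k)"
     "32 * exp 1 ^ 2 * real h ^ 2 / c \<le> 2 powr (c * real k)"
     "4 * exp 1 * (real k + 1) \<le> exp (real k * (\<delta> * \<gamma>)\<^sup>2 / (2 * real h ^ 3 * real w ^ 2))"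
    using k unfolding large_capacity_def Let_def c_def[symmetric] \<delta>_def by auto
  have Vne: "V \<noteq> {}" and n6: "6 \<le> real n" and n0: "real n > 0" using V by (auto simp: n_def)
  have kpos: "real k > 0" using K(1) wh by simp
  have w1: "real w \<ge> 1" and h1: "real h \<ge> 1" and hw1: "real w + 1 \<le> real h" using wh by auto
  have c: "0 < c" "c \<le> 1 / 8" using w1 by (auto simp: c_def field_simps)
  have \<delta>: "0 < \<delta>" "4 * exp 1 * real h ^ 2 * \<delta> \<le> c" "\<delta> \<le> 1 / (4 * real w)"
  proof -
    have e: "exp 1 \<ge> (1::real)" by simp
    have "1 * 1 * real w \<le> exp 1 * (real h ^ 2) * real w"
      using e h1 w1 by (intro mult_right_mono mult_mono) auto
    hence "4 * real w \<le> 32 * exp 1 * real w * real h ^ 2" using w1 by (simp add: mult_ac)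
    thus "\<delta> \<le> 1 / (4 * real w)" unfolding \<delta>_def sparse_fraction_def using w1 by (intro divide_left_mono) auto
    show "0 < \<delta>" "4 * exp 1 * real h ^ 2 * \<delta> \<le> c" using w1 h1 by (auto simp: \<delta>_def sparse_fraction_def c_def)
  qed
  have "1 / (4 * real w) \<le> 1 / 4" using w1 by (intro divide_left_mono) auto
  hence \<delta>1: "\<delta> < 1" using \<delta>(3) by linarith
  have Dk: "real ?D \<le> real k * real n" 
    using D mult_nonneg_nonneg[of \<epsilon> "real (card V)"] \<epsilon> unfolding n_def by linarith
  have Dk': "?D \<le> k * card V" using Dk by (simp only: n_def of_nat_le_iff flip: of_nat_mult)
  \<comment> \<open>The density gives |P| >= 2 n, and n >= 6 absorbs the six places excluded in the
    switching bounds.\<close>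
  have Mn: "real n \<le> real (card P) - 6" "6 < card P"
  proof -
    have "(1 + 1) * card V \<le> (k + 1) * card V" using K(1) wh by (intro mult_right_mono) auto
    from order_trans[OF this ne] have 2: "2 * card V \<le> card P" by simp
    thus "6 < card P" using V by linarith
    have "real (2 * card V) \<le> real (card P)" using 2 by (rule of_nat_mono)
    thus "real n \<le> real (card P) - 6" using n6 by (simp add: n_def)
  qed
  have mE: "real (card E) \<le> real k * real n"
    using of_nat_mono[OF card_E_le, where 'a = real] Dk by linarith
  have MP: "real (card P) \<le> real h * (real k * real n)"
  proof -
    have "real (card P) \<le> real (h * card E)" by (intro of_nat_mono card_P_le)
    also have "\<dots> \<le> real h * (real k * real n)" using mE by (simp add: mult_left_mono)
    finally show ?thesis .
  qed
  define B1 where "B1 = {f \<in> occ (k + 1) P V. \<exists>v\<in>V. (k + 1) + j \<le> card {p \<in> P. f p = v}}"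
  define B2 where "B2 = {f \<in> occ_le (k + 1) L P V. degenerate f}"
  define B3 where "B3 = {f \<in> occ_le (k + 1) L P V. repeats_meet f}"
  define B4 where "B4 = {f \<in> occ (k + 1) P V. \<exists>T\<subseteq>V. \<delta> * real (card V) < real (card T) \<and>
      \<gamma> * real (card V) \<le> real (card (V - T)) \<and> k * card (V - T) < deficit f T}"
  define B5 where "B5 = {f \<in> occ (k + 1) P V. real ?D > (1 - 1 / (4 * real w)) * (real k * real n) \<and>
     (\<exists>T\<subseteq>V. real (card T) \<le> \<delta> * real (card V) \<and>
      \<epsilon> * real (card V) < real k * real (card T) \<and> card (\<pi> ` {p \<in> P. f p \<in> T}) < k * card T)}"
  have fin: "finite (occ (k + 1) P V)" by (rule finite_occ[OF finP V(1)])
  have rL: "real k + 1 + real j = real L" by (simp add: L_def)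
  have leZ: "real (card (occ_le (k + 1) L P V)) \<le> ?Z"
    using fin by (intro of_nat_mono card_mono) (auto simp: occ_le_def)
  have Lr: "0 \<le> real L / (real (card P) - 6)" "real L / (real (card P) - 6) \<le> real L / real n"
    using Mn n0 by (auto intro: divide_left_mono)
  have c1: "real (card B1) \<le> real n * (real h * real k) ^ j / fact j * ?Z"
  proof -
    have "real (card B1) \<le> real n * (real (card P) / real n) ^ j / fact j * ?Z"
      unfolding B1_def n_def by (rule card_occ_max_degree[OF finP V(1) Vne])
    also have "\<dots> \<le> real n * (real h * real k) ^ j / fact j * ?Z"
      using MP n0 by (intro mult_right_mono divide_right_mono mult_left_mono power_mono) (auto simp: field_simps)
    finally show ?thesis .
  qed
  have c2: "real (card B2) \<le> real k * real h ^ 4 * (real k + 1 + real j) ^ 2 / real n * ?Z"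
  proof -
    have "real (card B2) \<le> (real (card E) * real h ^ 4) * ((real L / (real (card P) - 6)) ^ 2 * real (card (occ_le (k + 1) L P V)))"
      unfolding B2_def by (rule count_degenerate[OF V(1) Mn(2)])
    also have "\<dots> \<le> (real k * real n * real h ^ 4) * ((real L / real n) ^ 2 * ?Z)"
      using mE Lr leZ by (intro mult_mono power_mono mult_right_mono) auto
    also have "\<dots> = real k * real h ^ 4 * (real k + 1 + real j) ^ 2 / real n * ?Z"
      unfolding rL using n0 by (simp add: power2_eq_square)
    finally show ?thesis .
  qed
  have c3: "real (card B3) \<le> real k ^ 2 * real h ^ 6 * (real k + 1 + real j) ^ 3 / real n * ?Z"
  proof -
    have "real (card B3) \<le> (real (card E) ^ 2 * real h ^ 6) * ((real L / (real (card P) - 6)) ^ 3 * real (card (occ_le (k + 1) L P V)))"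
      unfolding B3_def by (rule count_repeats_meet[OF V(1) Mn(2)])
    also have "\<dots> \<le> ((real k * real n) ^ 2 * real h ^ 6) * ((real L / real n) ^ 3 * ?Z)"
      by (intro mult_mono[OF mult_right_mono[OF power_mono[OF mE]] mult_mono[OF power_mono[OF Lr(2,1)] leZ]])
        (use Lr(1) in simp_all)
    also have "\<dots> = real k ^ 2 * real h ^ 6 * (real k + 1 + real j) ^ 3 / real n * ?Z"
      unfolding rL using n0 by (simp add: power2_eq_square power3_eq_cube)
    finally show ?thesis .
  qed
  have c4: "real (card B4) \<le> (1 / 2) ^ n * ?Z"
    unfolding B4_def n_def
    by (rule count_mid[OF V(1) Vne _ ne Dk' \<gamma> \<delta>(1) \<delta>1 assms(8)[folded \<delta>_def] K(6)]) (use kpos in simp)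
  have c5: "real (card B5) \<le> real (n + 1) * (1 / 4) powr (\<epsilon> * real n / real k) * ?Z"
  proof (cases "real ?D > (1 - 1 / (4 * real w)) * (real k * real n)")
    case False
    hence "B5 = {}" by (auto simp: B5_def)
    thus ?thesis by simp
  next
    case True
    \<comment> \<open>From w |P| >= (w + 1) D and (w + 1) (1 - 1 / (4 w)) >= w + 1/2 = w (1 + 4c);
      the last equality is what fixes c = 1 / (8 w).\<close>
    have M: "(1 + 4 * c) * real k * real (card V) \<le> real (card P)"
    proof -
      have "real (h * ?D) \<le> real (w * card P)" by (intro of_nat_mono h_demand_le)
      hence "real h * real ?D \<le> real w * real (card P)" by simp
      moreover have "(real w + 1) * real ?D \<le> real h * real ?D" by (rule mult_right_mono[OF hw1 of_nat_0_le_iff])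
      moreover have "(real w + 1) * ((1 - 1 / (4 * real w)) * (real k * real n)) \<le> (real w + 1) * real ?D"
        using True by (intro mult_left_mono) auto
      ultimately have 1: "((real w + 1) * (1 - 1 / (4 * real w))) * (real k * real n) \<le> real w * real (card P)"
        unfolding mult.assoc by linarith
      have "1 / (4 * real w) \<le> 1 / 4" by fact
      moreover have "(real w + 1) * (1 - 1 / (4 * real w)) = real w + 1 - 1 / 4 - 1 / (4 * real w)"
        using w1 by (simp add: field_simps)
      ultimately have "real w + 1 / 2 \<le> (real w + 1) * (1 - 1 / (4 * real w))" by linarith
      hence "(real w + 1 / 2) * (real k * real n) \<le> ((real w + 1) * (1 - 1 / (4 * real w))) * (real k * real n)"
        by (rule mult_right_mono) simp
      also note 1
      also have "real w + 1 / 2 = real w * (1 + 4 * c)" using w1 by (simp add: c_def field_simps)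
      finally have "real w * ((1 + 4 * c) * real k * real n) \<le> real w * real (card P)" by (simp only: mult.assoc)
      hence "(1 + 4 * c) * real k * real n \<le> real (card P)" by (rule mult_left_le_imp_le) (use w1 in simp)
      thus ?thesis by (simp only: n_def)
    qed
    have "real (card B5) \<le> real (card {f \<in> occ (k + 1) P V. \<exists>T\<subseteq>V. real (card T) \<le> \<delta> * real (card V) \<and>
      \<epsilon> * real (card V) < real k * real (card T) \<and> card (\<pi> ` {p \<in> P. f p \<in> T}) < k * card T})"
      using fin by (intro of_nat_mono card_mono) (auto simp: B5_def)
    also have "\<dots> \<le> real (n + 1) * ((1 / 4) powr (\<epsilon> * real n / real k) * ?Z)"
      unfolding n_def by (rule count_small[OF V(1) Vne c K(2-5) M \<delta>(1,2) \<epsilon>])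
    finally show ?thesis by (simp add: mult.assoc)
  qed
  have "{f \<in> occ (k + 1) P V. sparse k \<gamma> V f \<and> \<not> orientable_with k V f} \<subseteq> B1 \<union> B2 \<union> B3 \<union> B4 \<union> B5"
  proof (rule ccontr)
    assume "\<not> ?thesis"
    then obtain f where f: "f \<in> occ (k + 1) P V" "sparse k \<gamma> V f" "\<not> orientable_with k V f"
      and nb: "f \<notin> B1" "f \<notin> B2" "f \<notin> B3" "f \<notin> B4" "f \<notin> B5" by blast
    have fle: "f \<in> occ_le (k + 1) L P V"
      using f(1) nb(1) unfolding occ_le_def B1_def L_def by (auto simp: not_le less_imp_le)
    have fP: "f \<in> P \<rightarrow> V" using f(1) unfolding occ_def by auto
    have "orientable_with k V f"
      unfolding orientable_with_def
    proof (rule orientable[OF fP V(1) _ _ K(1), where \<gamma> = \<gamma> and \<delta> = \<delta>])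
      show "\<not> degenerate f" "\<not> repeats_meet f" using fle nb(2,3) by (auto simp: B2_def B3_def)
      show "real (card (partial_edges f U)) < real k * real (card U) / (2 * real w)"
        if "U \<subseteq> V" "U \<noteq> {}" "real (card U) < \<gamma> * real (card V)" for U
        using f(2) that unfolding sparse_def by blast
      show "deficit f T \<le> k * card (V - T)"
        if "T \<subseteq> V" "\<delta> * real (card V) < real (card T)" "\<gamma> * real (card V) \<le> real (card (V - T))" for T
        using f(1) nb(4) that unfolding B4_def by (auto simp: not_less)
      show "deficit f T \<le> k * card (V - T)" if T: "T \<subseteq> V" "real (card T) \<le> \<delta> * real (card V)" for T
      proof -
        have cT: "card (V - T) = card V - card T" "card T \<le> card V"
          using V T(1) finite_subset[OF T(1) V(1)] by (auto simp: card_Diff_subset card_mono)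
        have "real (k * card (V - T)) = real k * (real n - real (card T))"
          using cT by (simp add: n_def of_nat_diff)
        hence kVT: "real (k * card (V - T)) = real k * real n - real k * real (card T)" by (simp add: algebra_simps)
        have touched: "real (deficit f T) + real (card (\<pi> ` {p \<in> P. f p \<in> T})) \<le> real ?D"
          using of_nat_mono[OF deficit_le_touched[OF fP, of T], where 'a = real] by simp
        have "real (deficit f T) \<le> real (k * card (V - T))"
        proof (cases "real ?D > (1 - 1 / (4 * real w)) * (real k * real n)")
          case False
          \<comment> \<open>Low demand: removing T takes away at most k n / (4 w) of the capacity,
            and the demand leaves that much free.\<close>
          have "real (card T) \<le> 1 / (4 * real w) * real n"
            using T(2) mult_right_mono[OF \<delta>(3), of "real n"] by (simp add: n_def)
          hence "real k * real (card T) \<le> real k * (1 / (4 * real w) * real n)" by (intro mult_left_mono) auto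
          moreover have "real ?D \<le> real k * real n - real k * (1 / (4 * real w) * real n)"
            using False by (simp add: algebra_simps)
          ultimately show ?thesis unfolding kVT using touched by linarith
        next
          case True
          show ?thesis
          proof (cases "\<epsilon> * real (card V) < real k * real (card T)")
            case True2: True
            have "\<not> card (\<pi> ` {p \<in> P. f p \<in> T}) < k * card T"
              using nb(5) f(1) True True2 T unfolding B5_def by blast
            hence "real (k * card T) \<le> real (card (\<pi> ` {p \<in> P. f p \<in> T}))" by (intro of_nat_mono) simp
            hence "real k * real (card T) \<le> real (card (\<pi> ` {p \<in> P. f p \<in> T}))" by simp
            thus ?thesis unfolding kVT using touched Dk by linarith
          next
            case False
            \<comment> \<open>Here k t <= \<epsilon> n, and the slack in the demand covers the lost
              capacity without any randomness.\<close>
            have "real ?D \<le> real k * real n - \<epsilon> * real (card V)" using D by (simp add: n_def)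
            thus ?thesis unfolding kVT using touched False by linarith
          qed
        qed
        thus ?thesis by (simp only: of_nat_le_iff)
      qed
    qed
    with f(3) show False by contradiction
  qed
  hence "card {f \<in> occ (k + 1) P V. sparse k \<gamma> V f \<and> \<not> orientable_with k V f} \<le> card (B1 \<union> B2 \<union> B3 \<union> B4 \<union> B5)"
    using fin by (intro card_mono) (auto simp: B1_def B2_def B3_def B4_def B5_def occ_le_def)
  also have "\<dots> \<le> card B1 + card B2 + card B3 + card B4 + card B5"
    using card_Un_le[of B1 B2] card_Un_le[of "B1 \<union> B2" B3] card_Un_le[of "B1 \<union> B2 \<union> B3" B4]
      card_Un_le[of "B1 \<union> B2 \<union> B3 \<union> B4" B5] by linarith
  finally have "real (card {f \<in> occ (k + 1) P V. sparse k \<gamma> V f \<and> \<not> orientable_with k V f})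
      \<le> real (card B1 + card B2 + card B3 + card B4 + card B5)" by (rule of_nat_mono)
  also have "\<dots> \<le> failure_bound h k \<epsilon> j n * ?Z"
    using c1 c2 c3 c4 c5 unfolding failure_bound_def distrib_right of_nat_add by linarith
  finally show ?thesis by (simp add: n_def)
qed

end

section \<open>The random multihypergraph\<close>

lemma cond_pmf_of_set:
  assumes "finite A" "A \<inter> s \<noteq> {}"
  shows "cond_pmf (pmf_of_set A) s = pmf_of_set (A \<inter> s)"
proof (rule pmf_eqI)
  fix x
  have A: "A \<noteq> {}" using assms by auto
  have c: "card (A \<inter> s) > 0" "card A > 0" using assms A by (auto simp: card_gt_0_iff)
  have "set_pmf (pmf_of_set A) \<inter> s \<noteq> {}" using assms A by simp
  thus "pmf (cond_pmf (pmf_of_set A) s) x = pmf (pmf_of_set (A \<inter> s)) x"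
    using assms A c by (auto simp: pmf_cond measure_pmf_of_set indicator_def)
qed

lemma size_filter_image_mset_set:
  "finite A \<Longrightarrow> size {#v \<in># image_mset g (mset_set A). Q v#} = card {b \<in> A. Q (g b)}"
  by (simp add: filter_mset_image_mset)

lemma count_eq_size_filter: "count M v = size {#x \<in># M. x = v#}"
  by (induction M) auto

lemma finite_places: "finite (places h w m)"
  by (simp add: places_def)

abbreviation hyperedge_of :: "nat \<times> nat \<times> nat \<Rightarrow> nat \<times> nat" where
  "hyperedge_of p \<equiv> (case p of (i, a, b) \<Rightarrow> (i, a))"

lemma edge_places:
  assumes "i \<in> {h - w + 1..h}" "a \<in> {1..m i}"
  shows "{p \<in> places h w m. hyperedge_of p = (i, a)} = (\<lambda>b. (i, a, b)) ` {1..i}"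
  using assms by (auto simp: places_def)

lemma hyperedges_places:
  assumes "0 < w" "w < h"
  shows "hyperedges (places h w m) (SIGMA i:{h - w + 1..h}. {1..m i}) hyperedge_of (\<lambda>(i, a). i - (h - w)) h w"
proof
  show "card {p \<in> places h w m. hyperedge_of p = e} = (case e of (i, a) \<Rightarrow> i - (h - w)) + (h - w)"
    if e: "e \<in> (SIGMA i:{h - w + 1..h}. {1..m i})" for e
  proof -
    obtain i a where ia: "e = (i, a)" "i \<in> {h - w + 1..h}" "a \<in> {1..m i}" using e by auto
    show ?thesis unfolding ia(1) using edge_places[of i h w a m] ia(2,3)
      by (simp add: card_image inj_on_def)
  qed
qed (use assms finite_places in \<open>auto simp: places_def\<close>)

lemma degree_multihypergraph_of:
  "degree (multihypergraph_of h w n m f) v = card {p \<in> places h w m. f p = v}"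
proof -
  have "degree (multihypergraph_of h w n m f) v = (\<Sum>(i, a)\<in>(SIGMA i:{h - w + 1..h}. {1..m i}). card {b \<in> {1..i}. f (i, a, b) = v})"
    unfolding degree_def multihypergraph_of_def
    by (auto intro!: sum.cong simp: count_eq_size_filter size_filter_image_mset_set)
  also have "\<dots> = card (SIGMA (i, a):(SIGMA i:{h - w + 1..h}. {1..m i}). {b \<in> {1..i}. f (i, a, b) = v})"
    by (subst card_SigmaI) (auto simp: split_beta)
  also have "\<dots> = card {p \<in> places h w m. f p = v}"
    by (rule bij_betw_same_card[where f = "\<lambda>((i, a), b). (i, a, b)"],
        rule bij_betwI[where g = "\<lambda>(i, a, b). ((i, a), b)"]) (auto simp: places_def)
  finally show ?thesis .
qed

lemma min_degree_multihypergraph_of: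
  "f \<in> places h w m \<rightarrow>\<^sub>E {1..n} \<Longrightarrow>
    min_degree_ge q (multihypergraph_of h w n m f) \<longleftrightarrow> f \<in> occ q (places h w m) {1..n}"
  by (simp add: min_degree_ge_def degree_multihypergraph_of occ_def) (simp add: multihypergraph_of_def)

text \<open>Conditioning commutes with the map from functions to multihypergraphs, and the minimum
  degree event pulls back to \<open>occ\<close>. Feasibility is what makes that set
  nonempty.\<close>

lemma prob_random_multihypergraph_min_degree:
  assumes "0 < n" "min_degree_feasible h w n m q"
  shows "measure_pmf.prob (random_multihypergraph_min_degree h w n m q) X =
    real (card {f \<in> occ q (places h w m) {1..n}. multihypergraph_of h w n m f \<in> X}) /
      real (card (occ q (places h w m) {1..n}))"
    and "occ q (places h w m) {1..n} \<noteq> {}"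
proof -
  let ?F = "places h w m \<rightarrow>\<^sub>E {1..n}" and ?O = "occ q (places h w m) {1..n}"
  let ?mk = "multihypergraph_of h w n m"
  have F: "finite ?F" "?F \<noteq> {}" using assms(1) by (auto simp: finite_places PiE_eq_empty_iff intro!: finite_PiE)
  have O: "?F \<inter> ?mk -` {G. min_degree_ge q G} = ?O"
    using min_degree_multihypergraph_of[of _ h w m n q] by (auto simp: occ_def)
  show ne: "?O \<noteq> {}"
    using assms(2) F min_degree_multihypergraph_of[of _ h w m n q]
    unfolding min_degree_feasible_def random_multihypergraph_def by auto
  have "random_multihypergraph_min_degree h w n m q = map_pmf ?mk (cond_pmf (pmf_of_set ?F) (?mk -` {G. min_degree_ge q G}))"
    unfolding random_multihypergraph_min_degree_def random_multihypergraph_def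
    using F ne O by (intro cond_map_pmf) auto
  also have "cond_pmf (pmf_of_set ?F) (?mk -` {G. min_degree_ge q G}) = pmf_of_set ?O"
    using F ne O cond_pmf_of_set[of ?F "?mk -` {G. min_degree_ge q G}"] by simp
  finally have "random_multihypergraph_min_degree h w n m q = map_pmf ?mk (pmf_of_set ?O)" .
  moreover have "finite ?O" by (simp add: finite_occ finite_places)
  ultimately show "measure_pmf.prob (random_multihypergraph_min_degree h w n m q) X =
    real (card {f \<in> ?O. ?mk f \<in> X}) / real (card ?O)"
    using ne by (simp add: measure_pmf_of_set vimage_def Int_def)
qed

lemma sum_demands:
  fixes h w :: nat and m :: "nat \<Rightarrow> nat"
  assumes "w < h"
  shows "(\<Sum>(i, a)\<in>(SIGMA i:{h - w + 1..h}. {1..m i}). i - (h - w)) = (\<Sum>j<w. (w - j) * m (h - j))"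
proof -
  have "(\<Sum>(i, a)\<in>(SIGMA i:{h - w + 1..h}. {1..m i}). i - (h - w)) = (\<Sum>i\<in>{h - w + 1..h}. \<Sum>a\<in>{1..m i}. i - (h - w))"
    by (rule sum.Sigma[symmetric]) auto
  also have "\<dots> = (\<Sum>i\<in>{h - w + 1..h}. m i * (i - (h - w)))" by simp
  also have "\<dots> = (\<Sum>j<w. (w - j) * m (h - j))"
    by (rule sum.reindex_bij_witness[where i = "\<lambda>j. h - j" and j = "\<lambda>i. h - i"]) (use assms in auto)
  finally show ?thesis .
qed

lemma prob_bound:
  fixes \<gamma> \<epsilon> :: real
  assumes wh: "0 < w" "w < h" and k: "large_capacity h w \<gamma> k" and \<gamma>: "0 < \<gamma>" "\<gamma> < 1" and \<epsilon>: "0 < \<epsilon>"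
    and n: "6 \<le> n" "2 * real w * real h ^ 3 \<le> sparse_fraction h w * \<gamma> * real n"
    and D: "real (\<Sum>j<w. (w - j) * m (h - j)) \<le> real k * real n - \<epsilon> * real n"
    and feas: "min_degree_feasible h w n m (k + 1)"
  shows "1 - failure_bound h k \<epsilon> j n \<le> measure_pmf.prob (random_multihypergraph_min_degree h w n m (k + 1))
               {G. has_orientation h w k G \<or> \<not> property_A w k \<gamma> G}"
proof -
  let ?P = "places h w m" and ?V = "{1..n}"
  let ?E = "SIGMA i:{h - w + 1..h}. {1..m i}"
  let ?O = "occ (k + 1) ?P ?V" and ?mk = "multihypergraph_of h w n m"
  interpret hyperedges ?P ?E hyperedge_of "\<lambda>(i, a). i - (h - w)" h w
    by (rule hyperedges_places[OF wh])
  have n0: "0 < n" using n by simp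
  note prob = prob_random_multihypergraph_min_degree[OF n0 feas]
  have finO: "finite ?O" by (simp add: finite_occ finite_places)
  have cO: "real (card ?O) > 0" using prob(2) finO by (simp add: card_gt_0_iff)
  have S: "S (i, a) = (\<lambda>b. (i, a, b)) ` {1..i}" if "(i, a) \<in> ?E" for i a
    using that edge_places[of i h w a m] by (auto simp: S_def)
  have ends: "set_mset (ends (?mk f) e) = f ` S e" if "e \<in> ?E" for e f
  proof -
    obtain i a where e: "e = (i, a)" by (cases e)
    show ?thesis using that S[of i a] unfolding e by (auto simp: multihypergraph_of_def image_image)
  qed
  have part: "partially_contained (ends (?mk f) e) U \<longleftrightarrow> 2 \<le> card {p \<in> S e. f p \<in> U}" if "e \<in> ?E" for e f U
  proof -
    obtain i a where e: "e = (i, a)" by (cases e)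
    have img: "{p \<in> S e. f p \<in> U} = (\<lambda>b. (i, a, b)) ` {b \<in> {1..i}. f (i, a, b) \<in> U}"
      using that S[of i a] unfolding e by auto
    have "card {p \<in> S e. f p \<in> U} = card {b \<in> {1..i}. f (i, a, b) \<in> U}"
      unfolding img by (rule card_image) (simp add: inj_on_def)
    thus ?thesis unfolding e partially_contained_def multihypergraph_of_def
      by (simp add: size_filter_image_mset_set)
  qed
  have sparse: "sparse k \<gamma> ?V f" if "property_A w k \<gamma> (?mk f)" for f
    unfolding sparse_def
  proof (intro allI impI)
    fix U assume U: "U \<subseteq> ?V" "U \<noteq> {}" "real (card U) < \<gamma> * real (card ?V)"
    have 1: "{e \<in> hedges (?mk f). partially_contained (ends (?mk f) e) U} = partial_edges f U"
      unfolding partial_edges_def using part by (auto simp: multihypergraph_of_def simp del: mem_Sigma_iff)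
    have 2: "verts (?mk f) = ?V" by (simp add: multihypergraph_of_def)
    show "real (card (partial_edges f U)) < real k * real (card U) / (2 * real w)"
      using spec[OF that[unfolded property_A_def], of U] U unfolding 1 2 by blast
  qed
  have orient: "has_orientation h w k (?mk f)" if "orientable_with k ?V f" for f
  proof -
    obtain \<sigma> where \<sigma>: "\<And>e. e \<in> ?E \<Longrightarrow> \<sigma> e \<subseteq> f ` S e \<and> card (\<sigma> e) = (case e of (i, a) \<Rightarrow> i - (h - w))"
      "\<And>v. v \<in> ?V \<Longrightarrow> card {e \<in> ?E. v \<in> \<sigma> e} \<le> k"
      using \<open>orientable_with k ?V f\<close> unfolding orientable_with_def by blast
    have "is_orientation h w k (?mk f) \<sigma>"
      unfolding is_orientation_def
    proof (intro conjI ballI)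
      fix e assume "e \<in> hedges (?mk f)"
      hence e: "e \<in> ?E" by (simp add: multihypergraph_of_def)
      then obtain i a where ia: "e = (i, a)" "h - w + 1 \<le> i" "i \<le> h" by auto
      have "size (ends (?mk f) e) = h - (h - i)" using ia by (simp add: multihypergraph_of_def)
      moreover have "oriented (?mk f) \<sigma> (w - (h - i)) e"
        using \<sigma>(1)[OF e] ends[OF e] ia wh unfolding oriented_def by simp
      moreover have "h - i < w" using ia wh by linarith
      ultimately show "\<exists>j<w. size (ends (?mk f) e) = h - j \<and> oriented (?mk f) \<sigma> (w - j) e" by blast
    next
      fix v assume "v \<in> verts (?mk f)"
      hence "v \<in> ?V" by (simp add: multihypergraph_of_def)
      thus "indegree (?mk f) \<sigma> v \<le> k" using \<sigma>(2) unfolding indegree_def by (simp add: multihypergraph_of_def)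
    qed
    thus ?thesis unfolding has_orientation_def by blast
  qed
  let ?good = "{f \<in> ?O. ?mk f \<in> {G. has_orientation h w k G \<or> \<not> property_A w k \<gamma> G}}"
  let ?bad = "{f \<in> ?O. sparse k \<gamma> ?V f \<and> \<not> orientable_with k ?V f}"
  have "real (\<Sum>e\<in>?E. case e of (i, a) \<Rightarrow> i - (h - w)) \<le> real k * real (card ?V) - \<epsilon> * real (card ?V)"
    using D unfolding sum_demands[OF wh(2)] by simp
  hence bad: "real (card ?bad) \<le> failure_bound h k \<epsilon> j (card ?V) * real (card ?O)"
    using n by (intro count_unorientable[OF _ _ k \<gamma> \<epsilon>]) auto
  have "?O \<subseteq> ?good \<union> ?bad" using sparse orient by auto
  hence "card ?O \<le> card (?good \<union> ?bad)" using finO by (intro card_mono) auto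
  also have "\<dots> \<le> card ?good + card ?bad" by (rule card_Un_le)
  finally have "real (card ?O) \<le> real (card ?good) + real (card ?bad)" by (simp flip: of_nat_add)
  hence "(1 - failure_bound h k \<epsilon> j n) * real (card ?O) \<le> real (card ?good)" using bad by (simp add: algebra_simps)
  thus ?thesis unfolding prob(1) using cO by (simp add: pos_le_divide_eq)
qed

text \<open>The limit is taken along those n for which the conditioning event has positive
  probability; if there are only finitely many, the filter is trivial and the limit holds
  vacuously.\<close>

theorem theorem2p6:
  fixes h w :: nat and \<gamma> :: real
  assumes "0 < w" and "w < h" and "0 < \<gamma>" and "\<gamma> < 1"
  shows "\<exists>N::real. N > 0 \<and> (\<forall>k::nat. real k > N \<longrightarrow>
    (\<forall>\<epsilon>::real. \<epsilon> > 0 \<longrightarrow>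
    (\<forall>m :: nat \<Rightarrow> nat \<Rightarrow> nat.
      (\<forall>n>0. real (\<Sum>j<w. (w - j) * m n (h - j)) \<le> real k * real n - \<epsilon> * real n) \<longrightarrow>
      ((\<lambda>n. measure_pmf.prob (random_multihypergraph_min_degree h w n (m n) (k + 1))
               {G. has_orientation h w k G \<or> \<not> property_A w k \<gamma> G}) \<longlongrightarrow> 1)
        (inf sequentially (principal {n. min_degree_feasible h w n (m n) (k + 1)})))))"
proof -
  obtain N0 where N0: "\<And>k. k \<ge> N0 \<Longrightarrow> large_capacity h w \<gamma> k"
    using eventually_large_capacity[OF assms(1-3)] unfolding eventually_sequentially by blast
  show ?thesis
  \<comment> \<open>\<open>N0\<close> is fixed by h, w and \<gamma> alone, since
    \<open>large_capacity\<close> does not mention epsilon. Adding 1 keeps N positive when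
    \<open>N0\<close> is 0.\<close>
  proof (intro exI[of _ "real N0 + 1"] conjI allI impI)
    fix k :: nat and \<epsilon> :: real and m :: "nat \<Rightarrow> nat \<Rightarrow> nat"
    assume k: "real k > real N0 + 1" and \<epsilon>: "\<epsilon> > 0"
      and D: "\<forall>n>0. real (\<Sum>j<w. (w - j) * m n (h - j)) \<le> real k * real n - \<epsilon> * real n"
    let ?F = "inf sequentially (principal {n. min_degree_feasible h w n (m n) (k + 1)})"
    let ?p = "\<lambda>n. measure_pmf.prob (random_multihypergraph_min_degree h w n (m n) (k + 1))
               {G. has_orientation h w k G \<or> \<not> property_A w k \<gamma> G}"
    define b where "b n = failure_bound h k \<epsilon> (nat \<lfloor>real n powr (1 / 4)\<rfloor>) n" for n
    have K: "large_capacity h w \<gamma> k" using k by (intro N0) simp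
    have "b \<longlonglongrightarrow> 0" unfolding b_def using k \<epsilon> assms by (intro failure_bound_tendsto) auto
    hence lim: "((\<lambda>n. 1 - b n) \<longlongrightarrow> 1 - 0) ?F"
      by (intro tendsto_intros tendsto_mono[OF inf_le1])
    have \<gamma>': "0 < sparse_fraction h w * \<gamma>" using assms by (simp add: sparse_fraction_def)
    have "eventually (\<lambda>n. 2 * real w * real h ^ 3 \<le> sparse_fraction h w * \<gamma> * real n) sequentially"
      using \<gamma>' by real_asymp
    hence "eventually (\<lambda>n. min_degree_feasible h w n (m n) (k + 1) \<longrightarrow> 1 - b n \<le> ?p n) sequentially"
      using eventually_ge_at_top[of 6]
    proof eventually_elim
      case (elim n)
      show ?case unfolding b_def
        using elim D by (intro impI prob_bound[OF assms(1,2) K assms(3,4) \<epsilon>]) auto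
    qed
    hence "eventually (\<lambda>n. 1 - b n \<le> ?p n) ?F" by (simp add: eventually_inf_principal)
    moreover have "eventually (\<lambda>n. ?p n \<le> 1) ?F" by (intro always_eventually allI measure_pmf.prob_le_1)
    ultimately show "(?p \<longlongrightarrow> 1) ?F"
      using tendsto_sandwich[OF _ _ _ tendsto_const, of "\<lambda>n. 1 - b n" ?p ?F 1] lim by simp
  qed simp
qed

end
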